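(* For a fibrant double category $\mathbb{D}$, the following are equivalent: (1) $\mathbb{D}$ is Cartesian. (2) The category $D_0$ has finite products, the bicategory $\mathcal{H}(\mathbb{D})$ has finite products locally (every category $\mathcal H(\mathbb D)(A,B)$ has finite products), and the induced lax double functors $\times:\mathbb{D}\times\mathbb{D}\to\mathbb{D}$ and $I:\mathbb{1}\to\mathbb{D}$ are pseudo.
   Context: A (pseudo) double category $\mathbb D$ consists of: a category $D_0$ (objects and vertical arrows of $\mathbb D$); a category $D_1$ (its objects are called horizontal arrows, its arrows cells); functors $S,T:D_1\to D_0$, $U:D_0\to D_1$ and $\odot:D_1\times_{D_0}D_1\to D_1$ (defined on pairs $(M,N)$ with $SM=TN$) such that $SU=TU=\mathrm{id}$, $S(M\odot N)=SN$, $T(M\odot N)=TM$; and natural isomorphisms $(M\odot N)\odot P\cong M\odot(N\odot P)$, $U_{TM}\odot M\cong M$, $M\odot U_{SM}\cong M$ in $D_1$ whose components have identity source and target under $S,T$ and satisfy the pentagon and triangle axioms. Write $M:A\nrightarrow B$ if $SM=A$, $TM=B$. A cell $\alpha:M\to N$ with $S\alpha=f$, $T\alpha=g$ has sides $(f,g)$; it is globular if both sides are identities. $\mathcal H(\mathbb D)$ is the bicategory of objects, horizontal arrows and globular cells, with composition $\odot$. A lax double functor $F:\mathbb B\to\mathbb D$ consists of functors $F_0:B_0\to D_0$, $F_1:B_1\to D_1$ commuting with $S,T$ and natural globular cells $F_1M\odot F_1N\to F_1(M\odot N)$, $U_{F_0A}\to F_1U_A$ satisfying the usual coherence axioms; it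 is a (pseudo) double functor if these are invertible. A vertical natural transformation $F\to G$ is a pair of natural transformations $\phi_0:F_0\to G_0$, $\phi_1:F_1\to G_1$ with $S\phi_M=\phi_{SM}$, $T\phi_M=\phi_{TM}$, compatible with the structure cells. $\mathbf{DblCat}$ is the 2-category of double categories, double functors and vertical natural transformations. $\mathbb D$ is Cartesian if the diagonal $\Delta:\mathbb D\to\mathbb D\times\mathbb D$ and the unique $!:\mathbb D\to\mathbb 1$ have right adjoints in $\mathbf{DblCat}$. A cell $\alpha:M\to N$ with sides $(f,g)$ is Cartesian if every cell $M'\to N$ with sides $(fh,gk)$ factors as $\alpha\circ\gamma$ for a unique cell $\gamma:M'\to M$ with sides $(h,k)$. $\mathbb D$ is fibrant if for all vertical $f:A\to B$, $g:C\to D$ and $M:B\nrightarrow D$ there is a Cartesian cell into $M$ with sides $(f,g)$; its domain is denoted $g^*Mf_*:A\nrightarrow C$. The induced lax double functors: if $\mathbb D$ is fibrant, $D_0$ has finite products (projections $p_1,p_2$, terminal object $I$) and $\mathcal H(\mathbb D)$ has finite products locally (binary products $\wedge$, terminal objects $\top_{A,B}$), then $D_1$ has finite products: for $M:A\nrightarrow B$, $N:X\nrightarrow Y$, $M\times N=(p_1^*M{p_1}_* )\wedge(p_2^*N{p_2}_* ):A\times X\nrightarrow B\times Y$, with projections the composites of the local projections with the Cartesian cells $p_1^*M{p_1}_*\to M$ (sides $(p_1,p_1)$) and $p_2^*N{p_2}_*\to N$ (sides $(p_2,p_2)$), and terminal object $\top_{I,I}$. The product functors on $D_0$ and $D_1$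 form a lax double functor $\times:\mathbb D\times\mathbb D\to\mathbb D$ with structure cells the canonical cells $(M'\times N')\odot(M\times N)\to(M'\odot M)\times(N'\odot N)$ and $U_{A\times B}\to U_A\times U_B$ induced by the universal property of products in $D_1$; similarly $I:\mathbb 1\to\mathbb D$ picks out $I$ and $\top_{I,I}$, with structure cells the unique globular ones. *)

theory Defs
  imports Main
begin

section \<open>Categories, functors, natural transformations\<close>

text \<open>
  Categories have explicit carriers. Composition is written in the usual (applicative)
  order; all operations are total functions and are only meaningful on the carriers.
\<close>

record ('o, 'a) cat =
  Obj :: "'o set"
  Arr :: "'a set"
  Dom :: "'a \<Rightarrow> 'o"
  Cod :: "'a \<Rightarrow> 'o"
  Ide :: "'o \<Rightarrow> 'a"
  Cmp :: "'a \<Rightarrow> 'a \<Rightarrow> 'a"  (infixl "\<cdot>\<index>" 70)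

definition hom_set :: "('o, 'a) cat \<Rightarrow> 'o \<Rightarrow> 'o \<Rightarrow> 'a set" where
  "hom_set C A B = {f \<in> Arr C. Dom C f = A \<and> Cod C f = B}"

locale category =
  fixes C :: "('o, 'a) cat" (structure)
  assumes dom_closed: "f \<in> Arr C \<Longrightarrow> Dom C f \<in> Obj C"
    and cod_closed: "f \<in> Arr C \<Longrightarrow> Cod C f \<in> Obj C"
    and ide_closed: "A \<in> Obj C \<Longrightarrow> Ide C A \<in> hom_set C A A"
    and cmp_closed: "\<lbrakk>f \<in> hom_set C A B; g \<in> hom_set C B E\<rbrakk> \<Longrightarrow> g \<cdot> f \<in> hom_set C A E"
    and cmp_ide_right: "f \<in> Arr C \<Longrightarrow> f \<cdot> Ide C (Dom C f) = f"
    and cmp_ide_left: "f \<in> Arr C \<Longrightarrow> Ide C (Cod C f) \<cdot> f = f"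
    and cmp_assoc: "\<lbrakk>f \<in> Arr C; g \<in> Arr C; h \<in> Arr C; Cod C f = Dom C g; Cod C g = Dom C h\<rbrakk>
      \<Longrightarrow> (h \<cdot> g) \<cdot> f = h \<cdot> (g \<cdot> f)"

definition is_iso :: "('o, 'a) cat \<Rightarrow> 'a \<Rightarrow> bool" where
  "is_iso C f \<longleftrightarrow> f \<in> Arr C \<and>
     (\<exists>g \<in> hom_set C (Cod C f) (Dom C f).
        g \<cdot>\<^bsub>C\<^esub> f = Ide C (Dom C f) \<and> f \<cdot>\<^bsub>C\<^esub> g = Ide C (Cod C f))"

record ('o, 'a, 'p, 'b) ftor =
  onO :: "'o \<Rightarrow> 'p"
  onA :: "'a \<Rightarrow> 'b"

definition is_functor ::
    "('o, 'a) cat \<Rightarrow> ('p, 'b) cat \<Rightarrow> ('o, 'a, 'p, 'b) ftor \<Rightarrow> bool" where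
  "is_functor C D F \<longleftrightarrow>
     (\<forall>A \<in> Obj C. onO F A \<in> Obj D) \<and>
     (\<forall>f \<in> Arr C. onA F f \<in> hom_set D (onO F (Dom C f)) (onO F (Cod C f))) \<and>
     (\<forall>A \<in> Obj C. onA F (Ide C A) = Ide D (onO F A)) \<and>
     (\<forall>f \<in> Arr C. \<forall>g \<in> Arr C. Cod C f = Dom C g \<longrightarrow>
        onA F (g \<cdot>\<^bsub>C\<^esub> f) = onA F g \<cdot>\<^bsub>D\<^esub> onA F f)"

definition is_nat_trans ::
    "('o, 'a) cat \<Rightarrow> ('p, 'b) cat \<Rightarrow> ('o, 'a, 'p, 'b) ftor \<Rightarrow> ('o, 'a, 'p, 'b) ftor
      \<Rightarrow> ('o \<Rightarrow> 'b) \<Rightarrow> bool" where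
  "is_nat_trans C D F G \<tau> \<longleftrightarrow>
     (\<forall>A \<in> Obj C. \<tau> A \<in> hom_set D (onO F A) (onO G A)) \<and>
     (\<forall>f \<in> Arr C. \<tau> (Cod C f) \<cdot>\<^bsub>D\<^esub> onA F f = onA G f \<cdot>\<^bsub>D\<^esub> \<tau> (Dom C f))"

definition id_ftor :: "('o, 'a, 'o, 'a) ftor" where
  "id_ftor = \<lparr>onO = (\<lambda>A. A), onA = (\<lambda>f. f)\<rparr>"

definition comp_ftor ::
    "('p, 'b, 'q, 'c) ftor \<Rightarrow> ('o, 'a, 'p, 'b) ftor \<Rightarrow> ('o, 'a, 'q, 'c) ftor" where
  "comp_ftor G F = \<lparr>onO = onO G \<circ> onO F, onA = onA G \<circ> onA F\<rparr>"

definition prod_cat :: "('o, 'a) cat \<Rightarrow> ('p, 'b) cat \<Rightarrow> ('o \<times> 'p, 'a \<times> 'b) cat" where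
  "prod_cat C D = \<lparr>
     Obj = Obj C \<times> Obj D,
     Arr = Arr C \<times> Arr D,
     Dom = map_prod (Dom C) (Dom D),
     Cod = map_prod (Cod C) (Cod D),
     Ide = map_prod (Ide C) (Ide D),
     Cmp = (\<lambda>(g, g') (f, f'). (g \<cdot>\<^bsub>C\<^esub> f, g' \<cdot>\<^bsub>D\<^esub> f'))\<rparr>"

definition unit_cat :: "(unit, unit) cat" where
  "unit_cat = \<lparr>Obj = {()}, Arr = {()}, Dom = (\<lambda>_. ()), Cod = (\<lambda>_. ()),
     Ide = (\<lambda>_. ()), Cmp = (\<lambda>_ _. ())\<rparr>"


section \<open>Finite products in a category\<close>

definition is_product :: "('o, 'a) cat \<Rightarrow> 'o \<Rightarrow> 'o \<Rightarrow> 'o \<Rightarrow> 'a \<Rightarrow> 'a \<Rightarrow> bool" where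
  "is_product C A B P p q \<longleftrightarrow>
     P \<in> Obj C \<and> p \<in> hom_set C P A \<and> q \<in> hom_set C P B \<and>
     (\<forall>X. \<forall>f \<in> hom_set C X A. \<forall>g \<in> hom_set C X B.
        \<exists>!h. h \<in> hom_set C X P \<and> p \<cdot>\<^bsub>C\<^esub> h = f \<and> q \<cdot>\<^bsub>C\<^esub> h = g)"

definition is_terminal :: "('o, 'a) cat \<Rightarrow> 'o \<Rightarrow> bool" where
  "is_terminal C I \<longleftrightarrow> I \<in> Obj C \<and> (\<forall>X \<in> Obj C. \<exists>!h. h \<in> hom_set C X I)"

definition has_finite_products :: "('o, 'a) cat \<Rightarrow> bool" where
  "has_finite_products C \<longleftrightarrow>
     (\<exists>I. is_terminal C I) \<and>
     (\<forall>A \<in> Obj C. \<forall>B \<in> Obj C. \<exists>P p q. is_product C A B P p q)"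

text \<open>A choice of binary products and of a terminal object.\<close>

record ('o, 'a) prods =
  pob :: "'o \<Rightarrow> 'o \<Rightarrow> 'o"
  pr1 :: "'o \<Rightarrow> 'o \<Rightarrow> 'a"
  pr2 :: "'o \<Rightarrow> 'o \<Rightarrow> 'a"
  tob :: "'o"

definition chosen_products :: "('o, 'a) cat \<Rightarrow> ('o, 'a) prods \<Rightarrow> bool" where
  "chosen_products C X \<longleftrightarrow>
     is_terminal C (tob X) \<and>
     (\<forall>A \<in> Obj C. \<forall>B \<in> Obj C. is_product C A B (pob X A B) (pr1 X A B) (pr2 X A B))"

text \<open>The arrow into the chosen product with components \<open>f\<close> and \<open>g\<close> (of equal domain).\<close>

definition pairing :: "('o, 'a) cat \<Rightarrow> ('o, 'a) prods \<Rightarrow> 'a \<Rightarrow> 'a \<Rightarrow> 'a" where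
  "pairing C X f g =
     (THE h. h \<in> hom_set C (Dom C f) (pob X (Cod C f) (Cod C g)) \<and>
        pr1 X (Cod C f) (Cod C g) \<cdot>\<^bsub>C\<^esub> h = f \<and>
        pr2 X (Cod C f) (Cod C g) \<cdot>\<^bsub>C\<^esub> h = g)"

definition product_ftor ::
    "('o, 'a) cat \<Rightarrow> ('o, 'a) prods \<Rightarrow> ('o \<times> 'o, 'a \<times> 'a, 'o, 'a) ftor" where
  "product_ftor C X = \<lparr>
     onO = (\<lambda>(A, B). pob X A B),
     onA = (\<lambda>(f, g). pairing C X (f \<cdot>\<^bsub>C\<^esub> pr1 X (Dom C f) (Dom C g))
                                (g \<cdot>\<^bsub>C\<^esub> pr2 X (Dom C f) (Dom C g)))\<rparr>"


section \<open>Pseudo double categories\<close>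

text \<open>
  \<open>D0\<close>: objects and vertical arrows; \<open>D1\<close>: horizontal arrows and cells.
  \<open>assoc M N P : (M \<odot> N) \<odot> P \<rightarrow> M \<odot> (N \<odot> P)\<close>, \<open>lunit M : U (T M) \<odot> M \<rightarrow> M\<close>,
  \<open>runit M : M \<odot> U (S M) \<rightarrow> M\<close>.
\<close>

record ('o, 'v, 'h, 'c) dblcat =
  D0 :: "('o, 'v) cat"
  D1 :: "('h, 'c) cat"
  Src :: "('h, 'c, 'o, 'v) ftor"
  Tgt :: "('h, 'c, 'o, 'v) ftor"
  Uni :: "('o, 'v, 'h, 'c) ftor"
  HComp :: "('h \<times> 'h, 'c \<times> 'c, 'h, 'c) ftor"
  assoc :: "'h \<Rightarrow> 'h \<Rightarrow> 'h \<Rightarrow> 'c"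
  lunit :: "'h \<Rightarrow> 'c"
  runit :: "'h \<Rightarrow> 'c"

text \<open>Horizontal composition of horizontal arrows (\<open>\<odot>\<close>) and of cells (\<open>\<star>\<close>).\<close>

abbreviation hcomp :: "('o, 'v, 'h, 'c) dblcat \<Rightarrow> 'h \<Rightarrow> 'h \<Rightarrow> 'h" (infixl "\<odot>\<index>" 75) where
  "M \<odot>\<^bsub>D\<^esub> N \<equiv> onO (HComp D) (M, N)"

abbreviation hcomp_cell :: "('o, 'v, 'h, 'c) dblcat \<Rightarrow> 'c \<Rightarrow> 'c \<Rightarrow> 'c" (infixl "\<star>\<index>" 75) where
  "\<alpha> \<star>\<^bsub>D\<^esub> \<beta> \<equiv> onA (HComp D) (\<alpha>, \<beta>)"

text \<open>The pullback of categories \<open>D1 \<times>\<^bsub>D0\<^esub> D1\<close>, of pairs \<open>(M, N)\<close> with \<open>S M = T N\<close>.\<close>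

definition composables :: "('o, 'v, 'h, 'c) dblcat \<Rightarrow> ('h \<times> 'h, 'c \<times> 'c) cat" where
  "composables D = (prod_cat (D1 D) (D1 D))\<lparr>
     Obj := {(M, N). M \<in> Obj (D1 D) \<and> N \<in> Obj (D1 D) \<and> onO (Src D) M = onO (Tgt D) N},
     Arr := {(\<alpha>, \<beta>). \<alpha> \<in> Arr (D1 D) \<and> \<beta> \<in> Arr (D1 D) \<and> onA (Src D) \<alpha> = onA (Tgt D) \<beta>}\<rparr>"

definition has_sides :: "('o, 'v, 'h, 'c) dblcat \<Rightarrow> 'c \<Rightarrow> 'v \<Rightarrow> 'v \<Rightarrow> bool" where
  "has_sides D \<alpha> f g \<longleftrightarrow> \<alpha> \<in> Arr (D1 D) \<and> onA (Src D) \<alpha> = f \<and> onA (Tgt D) \<alpha> = g"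

definition globular :: "('o, 'v, 'h, 'c) dblcat \<Rightarrow> 'c \<Rightarrow> bool" where
  "globular D \<alpha> \<longleftrightarrow>
     (\<exists>A \<in> Obj (D0 D). \<exists>B \<in> Obj (D0 D). has_sides D \<alpha> (Ide (D0 D) A) (Ide (D0 D) B))"

locale double_category =
  fixes D :: "('o, 'v, 'h, 'c) dblcat" (structure)
  assumes cat_D0: "category (D0 D)"
    and cat_D1: "category (D1 D)"
    and functor_Src: "is_functor (D1 D) (D0 D) (Src D)"
    and functor_Tgt: "is_functor (D1 D) (D0 D) (Tgt D)"
    and functor_Uni: "is_functor (D0 D) (D1 D) (Uni D)"
    and functor_HComp: "is_functor (composables D) (D1 D) (HComp D)"
    and Src_Uni: "A \<in> Obj (D0 D) \<Longrightarrow> onO (Src D) (onO (Uni D) A) = A"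
      "f \<in> Arr (D0 D) \<Longrightarrow> onA (Src D) (onA (Uni D) f) = f"
    and Tgt_Uni: "A \<in> Obj (D0 D) \<Longrightarrow> onO (Tgt D) (onO (Uni D) A) = A"
      "f \<in> Arr (D0 D) \<Longrightarrow> onA (Tgt D) (onA (Uni D) f) = f"
    and Src_HComp: "(M, N) \<in> Obj (composables D) \<Longrightarrow> onO (Src D) (M \<odot> N) = onO (Src D) N"
      "(\<alpha>, \<beta>) \<in> Arr (composables D) \<Longrightarrow> onA (Src D) (\<alpha> \<star> \<beta>) = onA (Src D) \<beta>"
    and Tgt_HComp: "(M, N) \<in> Obj (composables D) \<Longrightarrow> onO (Tgt D) (M \<odot> N) = onO (Tgt D) M"
      "(\<alpha>, \<beta>) \<in> Arr (composables D) \<Longrightarrow> onA (Tgt D) (\<alpha> \<star> \<beta>) = onA (Tgt D) \<alpha>"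
    and assoc_iso: "\<lbrakk>(M, N) \<in> Obj (composables D); (N, P) \<in> Obj (composables D)\<rbrakk> \<Longrightarrow>
      assoc D M N P \<in> hom_set (D1 D) ((M \<odot> N) \<odot> P) (M \<odot> (N \<odot> P)) \<and>
      is_iso (D1 D) (assoc D M N P) \<and> globular D (assoc D M N P)"
    and assoc_natural: "\<lbrakk>(\<alpha>, \<beta>) \<in> Arr (composables D); (\<beta>, \<gamma>) \<in> Arr (composables D)\<rbrakk> \<Longrightarrow>
      assoc D (Cod (D1 D) \<alpha>) (Cod (D1 D) \<beta>) (Cod (D1 D) \<gamma>) \<cdot>\<^bsub>D1 D\<^esub> ((\<alpha> \<star> \<beta>) \<star> \<gamma>) =
      (\<alpha> \<star> (\<beta> \<star> \<gamma>)) \<cdot>\<^bsub>D1 D\<^esub> assoc D (Dom (D1 D) \<alpha>) (Dom (D1 D) \<beta>) (Dom (D1 D) \<gamma>)"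
    and lunit_iso: "M \<in> Obj (D1 D) \<Longrightarrow>
      lunit D M \<in> hom_set (D1 D) (onO (Uni D) (onO (Tgt D) M) \<odot> M) M \<and>
      is_iso (D1 D) (lunit D M) \<and> globular D (lunit D M)"
    and lunit_natural: "\<alpha> \<in> Arr (D1 D) \<Longrightarrow>
      lunit D (Cod (D1 D) \<alpha>) \<cdot>\<^bsub>D1 D\<^esub> (onA (Uni D) (onA (Tgt D) \<alpha>) \<star> \<alpha>) =
      \<alpha> \<cdot>\<^bsub>D1 D\<^esub> lunit D (Dom (D1 D) \<alpha>)"
    and runit_iso: "M \<in> Obj (D1 D) \<Longrightarrow>
      runit D M \<in> hom_set (D1 D) (M \<odot> onO (Uni D) (onO (Src D) M)) M \<and>
      is_iso (D1 D) (runit D M) \<and> globular D (runit D M)"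
    and runit_natural: "\<alpha> \<in> Arr (D1 D) \<Longrightarrow>
      runit D (Cod (D1 D) \<alpha>) \<cdot>\<^bsub>D1 D\<^esub> (\<alpha> \<star> onA (Uni D) (onA (Src D) \<alpha>)) =
      \<alpha> \<cdot>\<^bsub>D1 D\<^esub> runit D (Dom (D1 D) \<alpha>)"
    and pentagon: "\<lbrakk>(M, N) \<in> Obj (composables D); (N, P) \<in> Obj (composables D);
        (P, Q) \<in> Obj (composables D)\<rbrakk> \<Longrightarrow>
      assoc D M N (P \<odot> Q) \<cdot>\<^bsub>D1 D\<^esub> assoc D (M \<odot> N) P Q =
      (Ide (D1 D) M \<star> assoc D N P Q) \<cdot>\<^bsub>D1 D\<^esub> assoc D M (N \<odot> P) Q
        \<cdot>\<^bsub>D1 D\<^esub> (assoc D M N P \<star> Ide (D1 D) Q)"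
    and triangle: "(M, N) \<in> Obj (composables D) \<Longrightarrow>
      (Ide (D1 D) M \<star> lunit D N) \<cdot>\<^bsub>D1 D\<^esub> assoc D M (onO (Uni D) (onO (Src D) M)) N =
      runit D M \<star> Ide (D1 D) N"

text \<open>The category \<open>\<H>(D)(A, B)\<close> of horizontal arrows \<open>A \<rightarrow> B\<close> and globular cells.\<close>

definition hor_cat :: "('o, 'v, 'h, 'c) dblcat \<Rightarrow> 'o \<Rightarrow> 'o \<Rightarrow> ('h, 'c) cat" where
  "hor_cat D A B = (D1 D)\<lparr>
     Obj := {M \<in> Obj (D1 D). onO (Src D) M = A \<and> onO (Tgt D) M = B},
     Arr := {\<alpha>. has_sides D \<alpha> (Ide (D0 D) A) (Ide (D0 D) B)}\<rparr>"

definition cartesian_cell :: "('o, 'v, 'h, 'c) dblcat \<Rightarrow> 'c \<Rightarrow> bool" where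
  "cartesian_cell D \<alpha> \<longleftrightarrow> \<alpha> \<in> Arr (D1 D) \<and>
     (\<forall>\<beta> h k. h \<in> Arr (D0 D) \<and> Cod (D0 D) h = Dom (D0 D) (onA (Src D) \<alpha>) \<and>
        k \<in> Arr (D0 D) \<and> Cod (D0 D) k = Dom (D0 D) (onA (Tgt D) \<alpha>) \<and>
        has_sides D \<beta> (onA (Src D) \<alpha> \<cdot>\<^bsub>D0 D\<^esub> h) (onA (Tgt D) \<alpha> \<cdot>\<^bsub>D0 D\<^esub> k) \<and>
        Cod (D1 D) \<beta> = Cod (D1 D) \<alpha> \<longrightarrow>
        (\<exists>!\<gamma>. \<gamma> \<in> hom_set (D1 D) (Dom (D1 D) \<beta>) (Dom (D1 D) \<alpha>) \<and>
           has_sides D \<gamma> h k \<and> \<alpha> \<cdot>\<^bsub>D1 D\<^esub> \<gamma> = \<beta>))"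

text \<open>\<open>(f, g, M)\<close> with \<open>f : A \<rightarrow> S M\<close> and \<open>g : C \<rightarrow> T M\<close> vertical.\<close>

definition niche :: "('o, 'v, 'h, 'c) dblcat \<Rightarrow> 'v \<Rightarrow> 'v \<Rightarrow> 'h \<Rightarrow> bool" where
  "niche D f g M \<longleftrightarrow> M \<in> Obj (D1 D) \<and>
     f \<in> Arr (D0 D) \<and> Cod (D0 D) f = onO (Src D) M \<and>
     g \<in> Arr (D0 D) \<and> Cod (D0 D) g = onO (Tgt D) M"

definition fibrant :: "('o, 'v, 'h, 'c) dblcat \<Rightarrow> bool" where
  "fibrant D \<longleftrightarrow> (\<forall>f g M. niche D f g M \<longrightarrow>
     (\<exists>\<alpha>. cartesian_cell D \<alpha> \<and> has_sides D \<alpha> f g \<and> Cod (D1 D) \<alpha> = M))"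

text \<open>A choice of Cartesian cells: \<open>R f g M\<close> is the cell \<open>g\<^sup>*Mf\<^sub>* \<rightarrow> M\<close> with sides \<open>(f, g)\<close>.\<close>

definition cleavage :: "('o, 'v, 'h, 'c) dblcat \<Rightarrow> ('v \<Rightarrow> 'v \<Rightarrow> 'h \<Rightarrow> 'c) \<Rightarrow> bool" where
  "cleavage D R \<longleftrightarrow> (\<forall>f g M. niche D f g M \<longrightarrow>
     cartesian_cell D (R f g M) \<and> has_sides D (R f g M) f g \<and> Cod (D1 D) (R f g M) = M)"


section \<open>Double functors and vertical transformations\<close>

text \<open>
  \<open>LComp F M N : F1 M \<odot> F1 N \<rightarrow> F1 (M \<odot> N)\<close> and \<open>LUnit F A : U (F0 A) \<rightarrow> F1 (U A)\<close>
  are the structure cells.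
\<close>

record ('o, 'v, 'h, 'c, 'o2, 'v2, 'h2, 'c2) dblftor =
  F0 :: "('o, 'v, 'o2, 'v2) ftor"
  F1 :: "('h, 'c, 'h2, 'c2) ftor"
  LComp :: "'h \<Rightarrow> 'h \<Rightarrow> 'c2"
  LUnit :: "'o \<Rightarrow> 'c2"

locale lax_double_functor =
  fixes B :: "('o, 'v, 'h, 'c) dblcat"
    and D :: "('o2, 'v2, 'h2, 'c2) dblcat"
    and F :: "('o, 'v, 'h, 'c, 'o2, 'v2, 'h2, 'c2) dblftor"
  assumes functor_F0: "is_functor (D0 B) (D0 D) (F0 F)"
    and functor_F1: "is_functor (D1 B) (D1 D) (F1 F)"
    and Src_F1: "M \<in> Obj (D1 B) \<Longrightarrow> onO (Src D) (onO (F1 F) M) = onO (F0 F) (onO (Src B) M)"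
      "\<alpha> \<in> Arr (D1 B) \<Longrightarrow> onA (Src D) (onA (F1 F) \<alpha>) = onA (F0 F) (onA (Src B) \<alpha>)"
    and Tgt_F1: "M \<in> Obj (D1 B) \<Longrightarrow> onO (Tgt D) (onO (F1 F) M) = onO (F0 F) (onO (Tgt B) M)"
      "\<alpha> \<in> Arr (D1 B) \<Longrightarrow> onA (Tgt D) (onA (F1 F) \<alpha>) = onA (F0 F) (onA (Tgt B) \<alpha>)"
    and LComp_cell: "(M, N) \<in> Obj (composables B) \<Longrightarrow>
      LComp F M N \<in> hom_set (D1 D) (onO (F1 F) M \<odot>\<^bsub>D\<^esub> onO (F1 F) N) (onO (F1 F) (M \<odot>\<^bsub>B\<^esub> N)) \<and>
      globular D (LComp F M N)"
    and LComp_natural: "(\<alpha>, \<beta>) \<in> Arr (composables B) \<Longrightarrow>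
      LComp F (Cod (D1 B) \<alpha>) (Cod (D1 B) \<beta>) \<cdot>\<^bsub>D1 D\<^esub> (onA (F1 F) \<alpha> \<star>\<^bsub>D\<^esub> onA (F1 F) \<beta>) =
      onA (F1 F) (\<alpha> \<star>\<^bsub>B\<^esub> \<beta>) \<cdot>\<^bsub>D1 D\<^esub> LComp F (Dom (D1 B) \<alpha>) (Dom (D1 B) \<beta>)"
    and LUnit_cell: "A \<in> Obj (D0 B) \<Longrightarrow>
      LUnit F A \<in> hom_set (D1 D) (onO (Uni D) (onO (F0 F) A)) (onO (F1 F) (onO (Uni B) A)) \<and>
      globular D (LUnit F A)"
    and LUnit_natural: "f \<in> Arr (D0 B) \<Longrightarrow>
      LUnit F (Cod (D0 B) f) \<cdot>\<^bsub>D1 D\<^esub> onA (Uni D) (onA (F0 F) f) =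
      onA (F1 F) (onA (Uni B) f) \<cdot>\<^bsub>D1 D\<^esub> LUnit F (Dom (D0 B) f)"
    and LComp_assoc: "\<lbrakk>(M, N) \<in> Obj (composables B); (N, P) \<in> Obj (composables B)\<rbrakk> \<Longrightarrow>
      onA (F1 F) (assoc B M N P) \<cdot>\<^bsub>D1 D\<^esub> LComp F (M \<odot>\<^bsub>B\<^esub> N) P
        \<cdot>\<^bsub>D1 D\<^esub> (LComp F M N \<star>\<^bsub>D\<^esub> Ide (D1 D) (onO (F1 F) P)) =
      LComp F M (N \<odot>\<^bsub>B\<^esub> P) \<cdot>\<^bsub>D1 D\<^esub> (Ide (D1 D) (onO (F1 F) M) \<star>\<^bsub>D\<^esub> LComp F N P)
        \<cdot>\<^bsub>D1 D\<^esub> assoc D (onO (F1 F) M) (onO (F1 F) N) (onO (F1 F) P)"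
    and LUnit_left: "M \<in> Obj (D1 B) \<Longrightarrow>
      onA (F1 F) (lunit B M) \<cdot>\<^bsub>D1 D\<^esub> LComp F (onO (Uni B) (onO (Tgt B) M)) M
        \<cdot>\<^bsub>D1 D\<^esub> (LUnit F (onO (Tgt B) M) \<star>\<^bsub>D\<^esub> Ide (D1 D) (onO (F1 F) M)) =
      lunit D (onO (F1 F) M)"
    and LUnit_right: "M \<in> Obj (D1 B) \<Longrightarrow>
      onA (F1 F) (runit B M) \<cdot>\<^bsub>D1 D\<^esub> LComp F M (onO (Uni B) (onO (Src B) M))
        \<cdot>\<^bsub>D1 D\<^esub> (Ide (D1 D) (onO (F1 F) M) \<star>\<^bsub>D\<^esub> LUnit F (onO (Src B) M)) =
      runit D (onO (F1 F) M)"

definition double_functor ::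
    "('o, 'v, 'h, 'c) dblcat \<Rightarrow> ('o2, 'v2, 'h2, 'c2) dblcat
      \<Rightarrow> ('o, 'v, 'h, 'c, 'o2, 'v2, 'h2, 'c2) dblftor \<Rightarrow> bool" where
  "double_functor B D F \<longleftrightarrow> lax_double_functor B D F \<and>
     (\<forall>(M, N) \<in> Obj (composables B). is_iso (D1 D) (LComp F M N)) \<and>
     (\<forall>A \<in> Obj (D0 B). is_iso (D1 D) (LUnit F A))"

locale vertical_transformation =
  fixes B :: "('o, 'v, 'h, 'c) dblcat"
    and D :: "('o2, 'v2, 'h2, 'c2) dblcat"
    and F G :: "('o, 'v, 'h, 'c, 'o2, 'v2, 'h2, 'c2) dblftor"
    and \<phi>0 :: "'o \<Rightarrow> 'v2"
    and \<phi>1 :: "'h \<Rightarrow> 'c2"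
  assumes nat_0: "is_nat_trans (D0 B) (D0 D) (F0 F) (F0 G) \<phi>0"
    and nat_1: "is_nat_trans (D1 B) (D1 D) (F1 F) (F1 G) \<phi>1"
    and sides: "M \<in> Obj (D1 B) \<Longrightarrow>
      has_sides D (\<phi>1 M) (\<phi>0 (onO (Src B) M)) (\<phi>0 (onO (Tgt B) M))"
    and compat_LComp: "(M, N) \<in> Obj (composables B) \<Longrightarrow>
      \<phi>1 (M \<odot>\<^bsub>B\<^esub> N) \<cdot>\<^bsub>D1 D\<^esub> LComp F M N = LComp G M N \<cdot>\<^bsub>D1 D\<^esub> (\<phi>1 M \<star>\<^bsub>D\<^esub> \<phi>1 N)"
    and compat_LUnit: "A \<in> Obj (D0 B) \<Longrightarrow>
      \<phi>1 (onO (Uni B) A) \<cdot>\<^bsub>D1 D\<^esub> LUnit F A = LUnit G A \<cdot>\<^bsub>D1 D\<^esub> onA (Uni D) (\<phi>0 A)"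

definition id_dblftor ::
    "('o, 'v, 'h, 'c) dblcat \<Rightarrow> ('o, 'v, 'h, 'c, 'o, 'v, 'h, 'c) dblftor" where
  "id_dblftor D = \<lparr>F0 = id_ftor, F1 = id_ftor,
     LComp = (\<lambda>M N. Ide (D1 D) (M \<odot>\<^bsub>D\<^esub> N)),
     LUnit = (\<lambda>A. Ide (D1 D) (onO (Uni D) A))\<rparr>"

text \<open>The composite \<open>G F\<close>; the first argument is the codomain of \<open>G\<close>.\<close>

definition comp_dblftor ::
    "('o3, 'v3, 'h3, 'c3) dblcat
      \<Rightarrow> ('o2, 'v2, 'h2, 'c2, 'o3, 'v3, 'h3, 'c3) dblftor
      \<Rightarrow> ('o, 'v, 'h, 'c, 'o2, 'v2, 'h2, 'c2) dblftor
      \<Rightarrow> ('o, 'v, 'h, 'c, 'o3, 'v3, 'h3, 'c3) dblftor" where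
  "comp_dblftor E G F = \<lparr>
     F0 = comp_ftor (F0 G) (F0 F),
     F1 = comp_ftor (F1 G) (F1 F),
     LComp = (\<lambda>M N. onA (F1 G) (LComp F M N)
       \<cdot>\<^bsub>D1 E\<^esub> LComp G (onO (F1 F) M) (onO (F1 F) N)),
     LUnit = (\<lambda>A. onA (F1 G) (LUnit F A) \<cdot>\<^bsub>D1 E\<^esub> LUnit G (onO (F0 F) A))\<rparr>"

text \<open>
  Adjunction \<open>F \<stileturn> G\<close> in the 2-category of double categories, (pseudo) double functors and
  vertical transformations, with unit \<open>\<eta> : 1 \<rightarrow> G F\<close> and counit \<open>\<epsilon> : F G \<rightarrow> 1\<close>;
  the last four conjuncts are the triangle identities, on objects and on horizontal arrows.
\<close>

definition dbl_adjunction ::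
    "('o, 'v, 'h, 'c) dblcat \<Rightarrow> ('o2, 'v2, 'h2, 'c2) dblcat
      \<Rightarrow> ('o, 'v, 'h, 'c, 'o2, 'v2, 'h2, 'c2) dblftor
      \<Rightarrow> ('o2, 'v2, 'h2, 'c2, 'o, 'v, 'h, 'c) dblftor
      \<Rightarrow> ('o \<Rightarrow> 'v) \<Rightarrow> ('h \<Rightarrow> 'c) \<Rightarrow> ('o2 \<Rightarrow> 'v2) \<Rightarrow> ('h2 \<Rightarrow> 'c2) \<Rightarrow> bool" where
  "dbl_adjunction B D F G \<eta>0 \<eta>1 \<epsilon>0 \<epsilon>1 \<longleftrightarrow>
     double_functor B D F \<and> double_functor D B G \<and>
     vertical_transformation B B (id_dblftor B) (comp_dblftor B G F) \<eta>0 \<eta>1 \<and>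
     vertical_transformation D D (comp_dblftor D F G) (id_dblftor D) \<epsilon>0 \<epsilon>1 \<and>
     (\<forall>A \<in> Obj (D0 B).
        \<epsilon>0 (onO (F0 F) A) \<cdot>\<^bsub>D0 D\<^esub> onA (F0 F) (\<eta>0 A) = Ide (D0 D) (onO (F0 F) A)) \<and>
     (\<forall>M \<in> Obj (D1 B).
        \<epsilon>1 (onO (F1 F) M) \<cdot>\<^bsub>D1 D\<^esub> onA (F1 F) (\<eta>1 M) = Ide (D1 D) (onO (F1 F) M)) \<and>
     (\<forall>X \<in> Obj (D0 D).
        onA (F0 G) (\<epsilon>0 X) \<cdot>\<^bsub>D0 B\<^esub> \<eta>0 (onO (F0 G) X) = Ide (D0 B) (onO (F0 G) X)) \<and>
     (\<forall>N \<in> Obj (D1 D).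
        onA (F1 G) (\<epsilon>1 N) \<cdot>\<^bsub>D1 B\<^esub> \<eta>1 (onO (F1 G) N) = Ide (D1 B) (onO (F1 G) N))"

definition has_right_adjoint ::
    "('o, 'v, 'h, 'c) dblcat \<Rightarrow> ('o2, 'v2, 'h2, 'c2) dblcat
      \<Rightarrow> ('o, 'v, 'h, 'c, 'o2, 'v2, 'h2, 'c2) dblftor \<Rightarrow> bool" where
  "has_right_adjoint B D F \<longleftrightarrow> (\<exists>G \<eta>0 \<eta>1 \<epsilon>0 \<epsilon>1. dbl_adjunction B D F G \<eta>0 \<eta>1 \<epsilon>0 \<epsilon>1)"


section \<open>Cartesian double categories\<close>

definition prod_ftor ::
    "('o, 'a, 'p, 'b) ftor \<Rightarrow> ('o2, 'a2, 'p2, 'b2) ftor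
      \<Rightarrow> ('o \<times> 'o2, 'a \<times> 'a2, 'p \<times> 'p2, 'b \<times> 'b2) ftor" where
  "prod_ftor F G = \<lparr>onO = map_prod (onO F) (onO G), onA = map_prod (onA F) (onA G)\<rparr>"

definition prod_dblcat ::
    "('o, 'v, 'h, 'c) dblcat \<Rightarrow> ('o2, 'v2, 'h2, 'c2) dblcat
      \<Rightarrow> ('o \<times> 'o2, 'v \<times> 'v2, 'h \<times> 'h2, 'c \<times> 'c2) dblcat" where
  "prod_dblcat B D = \<lparr>
     D0 = prod_cat (D0 B) (D0 D),
     D1 = prod_cat (D1 B) (D1 D),
     Src = prod_ftor (Src B) (Src D),
     Tgt = prod_ftor (Tgt B) (Tgt D),
     Uni = prod_ftor (Uni B) (Uni D),
     HComp = \<lparr>onO = (\<lambda>((M, M'), (N, N')). (M \<odot>\<^bsub>B\<^esub> N, M' \<odot>\<^bsub>D\<^esub> N')),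
              onA = (\<lambda>((\<alpha>, \<alpha>'), (\<beta>, \<beta>')). (\<alpha> \<star>\<^bsub>B\<^esub> \<beta>, \<alpha>' \<star>\<^bsub>D\<^esub> \<beta>'))\<rparr>,
     assoc = (\<lambda>(M, M') (N, N') (P, P'). (assoc B M N P, assoc D M' N' P')),
     lunit = map_prod (lunit B) (lunit D),
     runit = map_prod (runit B) (runit D)\<rparr>"

definition unit_dblcat :: "(unit, unit, unit, unit) dblcat" where
  "unit_dblcat = \<lparr>
     D0 = unit_cat, D1 = unit_cat,
     Src = id_ftor, Tgt = id_ftor, Uni = id_ftor,
     HComp = \<lparr>onO = (\<lambda>_. ()), onA = (\<lambda>_. ())\<rparr>,
     assoc = (\<lambda>_ _ _. ()), lunit = (\<lambda>_. ()), runit = (\<lambda>_. ())\<rparr>"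

definition diagonal ::
    "('o, 'v, 'h, 'c) dblcat
      \<Rightarrow> ('o, 'v, 'h, 'c, 'o \<times> 'o, 'v \<times> 'v, 'h \<times> 'h, 'c \<times> 'c) dblftor" where
  "diagonal D = \<lparr>
     F0 = \<lparr>onO = (\<lambda>A. (A, A)), onA = (\<lambda>f. (f, f))\<rparr>,
     F1 = \<lparr>onO = (\<lambda>M. (M, M)), onA = (\<lambda>\<alpha>. (\<alpha>, \<alpha>))\<rparr>,
     LComp = (\<lambda>M N. (Ide (D1 D) (M \<odot>\<^bsub>D\<^esub> N), Ide (D1 D) (M \<odot>\<^bsub>D\<^esub> N))),
     LUnit = (\<lambda>A. (Ide (D1 D) (onO (Uni D) A), Ide (D1 D) (onO (Uni D) A)))\<rparr>"

definition bang :: "('o, 'v, 'h, 'c, unit, unit, unit, unit) dblftor" where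
  "bang = \<lparr>
     F0 = \<lparr>onO = (\<lambda>_. ()), onA = (\<lambda>_. ())\<rparr>,
     F1 = \<lparr>onO = (\<lambda>_. ()), onA = (\<lambda>_. ())\<rparr>,
     LComp = (\<lambda>_ _. ()), LUnit = (\<lambda>_. ())\<rparr>"

definition cartesian_dblcat :: "('o, 'v, 'h, 'c) dblcat \<Rightarrow> bool" where
  "cartesian_dblcat D \<longleftrightarrow>
     has_right_adjoint D (prod_dblcat D D) (diagonal D) \<and>
     has_right_adjoint D unit_dblcat bang"


section \<open>The induced lax double functors\<close>

text \<open>
  Here \<open>X\<close> is a choice of finite products in \<open>D0\<close>, \<open>L A B\<close> one in \<open>\<H>(D)(A, B)\<close>, and \<open>R\<close> a
  choice of Cartesian cells. For \<open>M : A \<rightarrow> B\<close> and \<open>N : A' \<rightarrow> B'\<close> the two restrictions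
  \<open>p\<^sub>1\<^sup>*Mp\<^sub>1\<^sub>*\<close>, \<open>p\<^sub>2\<^sup>*Np\<^sub>2\<^sub>*\<close> are the domains of the cells \<open>restr1\<close> and \<open>restr2\<close> below.
\<close>

definition restr1 ::
    "('o, 'v, 'h, 'c) dblcat \<Rightarrow> ('o, 'v) prods \<Rightarrow> ('v \<Rightarrow> 'v \<Rightarrow> 'h \<Rightarrow> 'c) \<Rightarrow> 'h \<Rightarrow> 'h \<Rightarrow> 'c" where
  "restr1 D X R M N =
     R (pr1 X (onO (Src D) M) (onO (Src D) N)) (pr1 X (onO (Tgt D) M) (onO (Tgt D) N)) M"

definition restr2 ::
    "('o, 'v, 'h, 'c) dblcat \<Rightarrow> ('o, 'v) prods \<Rightarrow> ('v \<Rightarrow> 'v \<Rightarrow> 'h \<Rightarrow> 'c) \<Rightarrow> 'h \<Rightarrow> 'h \<Rightarrow> 'c" where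
  "restr2 D X R M N =
     R (pr2 X (onO (Src D) M) (onO (Src D) N)) (pr2 X (onO (Tgt D) M) (onO (Tgt D) N)) N"

definition D1_products ::
    "('o, 'v, 'h, 'c) dblcat \<Rightarrow> ('o, 'v) prods \<Rightarrow> ('o \<Rightarrow> 'o \<Rightarrow> ('h, 'c) prods)
      \<Rightarrow> ('v \<Rightarrow> 'v \<Rightarrow> 'h \<Rightarrow> 'c) \<Rightarrow> ('h, 'c) prods" where
  "D1_products D X L R =
     (let loc = (\<lambda>M N. L (pob X (onO (Src D) M) (onO (Src D) N))
                         (pob X (onO (Tgt D) M) (onO (Tgt D) N)));
          M1 = (\<lambda>M N. Dom (D1 D) (restr1 D X R M N));
          N2 = (\<lambda>M N. Dom (D1 D) (restr2 D X R M N))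
      in \<lparr>pob = (\<lambda>M N. pob (loc M N) (M1 M N) (N2 M N)),
          pr1 = (\<lambda>M N. restr1 D X R M N \<cdot>\<^bsub>D1 D\<^esub> pr1 (loc M N) (M1 M N) (N2 M N)),
          pr2 = (\<lambda>M N. restr2 D X R M N \<cdot>\<^bsub>D1 D\<^esub> pr2 (loc M N) (M1 M N) (N2 M N)),
          tob = tob (L (tob X) (tob X))\<rparr>)"

definition induced_times ::
    "('o, 'v, 'h, 'c) dblcat \<Rightarrow> ('o, 'v) prods \<Rightarrow> ('o \<Rightarrow> 'o \<Rightarrow> ('h, 'c) prods)
      \<Rightarrow> ('v \<Rightarrow> 'v \<Rightarrow> 'h \<Rightarrow> 'c)
      \<Rightarrow> ('o \<times> 'o, 'v \<times> 'v, 'h \<times> 'h, 'c \<times> 'c, 'o, 'v, 'h, 'c) dblftor" where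
  "induced_times D X L R =
     (let Y = D1_products D X L R
      in \<lparr>F0 = product_ftor (D0 D) X,
          F1 = product_ftor (D1 D) Y,
          LComp = (\<lambda>(M', N') (M, N).
            pairing (D1 D) Y (pr1 Y M' N' \<star>\<^bsub>D\<^esub> pr1 Y M N) (pr2 Y M' N' \<star>\<^bsub>D\<^esub> pr2 Y M N)),
          LUnit = (\<lambda>(A, B).
            pairing (D1 D) Y (onA (Uni D) (pr1 X A B)) (onA (Uni D) (pr2 X A B)))\<rparr>)"

definition induced_terminal ::
    "('o, 'v, 'h, 'c) dblcat \<Rightarrow> ('o, 'v) prods \<Rightarrow> ('o \<Rightarrow> 'o \<Rightarrow> ('h, 'c) prods)
      \<Rightarrow> (unit, unit, unit, unit, 'o, 'v, 'h, 'c) dblftor" where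
  "induced_terminal D X L =
     (let I = tob X; Top = tob (L I I);
          glob = (\<lambda>M. THE \<alpha>. \<alpha> \<in> hom_set (hor_cat D I I) M Top)
      in \<lparr>F0 = \<lparr>onO = (\<lambda>_. I), onA = (\<lambda>_. Ide (D0 D) I)\<rparr>,
          F1 = \<lparr>onO = (\<lambda>_. Top), onA = (\<lambda>_. Ide (D1 D) Top)\<rparr>,
          LComp = (\<lambda>_ _. glob (Top \<odot>\<^bsub>D\<^esub> Top)),
          LUnit = (\<lambda>_. glob (onO (Uni D) I))\<rparr>)"

end

theory Submission
  imports Defs
begin

text \<open>
  Products in \<open>D1\<close> lying strictly over products in \<open>D0\<close> mediate between the two sides. Given
  local products, \<open>M \<times> N = p\<^sub>1\<^sup>*M p\<^sub>1\<^sub>* \<and> p\<^sub>2\<^sup>*N p\<^sub>2\<^sub>*\<close> is a product in \<open>D1\<close> because restriction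
  preserves local limits: a cell out of \<open>Z\<close> with sides \<open>(h, k)\<close> is the same as a globular
  cell out of the extension \<open>k\<^sub>* \<odot> Z \<odot> h\<^sup>*\<close>, which exists since a fibrant double category has
  companions and conjoints. Conversely, restricting \<open>M \<times> N\<close> along diagonals gives local products.
  An adjunction \<open>\<Delta> \<stileturn> \<times>\<close> amounts to such a choice of products whose induced lax structure cells
  are invertible, and this invertibility does not depend on the choice: the comparison
  isomorphisms between two choices intertwine the structure cells.
\<close>

section \<open>Categories with products\<close>

text \<open>Local products test only globular cells, whereas products in \<open>D1\<close> must
  accept cells with arbitrary sides. Restriction repairs the sides at the codomain, where the
  projections live; repairing them at the domain takes an extension, and fibrancy is stated through
  Cartesian lifts only. Extensions therefore come from the companion and conjoint identities.
  Manipulating these involves unit constraints at composites and at units, which pentagon and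
  triangle do not mention directly; hence the coherence lemmas for \<open>lunit\<close> and
  \<open>runit\<close>. The structure cells of a right adjoint of the diagonal are not free data:
  compatibility with the counit fixes both of their projections, so they are the canonical pairings.
  Condition (2) speaks of every choice of products and Cartesian cells, while an adjunction yields a
  single product structure, so passing from (1) to (2) requires comparing different choices.\<close>

lemma hom_setD:
  assumes "f \<in> hom_set C A B"
  shows "f \<in> Arr C" "Dom C f = A" "Cod C f = B"
  using assms by (simp_all add: hom_set_def)

lemma hom_setI: "\<lbrakk>f \<in> Arr C; Dom C f = A; Cod C f = B\<rbrakk> \<Longrightarrow> f \<in> hom_set C A B"
  by (simp add: hom_set_def)

section \<open>Invertible arrows, terminal objects and products in a single category\<close>

context category
begin

lemma dom_cod_Obj [simp]: "f \<in> Arr C \<Longrightarrow> Dom C f \<in> Obj C" "f \<in> Arr C \<Longrightarrow> Cod C f \<in> Obj C"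
  by (simp_all add: dom_closed cod_closed)

lemma cmp_simps [simp]:
  assumes "f \<in> Arr C" "g \<in> Arr C" "Cod C f = Dom C g"
  shows "g \<cdot> f \<in> Arr C" "Dom C (g \<cdot> f) = Dom C f" "Cod C (g \<cdot> f) = Cod C g"
  using cmp_closed[of f "Dom C f" "Cod C f" g "Cod C g"] assms by (simp_all add: hom_set_def)

lemma ide_simps [simp]:
  assumes "A \<in> Obj C"
  shows "Ide C A \<in> Arr C" "Dom C (Ide C A) = A" "Cod C (Ide C A) = A"
  using ide_closed[OF assms] by (simp_all add: hom_set_def)

lemma cmp_ide [simp]:
  "\<lbrakk>f \<in> Arr C; Dom C f = A\<rbrakk> \<Longrightarrow> f \<cdot> Ide C A = f"
  "\<lbrakk>f \<in> Arr C; Cod C f = A\<rbrakk> \<Longrightarrow> Ide C A \<cdot> f = f"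
  using cmp_ide_left cmp_ide_right by auto

lemma assoc_simp:
  "\<lbrakk>f \<in> Arr C; g \<in> Arr C; h \<in> Arr C; Cod C f = Dom C g; Cod C g = Dom C h\<rbrakk>
    \<Longrightarrow> h \<cdot> g \<cdot> f = h \<cdot> (g \<cdot> f)"
  by (rule cmp_assoc)

text \<open>Composites are kept nested to the right, where the left-hand side of an equation
  \<open>g \<cdot> f = k\<close> no longer occurs as a subterm; this form applies the equation in
  front of a further arrow.\<close>

lemma cmp_extend:
  assumes "g \<cdot> f = k" "x \<in> Arr C" "f \<in> Arr C" "g \<in> Arr C" "Cod C x = Dom C f" "Cod C f = Dom C g"
  shows "g \<cdot> (f \<cdot> x) = k \<cdot> x"
  using assms by (metis cmp_assoc)

lemma is_isoI:
  assumes "f \<in> Arr C" "g \<in> Arr C" "Dom C g = Cod C f" "Cod C g = Dom C f"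
    and "g \<cdot> f = Ide C (Dom C f)" "f \<cdot> g = Ide C (Cod C f)"
  shows "is_iso C f"
  using assms by (auto simp: is_iso_def hom_set_def)

lemma is_isoE:
  assumes "is_iso C f"
  obtains g where "g \<in> Arr C" "Dom C g = Cod C f" "Cod C g = Dom C f"
    and "g \<cdot> f = Ide C (Dom C f)" "f \<cdot> g = Ide C (Cod C f)"
  using assms by (auto simp: is_iso_def hom_set_def)

lemma is_iso_Arr: "is_iso C f \<Longrightarrow> f \<in> Arr C"
  by (simp add: is_iso_def)

lemma iso_cancel_left:
  assumes "is_iso C f" "x \<in> Arr C" "y \<in> Arr C" "Cod C x = Dom C f" "Cod C y = Dom C f" "f \<cdot> x = f \<cdot> y"
  shows "x = y"
proof -
  obtain g where g: "g \<in> Arr C" "Dom C g = Cod C f" "Cod C g = Dom C f" "g \<cdot> f = Ide C (Dom C f)"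
    using assms(1) by (rule is_isoE)
  have "x = g \<cdot> (f \<cdot> x)" "y = g \<cdot> (f \<cdot> y)"
    using g assms(2-5) is_iso_Arr[OF assms(1)] by (simp_all add: cmp_extend[OF g(4)])
  then show ?thesis using assms(6) by simp
qed

lemma iso_cancel_right:
  assumes "is_iso C f" "x \<in> Arr C" "y \<in> Arr C" "Dom C x = Cod C f" "Dom C y = Cod C f" "x \<cdot> f = y \<cdot> f"
  shows "x = y"
proof -
  obtain g where g: "g \<in> Arr C" "Dom C g = Cod C f" "Cod C g = Dom C f" "f \<cdot> g = Ide C (Cod C f)"
    using assms(1) by (rule is_isoE)
  have "x = x \<cdot> f \<cdot> g" "y = y \<cdot> f \<cdot> g"
    using g assms(2-5) is_iso_Arr[OF assms(1)] by (simp_all add: cmp_assoc)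
  then show ?thesis using assms(6) by simp
qed

text \<open>A left inverse \<open>g\<close> and a right inverse \<open>h\<close> both equal
  \<open>g \<cdot> (f \<cdot> h)\<close>.\<close>

lemma inverse_unique:
  assumes "f \<in> Arr C" "g \<in> Arr C" "h \<in> Arr C" "Dom C g = Cod C f" "Cod C h = Dom C f"
    and "g \<cdot> f = Ide C (Dom C f)" "f \<cdot> h = Ide C (Cod C f)" "Dom C h = Cod C f" "Cod C g = Dom C f"
  shows "g = h"
proof -
  have "g = g \<cdot> (f \<cdot> h)" using assms by simp
  also have "\<dots> = h" using assms(1-5,8,9) by (simp add: cmp_extend[OF assms(6)])
  finally show ?thesis .
qed

lemma is_iso_ide: "A \<in> Obj C \<Longrightarrow> is_iso C (Ide C A)"
  by (rule is_isoI[of _ "Ide C A"]) simp_all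

lemma is_iso_cmp:
  assumes "is_iso C f" "is_iso C g" "Cod C f = Dom C g"
  shows "is_iso C (g \<cdot> f)"
proof -
  obtain f' where f': "f' \<in> Arr C" "Dom C f' = Cod C f" "Cod C f' = Dom C f"
      "f' \<cdot> f = Ide C (Dom C f)" "f \<cdot> f' = Ide C (Cod C f)"
    using assms(1) by (rule is_isoE)
  obtain g' where g': "g' \<in> Arr C" "Dom C g' = Cod C g" "Cod C g' = Dom C g"
      "g' \<cdot> g = Ide C (Dom C g)" "g \<cdot> g' = Ide C (Cod C g)"
    using assms(2) by (rule is_isoE)
  note a = is_iso_Arr[OF assms(1)] is_iso_Arr[OF assms(2)]
  show ?thesis
    by (rule is_isoI[of _ "f' \<cdot> g'"])
      (use a f' g' assms(3) in \<open>simp_all add: assoc_simp cmp_extend[OF f'(5)] cmp_extend[OF g'(4)]\<close>)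
qed

text \<open>Cancelling \<open>f\<close> writes \<open>g\<close> as
  \<open>g \<cdot> f \<cdot> f'\<close>. This is the form used on comparison squares: if the other
  three edges are invertible, so is the edge composed last on one of the two paths.\<close>

lemma is_iso_left_factor:
  assumes "is_iso C f" "is_iso C (g \<cdot> f)" "g \<in> Arr C" "Dom C g = Cod C f"
  shows "is_iso C g"
proof -
  obtain f' where f': "f' \<in> Arr C" "Dom C f' = Cod C f" "Cod C f' = Dom C f"
      "f' \<cdot> f = Ide C (Dom C f)" "f \<cdot> f' = Ide C (Cod C f)"
    using assms(1) by (rule is_isoE)
  note a = is_iso_Arr[OF assms(1)]
  have "is_iso C f'" by (rule is_isoI[of _ f]) (use f' a in simp_all)
  then have "is_iso C (g \<cdot> f \<cdot> f')"
    using is_iso_cmp[OF _ assms(2)] assms(3,4) a f' by simp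
  moreover have "g \<cdot> f \<cdot> f' = g" using a f' assms(3,4) by (simp add: assoc_simp)
  ultimately show ?thesis by simp
qed

lemma terminal_unique:
  assumes "is_terminal C I" "f \<in> Arr C" "g \<in> Arr C" "Dom C f = Dom C g" "Cod C f = I" "Cod C g = I"
  shows "f = g"
proof -
  have "\<exists>!h. h \<in> hom_set C (Dom C f) I"
    using assms(1,2) by (simp add: is_terminal_def)
  then show ?thesis using assms by (auto simp: hom_set_def)
qed

lemma terminal_arrow:
  assumes "is_terminal C I" "A \<in> Obj C"
  obtains f where "f \<in> Arr C" "Dom C f = A" "Cod C f = I"
  using assms by (auto simp: is_terminal_def hom_set_def)

lemma terminal_iso:
  assumes "is_terminal C I" "is_terminal C J" "f \<in> Arr C" "Dom C f = I" "Cod C f = J"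
  shows "is_iso C f"
proof -
  have o: "I \<in> Obj C" "J \<in> Obj C" using assms(1,2) by (simp_all add: is_terminal_def)
  then obtain g where g: "g \<in> Arr C" "Dom C g = J" "Cod C g = I"
    using assms(1) by (auto simp: is_terminal_def hom_set_def)
  show ?thesis
  proof (rule is_isoI[of _ g])
    show "g \<cdot> f = Ide C (Dom C f)"
      by (rule terminal_unique[OF assms(1)]) (use assms(3-) g o in simp_all)
    show "f \<cdot> g = Ide C (Cod C f)"
      by (rule terminal_unique[OF assms(2)]) (use assms(3-) g o in simp_all)
  qed (use assms g in simp_all)
qed

lemma is_product_mono:
  assumes "is_product C A B P p q" "x \<in> Arr C" "y \<in> Arr C" "Dom C x = Dom C y" "Cod C x = P" "Cod C y = P"
    and "p \<cdot> x = p \<cdot> y" "q \<cdot> x = q \<cdot> y"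
  shows "x = y"
proof -
  have pq: "p \<in> hom_set C P A" "q \<in> hom_set C P B" using assms(1) by (simp_all add: is_product_def)
  then have "p \<cdot> x \<in> hom_set C (Dom C x) A" "q \<cdot> x \<in> hom_set C (Dom C x) B"
    using assms by (simp_all add: hom_set_def del: assms(7,8))
  then have "\<exists>!h. h \<in> hom_set C (Dom C x) P \<and> p \<cdot> h = p \<cdot> x \<and> q \<cdot> h = q \<cdot> x"
    using assms(1) unfolding is_product_def by blast
  then show ?thesis using assms by (auto simp: hom_set_def)
qed

lemma is_product_lift:
  assumes "is_product C A B P p q" "f \<in> Arr C" "g \<in> Arr C" "Dom C f = Dom C g" "Cod C f = A" "Cod C g = B"
  obtains h where "h \<in> Arr C" "Dom C h = Dom C g" "Cod C h = P" "p \<cdot> h = f" "q \<cdot> h = g"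
proof -
  have "f \<in> hom_set C (Dom C g) A" "g \<in> hom_set C (Dom C g) B"
    using assms by (simp_all add: hom_set_def)
  then have "\<exists>!h. h \<in> hom_set C (Dom C g) P \<and> p \<cdot> h = f \<and> q \<cdot> h = g"
    using assms(1) unfolding is_product_def by blast
  then show ?thesis using that by (auto simp: hom_set_def)
qed

lemma is_productD:
  assumes "is_product C A B P p q"
  shows "P \<in> Obj C" "p \<in> Arr C" "Dom C p = P" "Cod C p = A" "q \<in> Arr C" "Dom C q = P" "Cod C q = B"
  using assms by (auto simp: is_product_def hom_set_def)

text \<open>Unique existence is split into lifting and joint monicity, because for horizontal arrows
  the two come from different arguments.\<close>

lemma is_productI:
  assumes "p \<in> Arr C" "Dom C p = P" "Cod C p = A" "q \<in> Arr C" "Dom C q = P" "Cod C q = B"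
    and lift: "\<And>f g. \<lbrakk>f \<in> Arr C; g \<in> Arr C; Dom C f = Dom C g; Cod C f = A; Cod C g = B\<rbrakk> \<Longrightarrow>
      \<exists>h. h \<in> Arr C \<and> Dom C h = Dom C g \<and> Cod C h = P \<and> p \<cdot> h = f \<and> q \<cdot> h = g"
    and mono: "\<And>x y. \<lbrakk>x \<in> Arr C; y \<in> Arr C; Dom C x = Dom C y; Cod C x = P; Cod C y = P;
      p \<cdot> x = p \<cdot> y; q \<cdot> x = q \<cdot> y\<rbrakk> \<Longrightarrow> x = y"
  shows "is_product C A B P p q"
  unfolding is_product_def
proof (intro conjI allI ballI)
  show "P \<in> Obj C" using assms(1,2) by auto
  fix X f g assume "f \<in> hom_set C X A" "g \<in> hom_set C X B"
  then obtain h where h: "h \<in> hom_set C X P" "p \<cdot> h = f" "q \<cdot> h = g"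
    using lift[of f g] by (auto simp: hom_set_def)
  show "\<exists>!h. h \<in> hom_set C X P \<and> p \<cdot> h = f \<and> q \<cdot> h = g"
  proof (intro ex1I[of _ h] conjI h)
    fix k assume k: "k \<in> hom_set C X P \<and> p \<cdot> k = f \<and> q \<cdot> k = g"
    show "k = h"
      by (rule mono) (use k h hom_setD[OF conjunct1[OF k]] hom_setD[OF h(1)] in simp_all)
  qed
qed (use assms in \<open>simp_all add: hom_set_def\<close>)

lemma is_product_comparison_iso:
  assumes "is_product C A B P p q" "is_product C A B P' p' q'"
    and "c \<in> Arr C" "Dom C c = P" "Cod C c = P'" "p' \<cdot> c = p" "q' \<cdot> c = q"
  shows "is_iso C c"
proof -
  note D = is_productD[OF assms(1)] is_productD[OF assms(2)]
  obtain d where d: "d \<in> Arr C" "Dom C d = P'" "Cod C d = P" "p \<cdot> d = p'" "q \<cdot> d = q'"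
    by (rule is_product_lift[OF assms(1), of p' q']) (use D in simp_all)
  show ?thesis
  proof (rule is_isoI[of _ d])
    show "d \<cdot> c = Ide C (Dom C c)"
      by (rule is_product_mono[OF assms(1)])
        (use D d assms(3-) in \<open>simp_all add: cmp_extend[OF d(4)] cmp_extend[OF d(5)]\<close>)
    show "c \<cdot> d = Ide C (Cod C c)"
      by (rule is_product_mono[OF assms(2)])
        (use D d assms(3-) in \<open>simp_all add: cmp_extend[OF assms(6)] cmp_extend[OF assms(7)]\<close>)
  qed (use d assms in simp_all)
qed

end

section \<open>Chosen products, pairing and the product functor\<close>

locale category_with_products = category C for C :: "('o, 'a) cat" (structure) +
  fixes X :: "('o, 'a) prods"
  assumes chosen: "chosen_products C X"
begin

lemma terminal_tob: "is_terminal C (tob X)"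
  using chosen by (simp add: chosen_products_def)

lemma tob_Obj [simp]: "tob X \<in> Obj C"
  using terminal_tob by (simp add: is_terminal_def)

lemma product_pob: "\<lbrakk>A \<in> Obj C; B \<in> Obj C\<rbrakk> \<Longrightarrow> is_product C A B (pob X A B) (pr1 X A B) (pr2 X A B)"
  using chosen by (simp add: chosen_products_def)

lemma proj_simps [simp]:
  assumes "A \<in> Obj C" "B \<in> Obj C"
  shows "pob X A B \<in> Obj C"
    and "pr1 X A B \<in> Arr C" "Dom C (pr1 X A B) = pob X A B" "Cod C (pr1 X A B) = A"
    and "pr2 X A B \<in> Arr C" "Dom C (pr2 X A B) = pob X A B" "Cod C (pr2 X A B) = B"
  using is_productD[OF product_pob[OF assms]] by auto

text \<open>The standard opening for an equation into a product: it leaves two component equations,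
  which \<open>pr_pairing\<close> and \<open>pr_pairing_extend\<close> let the simplifier
  compute.\<close>

lemma proj_joint_mono:
  assumes "A \<in> Obj C" "B \<in> Obj C" "x \<in> Arr C" "y \<in> Arr C" "Dom C x = Dom C y"
    and "Cod C x = pob X A B" "Cod C y = pob X A B"
    and "pr1 X A B \<cdot> x = pr1 X A B \<cdot> y" "pr2 X A B \<cdot> x = pr2 X A B \<cdot> y"
  shows "x = y"
  using is_product_mono[OF product_pob] assms by blast

lemma pairing_char:
  assumes "f \<in> Arr C" "g \<in> Arr C" "Dom C f = Dom C g"
  shows "pairing C X f g \<in> hom_set C (Dom C g) (pob X (Cod C f) (Cod C g)) \<and>
    pr1 X (Cod C f) (Cod C g) \<cdot> pairing C X f g = f \<and>
    pr2 X (Cod C f) (Cod C g) \<cdot> pairing C X f g = g"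
proof -
  have "is_product C (Cod C f) (Cod C g) (pob X (Cod C f) (Cod C g))
      (pr1 X (Cod C f) (Cod C g)) (pr2 X (Cod C f) (Cod C g))"
    using assms by (intro product_pob) simp_all
  then have "\<exists>!h. h \<in> hom_set C (Dom C g) (pob X (Cod C f) (Cod C g)) \<and>
      pr1 X (Cod C f) (Cod C g) \<cdot> h = f \<and> pr2 X (Cod C f) (Cod C g) \<cdot> h = g"
    using assms hom_setI[of f C "Dom C g" "Cod C f"] hom_setI[of g C "Dom C g" "Cod C g"]
    unfolding is_product_def by blast
  from theI'[OF this] show ?thesis
    unfolding pairing_def assms(3) .
qed

lemma pairing_simps [simp]:
  assumes "f \<in> Arr C" "g \<in> Arr C" "Dom C f = Dom C g"
  shows "pairing C X f g \<in> Arr C" "Dom C (pairing C X f g) = Dom C g"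
    and "Cod C (pairing C X f g) = pob X (Cod C f) (Cod C g)"
  using pairing_char[OF assms] by (auto simp: hom_set_def)

lemma pr_pairing [simp]:
  assumes "f \<in> Arr C" "g \<in> Arr C" "Dom C f = Dom C g" "Cod C f = A" "Cod C g = B"
  shows "pr1 X A B \<cdot> pairing C X f g = f" "pr2 X A B \<cdot> pairing C X f g = g"
  using pairing_char[OF assms(1-3)] assms(4,5) by auto

lemma pr_pairing_extend [simp]:
  assumes "f \<in> Arr C" "g \<in> Arr C" "Dom C f = Dom C g" "Cod C f = A" "Cod C g = B" "x \<in> Arr C" "Cod C x = Dom C g"
  shows "pr1 X A B \<cdot> (pairing C X f g \<cdot> x) = f \<cdot> x" "pr2 X A B \<cdot> (pairing C X f g \<cdot> x) = g \<cdot> x"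
proof -
  have "A \<in> Obj C" "B \<in> Obj C" using assms by auto
  then show "pr1 X A B \<cdot> (pairing C X f g \<cdot> x) = f \<cdot> x" "pr2 X A B \<cdot> (pairing C X f g \<cdot> x) = g \<cdot> x"
    using assms by (auto intro!: cmp_extend)
qed

lemma product_ftor_onO: "onO (product_ftor C X) (A, B) = pob X A B"
  by (simp add: product_ftor_def)

lemma product_ftor_onA:
  "onA (product_ftor C X) (f, g) = pairing C X (f \<cdot> pr1 X (Dom C f) (Dom C g)) (g \<cdot> pr2 X (Dom C f) (Dom C g))"
  by (simp add: product_ftor_def)

lemma functor_product_ftor: "is_functor (prod_cat C C) C (product_ftor C X)"
  unfolding is_functor_def
proof (intro conjI ballI impI)
  fix A assume "A \<in> Obj (prod_cat C C)"
  then obtain a b where A: "A = (a, b)" "a \<in> Obj C" "b \<in> Obj C" by (auto simp: prod_cat_def)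
  then show "onO (product_ftor C X) A \<in> Obj C" by (simp add: product_ftor_onO)
  show "onA (product_ftor C X) (Ide (prod_cat C C) A) = Ide C (onO (product_ftor C X) A)"
    by (rule proj_joint_mono[of a b]) (use A in \<open>simp_all add: product_ftor_onO product_ftor_onA prod_cat_def\<close>)
next
  fix F assume "F \<in> Arr (prod_cat C C)"
  then obtain f f' where F: "F = (f, f')" "f \<in> Arr C" "f' \<in> Arr C" by (auto simp: prod_cat_def)
  then show "onA (product_ftor C X) F \<in> hom_set C (onO (product_ftor C X) (Dom (prod_cat C C) F))
     (onO (product_ftor C X) (Cod (prod_cat C C) F))"
    by (simp add: product_ftor_onO product_ftor_onA prod_cat_def hom_set_def)
  fix G assume "G \<in> Arr (prod_cat C C)" and c: "Cod (prod_cat C C) F = Dom (prod_cat C C) G"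
  then obtain g g' where G: "G = (g, g')" "g \<in> Arr C" "g' \<in> Arr C" "Cod C f = Dom C g" "Cod C f' = Dom C g'"
    using F by (auto simp: prod_cat_def)
  show "onA (product_ftor C X) (G \<cdot>\<^bsub>prod_cat C C\<^esub> F) = onA (product_ftor C X) G \<cdot> onA (product_ftor C X) F"
    by (rule proj_joint_mono[of "Cod C g" "Cod C g'"])
      (use F G in \<open>simp_all add: product_ftor_onA prod_cat_def assoc_simp\<close>)
qed

end

section \<open>Double categories\<close>

lemma is_functorD:
  assumes "is_functor C D F"
  shows "A \<in> Obj C \<Longrightarrow> onO F A \<in> Obj D"
    and "f \<in> Arr C \<Longrightarrow> onA F f \<in> Arr D"
    and "f \<in> Arr C \<Longrightarrow> Dom D (onA F f) = onO F (Dom C f)"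
    and "f \<in> Arr C \<Longrightarrow> Cod D (onA F f) = onO F (Cod C f)"
    and "A \<in> Obj C \<Longrightarrow> onA F (Ide C A) = Ide D (onO F A)"
    and "\<lbrakk>f \<in> Arr C; g \<in> Arr C; Cod C f = Dom C g\<rbrakk>
      \<Longrightarrow> onA F (g \<cdot>\<^bsub>C\<^esub> f) = onA F g \<cdot>\<^bsub>D\<^esub> onA F f"
  using assms by (auto simp: is_functor_def hom_set_def)

lemma globularD:
  assumes "globular D \<alpha>"
  obtains A B where "A \<in> Obj (D0 D)" "B \<in> Obj (D0 D)"
    "onA (Src D) \<alpha> = Ide (D0 D) A" "onA (Tgt D) \<alpha> = Ide (D0 D) B"
  using assms by (auto simp: globular_def has_sides_def)

section \<open>Calculus of cells: sides, interchange, invertibility and coherence of units\<close>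

context double_category
begin

abbreviation "S0 \<equiv> onO (Src D)"
abbreviation "S1 \<equiv> onA (Src D)"
abbreviation "T0 \<equiv> onO (Tgt D)"
abbreviation "T1 \<equiv> onA (Tgt D)"
abbreviation "U0 \<equiv> onO (Uni D)"
abbreviation "U1 \<equiv> onA (Uni D)"
abbreviation vcmp (infixl "\<bullet>" 70) where "\<beta> \<bullet> \<alpha> \<equiv> \<beta> \<cdot>\<^bsub>D1 D\<^esub> \<alpha>"

sublocale V: category "D0 D" by (rule cat_D0)
sublocale H: category "D1 D" by (rule cat_D1)

lemmas Src_simps [simp] = is_functorD[OF functor_Src]
lemmas Tgt_simps [simp] = is_functorD[OF functor_Tgt]
lemmas Uni_simps [simp] = is_functorD(1-5)[OF functor_Uni]
lemmas Uni_cmp = is_functorD(6)[OF functor_Uni]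
declare Src_Uni [simp] Tgt_Uni [simp]

lemma Obj_composables [simp]:
  "(M, N) \<in> Obj (composables D) \<longleftrightarrow> M \<in> Obj (D1 D) \<and> N \<in> Obj (D1 D) \<and> S0 M = T0 N"
  by (simp add: composables_def)

lemma Arr_composables [simp]:
  "(\<alpha>, \<beta>) \<in> Arr (composables D) \<longleftrightarrow> \<alpha> \<in> Arr (D1 D) \<and> \<beta> \<in> Arr (D1 D) \<and> S1 \<alpha> = T1 \<beta>"
  by (simp add: composables_def)

lemma hcomp_simps [simp]:
  assumes "M \<in> Obj (D1 D)" "N \<in> Obj (D1 D)" "S0 M = T0 N"
  shows "M \<odot> N \<in> Obj (D1 D)" "S0 (M \<odot> N) = S0 N" "T0 (M \<odot> N) = T0 M"
  using assms is_functorD(1)[OF functor_HComp] Src_HComp(1) Tgt_HComp(1) by simp_all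

lemma hcomp_cell_simps [simp]:
  assumes "\<alpha> \<in> Arr (D1 D)" "\<beta> \<in> Arr (D1 D)" "S1 \<alpha> = T1 \<beta>"
  shows "\<alpha> \<star> \<beta> \<in> Arr (D1 D)" "S1 (\<alpha> \<star> \<beta>) = S1 \<beta>" "T1 (\<alpha> \<star> \<beta>) = T1 \<alpha>"
    and "Dom (D1 D) (\<alpha> \<star> \<beta>) = Dom (D1 D) \<alpha> \<odot> Dom (D1 D) \<beta>"
    and "Cod (D1 D) (\<alpha> \<star> \<beta>) = Cod (D1 D) \<alpha> \<odot> Cod (D1 D) \<beta>"
  using assms is_functorD(2-4)[OF functor_HComp, of "(\<alpha>, \<beta>)"] Src_HComp(2) Tgt_HComp(2)
  by (simp_all add: composables_def prod_cat_def)

text \<open>\<open>S\<close> and \<open>T\<close> preserve domains and codomains, so a common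
  vertical side makes the boundaries of two cells horizontally composable.\<close>

lemma sides_composable:
  assumes "\<alpha> \<in> Arr (D1 D)" "\<beta> \<in> Arr (D1 D)" "S1 \<alpha> = T1 \<beta>"
  shows "S0 (Dom (D1 D) \<alpha>) = T0 (Dom (D1 D) \<beta>)" "S0 (Cod (D1 D) \<alpha>) = T0 (Cod (D1 D) \<beta>)"
  using assms Src_simps(3,4)[of \<alpha>] Tgt_simps(3,4)[of \<beta>] by simp_all

lemma hcomp_ide [simp]:
  assumes "M \<in> Obj (D1 D)" "N \<in> Obj (D1 D)" "S0 M = T0 N"
  shows "Ide (D1 D) M \<star> Ide (D1 D) N = Ide (D1 D) (M \<odot> N)"
  using assms is_functorD(5)[OF functor_HComp, of "(M, N)"]
  by (simp add: composables_def prod_cat_def)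

lemma hcomp_cmp:
  assumes "\<alpha> \<in> Arr (D1 D)" "\<alpha>' \<in> Arr (D1 D)" "\<beta> \<in> Arr (D1 D)" "\<beta>' \<in> Arr (D1 D)"
    and "Cod (D1 D) \<alpha> = Dom (D1 D) \<alpha>'" "Cod (D1 D) \<beta> = Dom (D1 D) \<beta>'"
    and "S1 \<alpha> = T1 \<beta>" "S1 \<alpha>' = T1 \<beta>'"
  shows "(\<alpha>' \<bullet> \<alpha>) \<star> (\<beta>' \<bullet> \<beta>) = (\<alpha>' \<star> \<beta>') \<bullet> (\<alpha> \<star> \<beta>)"
  using assms is_functorD(6)[OF functor_HComp, of "(\<alpha>, \<beta>)" "(\<alpha>', \<beta>')"]
  by (simp add: composables_def prod_cat_def)

text \<open>Globularity by definition only says that the sides are identities of some objects;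
  preservation of domains and codomains by \<open>S\<close> and \<open>T\<close> tells which objects
  these are.\<close>

lemma globular_sides:
  assumes "globular D \<alpha>" "\<alpha> \<in> hom_set (D1 D) M N"
  shows "\<alpha> \<in> Arr (D1 D)" "Dom (D1 D) \<alpha> = M" "Cod (D1 D) \<alpha> = N"
    and "S1 \<alpha> = Ide (D0 D) (S0 M)" "T1 \<alpha> = Ide (D0 D) (T0 M)"
    and "S0 M = S0 N" "T0 M = T0 N"
proof -
  note h = hom_setD[OF assms(2)]
  show "\<alpha> \<in> Arr (D1 D)" "Dom (D1 D) \<alpha> = M" "Cod (D1 D) \<alpha> = N" by (fact h)+
  obtain A B where AB: "A \<in> Obj (D0 D)" "B \<in> Obj (D0 D)" "S1 \<alpha> = Ide (D0 D) A" "T1 \<alpha> = Ide (D0 D) B"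
    using assms(1) by (rule globularD)
  have "A = S0 M" "A = S0 N" "B = T0 M" "B = T0 N"
    using Src_simps(3,4)[of \<alpha>] Tgt_simps(3,4)[of \<alpha>] h AB by simp_all
  with AB show "S1 \<alpha> = Ide (D0 D) (S0 M)" "T1 \<alpha> = Ide (D0 D) (T0 M)" "S0 M = S0 N" "T0 M = T0 N"
    by simp_all
qed

lemma globularI:
  assumes "\<alpha> \<in> Arr (D1 D)" "A \<in> Obj (D0 D)" "B \<in> Obj (D0 D)" "S1 \<alpha> = Ide (D0 D) A" "T1 \<alpha> = Ide (D0 D) B"
  shows "globular D \<alpha>"
  using assms by (auto simp: globular_def has_sides_def)

lemma assoc_simps [simp]:
  assumes "M \<in> Obj (D1 D)" "N \<in> Obj (D1 D)" "P \<in> Obj (D1 D)" "S0 M = T0 N" "S0 N = T0 P"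
  shows "assoc D M N P \<in> Arr (D1 D)" "Dom (D1 D) (assoc D M N P) = (M \<odot> N) \<odot> P"
    and "Cod (D1 D) (assoc D M N P) = M \<odot> (N \<odot> P)"
    and "S1 (assoc D M N P) = Ide (D0 D) (S0 P)" "T1 (assoc D M N P) = Ide (D0 D) (T0 M)"
    and "is_iso (D1 D) (assoc D M N P)"
proof -
  have a: "globular D (assoc D M N P)" "assoc D M N P \<in> hom_set (D1 D) (M \<odot> N \<odot> P) (M \<odot> (N \<odot> P))"
      "is_iso (D1 D) (assoc D M N P)"
    using assoc_iso[of M N P] assms by simp_all
  show "assoc D M N P \<in> Arr (D1 D)" "Dom (D1 D) (assoc D M N P) = (M \<odot> N) \<odot> P"
      "Cod (D1 D) (assoc D M N P) = M \<odot> (N \<odot> P)" "is_iso (D1 D) (assoc D M N P)"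
      "S1 (assoc D M N P) = Ide (D0 D) (S0 P)" "T1 (assoc D M N P) = Ide (D0 D) (T0 M)"
    using globular_sides[OF a(1,2)] a(3) assms by simp_all
qed

lemma lunit_simps [simp]:
  assumes "M \<in> Obj (D1 D)"
  shows "lunit D M \<in> Arr (D1 D)" "Dom (D1 D) (lunit D M) = U0 (T0 M) \<odot> M" "Cod (D1 D) (lunit D M) = M"
    and "S1 (lunit D M) = Ide (D0 D) (S0 M)" "T1 (lunit D M) = Ide (D0 D) (T0 M)"
    and "is_iso (D1 D) (lunit D M)"
  using globular_sides[of "lunit D M"] lunit_iso[OF assms] assms by auto

lemma runit_simps [simp]:
  assumes "M \<in> Obj (D1 D)"
  shows "runit D M \<in> Arr (D1 D)" "Dom (D1 D) (runit D M) = M \<odot> U0 (S0 M)" "Cod (D1 D) (runit D M) = M"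
    and "S1 (runit D M) = Ide (D0 D) (S0 M)" "T1 (runit D M) = Ide (D0 D) (T0 M)"
    and "is_iso (D1 D) (runit D M)"
  using globular_sides[of "runit D M"] runit_iso[OF assms] assms by auto

text \<open>Functors preserve inverses. The inverse is named explicitly so that its sides can be
  read off; in particular the inverse of a globular cell is globular.\<close>

lemma is_iso_side:
  assumes "is_iso (D1 D) \<alpha>" "\<beta> \<in> Arr (D1 D)" "Dom (D1 D) \<beta> = Cod (D1 D) \<alpha>" "Cod (D1 D) \<beta> = Dom (D1 D) \<alpha>"
    and "\<beta> \<bullet> \<alpha> = Ide (D1 D) (Dom (D1 D) \<alpha>)" "\<alpha> \<bullet> \<beta> = Ide (D1 D) (Cod (D1 D) \<alpha>)"
  shows "S1 \<beta> \<cdot>\<^bsub>D0 D\<^esub> S1 \<alpha> = Ide (D0 D) (S0 (Dom (D1 D) \<alpha>))"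
    and "S1 \<alpha> \<cdot>\<^bsub>D0 D\<^esub> S1 \<beta> = Ide (D0 D) (S0 (Cod (D1 D) \<alpha>))"
    and "T1 \<beta> \<cdot>\<^bsub>D0 D\<^esub> T1 \<alpha> = Ide (D0 D) (T0 (Dom (D1 D) \<alpha>))"
    and "T1 \<alpha> \<cdot>\<^bsub>D0 D\<^esub> T1 \<beta> = Ide (D0 D) (T0 (Cod (D1 D) \<alpha>))"
  using assms H.is_iso_Arr[OF assms(1)]
  by (simp_all flip: Src_simps(5,6) Tgt_simps(5,6))

lemma is_iso_hcomp:
  assumes "is_iso (D1 D) \<alpha>" "is_iso (D1 D) \<beta>" "S1 \<alpha> = T1 \<beta>"
  shows "is_iso (D1 D) (\<alpha> \<star> \<beta>)"
proof -
  obtain \<alpha>' where \<alpha>': "\<alpha>' \<in> Arr (D1 D)" "Dom (D1 D) \<alpha>' = Cod (D1 D) \<alpha>" "Cod (D1 D) \<alpha>' = Dom (D1 D) \<alpha>"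
      "\<alpha>' \<bullet> \<alpha> = Ide (D1 D) (Dom (D1 D) \<alpha>)" "\<alpha> \<bullet> \<alpha>' = Ide (D1 D) (Cod (D1 D) \<alpha>)"
    using assms(1) by (rule H.is_isoE)
  obtain \<beta>' where \<beta>': "\<beta>' \<in> Arr (D1 D)" "Dom (D1 D) \<beta>' = Cod (D1 D) \<beta>" "Cod (D1 D) \<beta>' = Dom (D1 D) \<beta>"
      "\<beta>' \<bullet> \<beta> = Ide (D1 D) (Dom (D1 D) \<beta>)" "\<beta> \<bullet> \<beta>' = Ide (D1 D) (Cod (D1 D) \<beta>)"
    using assms(2) by (rule H.is_isoE)
  note a = H.is_iso_Arr[OF assms(1)] H.is_iso_Arr[OF assms(2)]
  note c = sides_composable[OF a assms(3)]
  \<comment> \<open>Both are inverse to the common side \<open>S1 \<alpha> = T1 \<beta>\<close>;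
    without this the two inverse cells could not be composed horizontally.\<close>
  have s: "S1 \<alpha>' = T1 \<beta>'"
    by (rule V.inverse_unique[of "S1 \<alpha>"])
      (use a c \<alpha>' \<beta>' assms(3) is_iso_side[OF assms(1) \<alpha>'] is_iso_side[OF assms(2) \<beta>'] in simp_all)
  show ?thesis
  proof (rule H.is_isoI[of _ "\<alpha>' \<star> \<beta>'"])
    show "(\<alpha>' \<star> \<beta>') \<bullet> (\<alpha> \<star> \<beta>) = Ide (D1 D) (Dom (D1 D) (\<alpha> \<star> \<beta>))"
      using a c \<alpha>' \<beta>' s assms(3) by (simp flip: hcomp_cmp)
    show "(\<alpha> \<star> \<beta>) \<bullet> (\<alpha>' \<star> \<beta>') = Ide (D1 D) (Cod (D1 D) (\<alpha> \<star> \<beta>))"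
      using a c \<alpha>' \<beta>' s assms(3) by (simp flip: hcomp_cmp)
  qed (use a \<alpha>' \<beta>' s assms(3) in simp_all)
qed

text \<open>When the target side is an identity, the cell \<open>U1 (T1 \<alpha>)\<close> in the
  naturality of \<open>lunit\<close> is an identity cell. Whiskering with the unit then amounts to
  conjugation by invertible unit constraints.\<close>

lemma unit_whisker_faithful_left:
  assumes "\<alpha> \<in> Arr (D1 D)" "\<beta> \<in> Arr (D1 D)" "Dom (D1 D) \<alpha> = Dom (D1 D) \<beta>" "Cod (D1 D) \<alpha> = Cod (D1 D) \<beta>"
    and "B \<in> Obj (D0 D)" "T1 \<alpha> = Ide (D0 D) B" "T1 \<beta> = Ide (D0 D) B"
    and "Ide (D1 D) (U0 B) \<star> \<alpha> = Ide (D1 D) (U0 B) \<star> \<beta>"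
  shows "\<alpha> = \<beta>"
proof (rule H.iso_cancel_right[of "lunit D (Dom (D1 D) \<alpha>)"])
  show "\<alpha> \<bullet> lunit D (Dom (D1 D) \<alpha>) = \<beta> \<bullet> lunit D (Dom (D1 D) \<alpha>)"
    using lunit_natural[of \<alpha>] lunit_natural[of \<beta>] assms by simp
qed (use assms in simp_all)

lemma unit_whisker_faithful_right:
  assumes "\<alpha> \<in> Arr (D1 D)" "\<beta> \<in> Arr (D1 D)" "Dom (D1 D) \<alpha> = Dom (D1 D) \<beta>" "Cod (D1 D) \<alpha> = Cod (D1 D) \<beta>"
    and "B \<in> Obj (D0 D)" "S1 \<alpha> = Ide (D0 D) B" "S1 \<beta> = Ide (D0 D) B"
    and "\<alpha> \<star> Ide (D1 D) (U0 B) = \<beta> \<star> Ide (D1 D) (U0 B)"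
  shows "\<alpha> = \<beta>"
proof (rule H.iso_cancel_right[of "runit D (Dom (D1 D) \<alpha>)"])
  show "\<alpha> \<bullet> runit D (Dom (D1 D) \<alpha>) = \<beta> \<bullet> runit D (Dom (D1 D) \<alpha>)"
    using runit_natural[of \<alpha>] runit_natural[of \<beta>] assms by simp
qed (use assms in simp_all)

text \<open>
  Kelly's coherence facts. The two sides become equal after whiskering with a unit and pasting
  onto a pentagon; whiskering with a unit is faithful on globular cells.
\<close>

lemma lunit_hcomp:
  assumes "M \<in> Obj (D1 D)" "N \<in> Obj (D1 D)" "S0 M = T0 N"
  shows "lunit D (M \<odot> N) \<bullet> assoc D (U0 (T0 M)) M N = lunit D M \<star> Ide (D1 D) N"
    (is "?x = ?y")
proof -
  let ?U = "U0 (T0 M)"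
  \<comment> \<open>Two of the three edges on the long path of the pentagon for
    \<open>?U, ?U, M, N\<close>; the third edge is the associator inside the whiskered
    \<open>?x\<close>. As \<open>?c\<close> is invertible, it can be cancelled on the right at the
    end.\<close>
  let ?c = "assoc D ?U (?U \<odot> M) N \<bullet> (assoc D ?U ?U M \<star> Ide (D1 D) N)"
  have "(Ide (D1 D) ?U \<star> ?x) \<bullet> ?c
      = ((Ide (D1 D) ?U \<bullet> Ide (D1 D) ?U) \<star> (lunit D (M \<odot> N) \<bullet> assoc D ?U M N)) \<bullet> ?c"
    using assms by simp
  also have "\<dots> = (Ide (D1 D) ?U \<star> lunit D (M \<odot> N)) \<bullet>
      ((Ide (D1 D) ?U \<star> assoc D ?U M N) \<bullet> assoc D ?U (?U \<odot> M) N \<bullet> (assoc D ?U ?U M \<star> Ide (D1 D) N))"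
    using assms by (subst hcomp_cmp) (simp_all add: H.assoc_simp)
  also have "\<dots> = (Ide (D1 D) ?U \<star> lunit D (M \<odot> N)) \<bullet>
      (assoc D ?U ?U (M \<odot> N) \<bullet> assoc D (?U \<odot> ?U) M N)"
    using assms by (subst pentagon) simp_all
  also have "\<dots> = (runit D ?U \<star> Ide (D1 D) (M \<odot> N)) \<bullet> assoc D (?U \<odot> ?U) M N"
    using assms triangle[of ?U "M \<odot> N"] by (intro H.cmp_extend) simp_all
  also have "\<dots> = assoc D ?U M N \<bullet> ((runit D ?U \<star> Ide (D1 D) M) \<star> Ide (D1 D) N)"
    using assms assoc_natural[of "runit D ?U" "Ide (D1 D) M" "Ide (D1 D) N"] by simp
  also have "\<dots> = assoc D ?U M N \<bullet>
      (((Ide (D1 D) ?U \<star> lunit D M) \<bullet> assoc D ?U ?U M) \<star> (Ide (D1 D) N \<bullet> Ide (D1 D) N))"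
    using assms triangle[of ?U M] by simp
  also have "\<dots> = assoc D ?U M N \<bullet> ((Ide (D1 D) ?U \<star> lunit D M) \<star> Ide (D1 D) N)
      \<bullet> (assoc D ?U ?U M \<star> Ide (D1 D) N)"
    using assms by (subst hcomp_cmp) (simp_all add: H.assoc_simp)
  also have "\<dots> = (Ide (D1 D) ?U \<star> ?y) \<bullet> ?c"
    using assms assoc_natural[of "Ide (D1 D) ?U" "lunit D M" "Ide (D1 D) N"] by (simp add: H.assoc_simp)
  finally have e: "(Ide (D1 D) ?U \<star> ?x) \<bullet> ?c = (Ide (D1 D) ?U \<star> ?y) \<bullet> ?c" .
  have "is_iso (D1 D) ?c"
    using assms by (intro H.is_iso_cmp is_iso_hcomp H.is_iso_ide) simp_all
  then have "Ide (D1 D) ?U \<star> ?x = Ide (D1 D) ?U \<star> ?y"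
    by (rule H.iso_cancel_right) (use assms e in simp_all)
  then show ?thesis
    by (rule unit_whisker_faithful_left[rotated -1]) (use assms in simp_all)
qed

lemma runit_hcomp:
  assumes "M \<in> Obj (D1 D)" "N \<in> Obj (D1 D)" "S0 M = T0 N"
  shows "(Ide (D1 D) M \<star> runit D N) \<bullet> assoc D M N (U0 (S0 N)) = runit D (M \<odot> N)"
    (is "?x = ?y")
proof -
  let ?U = "U0 (S0 N)"
  let ?a = "assoc D M N ?U"
  \<comment> \<open>The unit is now whiskered on the right, and the pentagon for
    \<open>M, N, ?U, ?U\<close> is pasted so that the associator \<open>?a\<close> is left over in
    front of both sides, to be cancelled on the left.\<close>
  have "?a \<bullet> (?y \<star> Ide (D1 D) ?U) = ?a \<bullet> ((Ide (D1 D) (M \<odot> N) \<star> lunit D ?U) \<bullet> assoc D (M \<odot> N) ?U ?U)"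
    using assms triangle[of "M \<odot> N" ?U] by simp
  also have "\<dots> = (?a \<bullet> ((Ide (D1 D) M \<star> Ide (D1 D) N) \<star> lunit D ?U)) \<bullet> assoc D (M \<odot> N) ?U ?U"
    using assms by (simp add: H.assoc_simp)
  also have "\<dots> = ((Ide (D1 D) M \<star> (Ide (D1 D) N \<star> lunit D ?U)) \<bullet> assoc D M N (?U \<odot> ?U)) \<bullet> assoc D (M \<odot> N) ?U ?U"
    using assms assoc_natural[of "Ide (D1 D) M" "Ide (D1 D) N" "lunit D ?U"] by simp
  also have "\<dots> = (Ide (D1 D) M \<star> (Ide (D1 D) N \<star> lunit D ?U)) \<bullet> (assoc D M N (?U \<odot> ?U) \<bullet> assoc D (M \<odot> N) ?U ?U)"
    using assms by (simp add: H.assoc_simp)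
  also have "\<dots> = (Ide (D1 D) M \<star> (Ide (D1 D) N \<star> lunit D ?U)) \<bullet> ((Ide (D1 D) M \<star> assoc D N ?U ?U)
      \<bullet> assoc D M (N \<odot> ?U) ?U \<bullet> (?a \<star> Ide (D1 D) ?U))"
    using assms by (subst pentagon) simp_all
  also have "\<dots> = ((Ide (D1 D) M \<star> (Ide (D1 D) N \<star> lunit D ?U)) \<bullet> (Ide (D1 D) M \<star> assoc D N ?U ?U))
      \<bullet> (assoc D M (N \<odot> ?U) ?U \<bullet> (?a \<star> Ide (D1 D) ?U))"
    using assms by (simp add: H.assoc_simp)
  also have "\<dots> = ((Ide (D1 D) M \<bullet> Ide (D1 D) M) \<star> ((Ide (D1 D) N \<star> lunit D ?U) \<bullet> assoc D N ?U ?U))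
      \<bullet> (assoc D M (N \<odot> ?U) ?U \<bullet> (?a \<star> Ide (D1 D) ?U))"
    using assms by (subst hcomp_cmp) simp_all
  also have "\<dots> = (Ide (D1 D) M \<star> (runit D N \<star> Ide (D1 D) ?U))
      \<bullet> (assoc D M (N \<odot> ?U) ?U \<bullet> (?a \<star> Ide (D1 D) ?U))"
    using assms triangle[of N ?U] by simp
  also have "\<dots> = ?a \<bullet> (((Ide (D1 D) M \<star> runit D N) \<star> Ide (D1 D) ?U) \<bullet> (?a \<star> Ide (D1 D) ?U))"
    using assms assoc_natural[of "Ide (D1 D) M" "runit D N" "Ide (D1 D) ?U"]
    by (simp flip: H.assoc_simp)
  also have "\<dots> = ?a \<bullet> (?x \<star> (Ide (D1 D) ?U \<bullet> Ide (D1 D) ?U))"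
    using assms by (subst hcomp_cmp) simp_all
  finally have e: "?a \<bullet> (?y \<star> Ide (D1 D) ?U) = ?a \<bullet> (?x \<star> Ide (D1 D) ?U)"
    using assms by simp
  have "?y \<star> Ide (D1 D) ?U = ?x \<star> Ide (D1 D) ?U"
    by (rule H.iso_cancel_left[OF _ _ _ _ _ e]) (use assms in simp_all)
  then have "?y = ?x"
    by (rule unit_whisker_faithful_right[rotated -1]) (use assms in simp_all)
  then show ?thesis by simp
qed

text \<open>Naturality of \<open>lunit\<close> at itself identifies the whiskered constraint with
  the constraint at the composite \<open>U \<odot> U\<close>. Then \<open>lunit_hcomp\<close> and
  the triangle equate both constraints after whiskering on the right, and whiskering with a unit is
  faithful.\<close>

lemma lunit_Uni_eq_runit_Uni:
  assumes "A \<in> Obj (D0 D)"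
  shows "lunit D (U0 A) = runit D (U0 A)"
proof -
  let ?U = "U0 A"
  have "lunit D ?U \<bullet> (Ide (D1 D) ?U \<star> lunit D ?U) = lunit D ?U \<bullet> lunit D (?U \<odot> ?U)"
    using assms lunit_natural[of "lunit D ?U"] by simp
  then have l: "Ide (D1 D) ?U \<star> lunit D ?U = lunit D (?U \<odot> ?U)"
    by (rule H.iso_cancel_left[rotated -1]) (use assms in simp_all)
  have "lunit D ?U \<star> Ide (D1 D) ?U = runit D ?U \<star> Ide (D1 D) ?U"
    using lunit_hcomp[of ?U ?U] triangle[of ?U ?U] assms l by simp
  then show ?thesis
    by (rule unit_whisker_faithful_right[rotated -1]) (use assms in simp_all)
qed

end

section \<open>Companions, conjoints and extensions\<close>

context double_category
begin

lemma cartesian_cell_Arr: "cartesian_cell D \<chi> \<Longrightarrow> \<chi> \<in> Arr (D1 D)"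
  by (simp add: cartesian_cell_def)

lemma cartesian_cell_unique_lift:
  assumes "cartesian_cell D \<chi>" "\<beta> \<in> Arr (D1 D)" "Cod (D1 D) \<beta> = Cod (D1 D) \<chi>"
    and "h \<in> Arr (D0 D)" "Cod (D0 D) h = S0 (Dom (D1 D) \<chi>)" "S1 \<beta> = S1 \<chi> \<cdot>\<^bsub>D0 D\<^esub> h"
    and "k \<in> Arr (D0 D)" "Cod (D0 D) k = T0 (Dom (D1 D) \<chi>)" "T1 \<beta> = T1 \<chi> \<cdot>\<^bsub>D0 D\<^esub> k"
  shows "\<exists>!\<gamma>. \<gamma> \<in> hom_set (D1 D) (Dom (D1 D) \<beta>) (Dom (D1 D) \<chi>) \<and> has_sides D \<gamma> h k \<and> \<chi> \<bullet> \<gamma> = \<beta>"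
proof -
  have "h \<in> Arr (D0 D) \<and> Cod (D0 D) h = Dom (D0 D) (S1 \<chi>) \<and>
        k \<in> Arr (D0 D) \<and> Cod (D0 D) k = Dom (D0 D) (T1 \<chi>) \<and>
        has_sides D \<beta> (S1 \<chi> \<cdot>\<^bsub>D0 D\<^esub> h) (T1 \<chi> \<cdot>\<^bsub>D0 D\<^esub> k) \<and> Cod (D1 D) \<beta> = Cod (D1 D) \<chi>"
    using assms cartesian_cell_Arr[OF assms(1)] by (simp add: has_sides_def)
  then show ?thesis using assms(1) unfolding cartesian_cell_def by blast
qed

lemma cartesian_cell_lift:
  assumes "cartesian_cell D \<chi>" "\<beta> \<in> Arr (D1 D)" "Cod (D1 D) \<beta> = Cod (D1 D) \<chi>"
    and "h \<in> Arr (D0 D)" "Cod (D0 D) h = S0 (Dom (D1 D) \<chi>)" "S1 \<beta> = S1 \<chi> \<cdot>\<^bsub>D0 D\<^esub> h"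
    and "k \<in> Arr (D0 D)" "Cod (D0 D) k = T0 (Dom (D1 D) \<chi>)" "T1 \<beta> = T1 \<chi> \<cdot>\<^bsub>D0 D\<^esub> k"
  obtains \<gamma> where "\<gamma> \<in> Arr (D1 D)" "Dom (D1 D) \<gamma> = Dom (D1 D) \<beta>" "Cod (D1 D) \<gamma> = Dom (D1 D) \<chi>"
    "S1 \<gamma> = h" "T1 \<gamma> = k" "\<chi> \<bullet> \<gamma> = \<beta>"
  using cartesian_cell_unique_lift[OF assms] by (auto simp: hom_set_def has_sides_def)

lemma cartesian_cell_mono:
  assumes "cartesian_cell D \<chi>" "\<gamma> \<in> Arr (D1 D)" "\<gamma>' \<in> Arr (D1 D)" "Dom (D1 D) \<gamma> = Dom (D1 D) \<gamma>'"
    and "Cod (D1 D) \<gamma> = Dom (D1 D) \<chi>" "Cod (D1 D) \<gamma>' = Dom (D1 D) \<chi>"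
    and "S1 \<gamma> = S1 \<gamma>'" "T1 \<gamma> = T1 \<gamma>'" "\<chi> \<bullet> \<gamma> = \<chi> \<bullet> \<gamma>'"
  shows "\<gamma> = \<gamma>'"
proof -
  have "\<exists>!\<delta>. \<delta> \<in> hom_set (D1 D) (Dom (D1 D) (\<chi> \<bullet> \<gamma>)) (Dom (D1 D) \<chi>) \<and>
      has_sides D \<delta> (S1 \<gamma>) (T1 \<gamma>) \<and> \<chi> \<bullet> \<delta> = \<chi> \<bullet> \<gamma>"
    by (rule cartesian_cell_unique_lift[OF assms(1)])
      (use assms(2-8) cartesian_cell_Arr[OF assms(1)] in simp_all)
  moreover have "\<gamma> \<in> hom_set (D1 D) (Dom (D1 D) (\<chi> \<bullet> \<gamma>)) (Dom (D1 D) \<chi>) \<and>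
      has_sides D \<gamma> (S1 \<gamma>) (T1 \<gamma>) \<and> \<chi> \<bullet> \<gamma> = \<chi> \<bullet> \<gamma>"
    using assms(2-8) cartesian_cell_Arr[OF assms(1)] by (simp add: hom_set_def has_sides_def)
  moreover have "\<gamma>' \<in> hom_set (D1 D) (Dom (D1 D) (\<chi> \<bullet> \<gamma>)) (Dom (D1 D) \<chi>) \<and>
      has_sides D \<gamma>' (S1 \<gamma>) (T1 \<gamma>) \<and> \<chi> \<bullet> \<gamma>' = \<chi> \<bullet> \<gamma>"
    using assms(2-8) assms(9)[symmetric] cartesian_cell_Arr[OF assms(1)] by (simp add: hom_set_def has_sides_def)
  ultimately show ?thesis by blast
qed

lemma fibrant_restriction:
  assumes "fibrant D" "M \<in> Obj (D1 D)" "f \<in> Arr (D0 D)" "Cod (D0 D) f = S0 M"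
    and "g \<in> Arr (D0 D)" "Cod (D0 D) g = T0 M"
  obtains \<chi> where "cartesian_cell D \<chi>" "\<chi> \<in> Arr (D1 D)" "S1 \<chi> = f" "T1 \<chi> = g" "Cod (D1 D) \<chi> = M"
    "Dom (D1 D) \<chi> \<in> Obj (D1 D)" "S0 (Dom (D1 D) \<chi>) = Dom (D0 D) f" "T0 (Dom (D1 D) \<chi>) = Dom (D0 D) g"
proof -
  have "niche D f g M" using assms by (simp add: niche_def)
  then obtain \<chi> where "cartesian_cell D \<chi>" "has_sides D \<chi> f g" "Cod (D1 D) \<chi> = M"
    using assms(1) unfolding fibrant_def by blast
  moreover from this have "S0 (Dom (D1 D) \<chi>) = Dom (D0 D) f" "T0 (Dom (D1 D) \<chi>) = Dom (D0 D) g"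
    using Src_simps(3)[of \<chi>] Tgt_simps(3)[of \<chi>] by (simp_all add: has_sides_def)
  ultimately show ?thesis using that by (simp add: has_sides_def)
qed

text \<open>\<open>K\<close> is the restriction of the unit at the codomain of \<open>k\<close>
  along \<open>k\<close> and an identity; \<open>\<tau>\<close> is the factorization of
  \<open>U1 k\<close> through the Cartesian cell \<open>\<chi>\<close>. The last identity is tested
  after composing with \<open>\<chi>\<close>: both sides become a unit constraint applied to
  \<open>\<chi> \<star> U1 k\<close>, once with \<open>lunit\<close> and once with
  \<open>runit\<close>, and these agree at a unit.\<close>

lemma companion:
  assumes "fibrant D" "k \<in> Arr (D0 D)"
  obtains \<chi> \<tau> K where "K \<in> Obj (D1 D)" "S0 K = Dom (D0 D) k" "T0 K = Cod (D0 D) k"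
    and "\<chi> \<in> Arr (D1 D)" "Dom (D1 D) \<chi> = K" "Cod (D1 D) \<chi> = U0 (Cod (D0 D) k)"
    "S1 \<chi> = k" "T1 \<chi> = Ide (D0 D) (Cod (D0 D) k)"
    and "\<tau> \<in> Arr (D1 D)" "Dom (D1 D) \<tau> = U0 (Dom (D0 D) k)" "Cod (D1 D) \<tau> = K"
    "S1 \<tau> = Ide (D0 D) (Dom (D0 D) k)" "T1 \<tau> = k"
    and "\<chi> \<bullet> \<tau> = U1 k" "lunit D K \<bullet> (\<chi> \<star> \<tau>) = runit D K"
proof -
  let ?B = "Dom (D0 D) k" and ?C = "Cod (D0 D) k"
  obtain \<chi> where \<chi>: "cartesian_cell D \<chi>" "\<chi> \<in> Arr (D1 D)" "S1 \<chi> = k" "T1 \<chi> = Ide (D0 D) ?C" "Cod (D1 D) \<chi> = U0 ?C"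
    "Dom (D1 D) \<chi> \<in> Obj (D1 D)" "S0 (Dom (D1 D) \<chi>) = ?B" "T0 (Dom (D1 D) \<chi>) = ?C"
    by (rule fibrant_restriction[OF assms(1), of "U0 ?C" k "Ide (D0 D) ?C"]) (use assms(2) in simp_all)
  let ?K = "Dom (D1 D) \<chi>"
  obtain \<tau> where \<tau>: "\<tau> \<in> Arr (D1 D)" "Dom (D1 D) \<tau> = U0 ?B" "Cod (D1 D) \<tau> = ?K"
    "S1 \<tau> = Ide (D0 D) ?B" "T1 \<tau> = k" "\<chi> \<bullet> \<tau> = U1 k"
    by (rule cartesian_cell_lift[OF \<chi>(1), of "U1 k" "Ide (D0 D) ?B" k])
      (use assms(2) \<chi> in simp_all)
  have "\<chi> \<bullet> (lunit D ?K \<bullet> (\<chi> \<star> \<tau>)) = lunit D (U0 ?C) \<bullet> (Ide (D1 D) (U0 ?C) \<star> \<chi>) \<bullet> (\<chi> \<star> \<tau>)"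
    using lunit_natural[of \<chi>] assms(2) \<chi> \<tau>(1-5) by (simp flip: H.assoc_simp)
  also have "\<dots> = lunit D (U0 ?C) \<bullet> ((Ide (D1 D) (U0 ?C) \<bullet> \<chi>) \<star> (\<chi> \<bullet> \<tau>))"
    using assms(2) \<chi> \<tau>(1-5) by (subst hcomp_cmp) (simp_all add: H.assoc_simp)
  also have "\<dots> = runit D (U0 ?C) \<bullet> (\<chi> \<star> U1 k)"
    using assms(2) \<chi> \<tau> by (simp add: lunit_Uni_eq_runit_Uni)
  also have "\<dots> = \<chi> \<bullet> runit D ?K"
    using runit_natural[of \<chi>] assms(2) \<chi> by simp
  finally have "lunit D ?K \<bullet> (\<chi> \<star> \<tau>) = runit D ?K"
    by (rule cartesian_cell_mono[OF \<chi>(1), rotated -1]) (use assms(2) \<chi> \<tau> in simp_all)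
  with \<chi> \<tau> show ?thesis by (intro that[of ?K \<chi> \<tau>]) simp_all
qed

text \<open>The mirror image of the companion under exchange of source and target: the identity and
  \<open>h\<close> swap places in the sides of the restriction, and the two cells occur in the
  opposite order in the horizontal composite.\<close>

lemma conjoint:
  assumes "fibrant D" "h \<in> Arr (D0 D)"
  obtains \<chi> \<tau> J where "J \<in> Obj (D1 D)" "S0 J = Cod (D0 D) h" "T0 J = Dom (D0 D) h"
    and "\<chi> \<in> Arr (D1 D)" "Dom (D1 D) \<chi> = J" "Cod (D1 D) \<chi> = U0 (Cod (D0 D) h)"
    "S1 \<chi> = Ide (D0 D) (Cod (D0 D) h)" "T1 \<chi> = h"
    and "\<tau> \<in> Arr (D1 D)" "Dom (D1 D) \<tau> = U0 (Dom (D0 D) h)" "Cod (D1 D) \<tau> = J"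
    "S1 \<tau> = h" "T1 \<tau> = Ide (D0 D) (Dom (D0 D) h)"
    and "\<chi> \<bullet> \<tau> = U1 h" "runit D J \<bullet> (\<tau> \<star> \<chi>) = lunit D J"
proof -
  let ?A = "Dom (D0 D) h" and ?C = "Cod (D0 D) h"
  obtain \<chi> where \<chi>: "cartesian_cell D \<chi>" "\<chi> \<in> Arr (D1 D)" "S1 \<chi> = Ide (D0 D) ?C" "T1 \<chi> = h" "Cod (D1 D) \<chi> = U0 ?C"
    "Dom (D1 D) \<chi> \<in> Obj (D1 D)" "S0 (Dom (D1 D) \<chi>) = ?C" "T0 (Dom (D1 D) \<chi>) = ?A"
    by (rule fibrant_restriction[OF assms(1), of "U0 ?C" "Ide (D0 D) ?C" h]) (use assms(2) in simp_all)
  let ?J = "Dom (D1 D) \<chi>"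
  obtain \<tau> where \<tau>: "\<tau> \<in> Arr (D1 D)" "Dom (D1 D) \<tau> = U0 ?A" "Cod (D1 D) \<tau> = ?J"
    "S1 \<tau> = h" "T1 \<tau> = Ide (D0 D) ?A" "\<chi> \<bullet> \<tau> = U1 h"
    by (rule cartesian_cell_lift[OF \<chi>(1), of "U1 h" h "Ide (D0 D) ?A"])
      (use assms(2) \<chi> in simp_all)
  have "\<chi> \<bullet> (runit D ?J \<bullet> (\<tau> \<star> \<chi>)) = runit D (U0 ?C) \<bullet> (\<chi> \<star> Ide (D1 D) (U0 ?C)) \<bullet> (\<tau> \<star> \<chi>)"
    using runit_natural[of \<chi>] assms(2) \<chi> \<tau>(1-5) by (simp flip: H.assoc_simp)
  also have "\<dots> = runit D (U0 ?C) \<bullet> ((\<chi> \<bullet> \<tau>) \<star> (Ide (D1 D) (U0 ?C) \<bullet> \<chi>))"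
    using assms(2) \<chi> \<tau>(1-5) by (subst hcomp_cmp) (simp_all add: H.assoc_simp)
  also have "\<dots> = lunit D (U0 ?C) \<bullet> (U1 h \<star> \<chi>)"
    using assms(2) \<chi> \<tau> by (simp add: lunit_Uni_eq_runit_Uni)
  also have "\<dots> = \<chi> \<bullet> lunit D ?J"
    using lunit_natural[of \<chi>] assms(2) \<chi> by simp
  finally have "runit D ?J \<bullet> (\<tau> \<star> \<chi>) = lunit D ?J"
    by (rule cartesian_cell_mono[OF \<chi>(1), rotated -1]) (use assms(2) \<chi> \<tau> in simp_all)
  with \<chi> \<tau> show ?thesis by (intro that[of ?J \<chi> \<tau>]) simp_all
qed

text \<open>
  \<open>\<sigma>\<close> is the cell \<open>Z \<rightarrow> k\<^sub>* \<odot> Z\<close>. Only factorizations through cells with identity on the side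
  of \<open>k\<close> are needed below, so this is weaker than being opcartesian.
\<close>

lemma extension_left:
  assumes "fibrant D" "Z \<in> Obj (D1 D)" "k \<in> Arr (D0 D)" "Dom (D0 D) k = T0 Z"
  obtains \<sigma> where "\<sigma> \<in> Arr (D1 D)" "Dom (D1 D) \<sigma> = Z" "S1 \<sigma> = Ide (D0 D) (S0 Z)" "T1 \<sigma> = k"
    and "\<And>\<beta>. \<lbrakk>\<beta> \<in> Arr (D1 D); Dom (D1 D) \<beta> = Z; T1 \<beta> = k\<rbrakk> \<Longrightarrow>
      \<exists>\<gamma>. \<gamma> \<in> Arr (D1 D) \<and> Dom (D1 D) \<gamma> = Cod (D1 D) \<sigma> \<and> Cod (D1 D) \<gamma> = Cod (D1 D) \<beta> \<and>
        S1 \<gamma> = S1 \<beta> \<and> T1 \<gamma> = Ide (D0 D) (Cod (D0 D) k) \<and> \<gamma> \<bullet> \<sigma> = \<beta>"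
    and "\<And>\<gamma> \<gamma>'. \<lbrakk>\<gamma> \<in> Arr (D1 D); \<gamma>' \<in> Arr (D1 D); Dom (D1 D) \<gamma> = Cod (D1 D) \<sigma>; Dom (D1 D) \<gamma>' = Cod (D1 D) \<sigma>;
      Cod (D1 D) \<gamma> = Cod (D1 D) \<gamma>'; T1 \<gamma> = Ide (D0 D) (Cod (D0 D) k); T1 \<gamma>' = Ide (D0 D) (Cod (D0 D) k);
      \<gamma> \<bullet> \<sigma> = \<gamma>' \<bullet> \<sigma>\<rbrakk> \<Longrightarrow> \<gamma> = \<gamma>'"
proof -
  let ?C = "Cod (D0 D) k"
  obtain \<chi> \<tau> K where K: "K \<in> Obj (D1 D)" "S0 K = T0 Z" "T0 K = ?C"
    and \<chi>: "\<chi> \<in> Arr (D1 D)" "Dom (D1 D) \<chi> = K" "Cod (D1 D) \<chi> = U0 ?C" "S1 \<chi> = k" "T1 \<chi> = Ide (D0 D) ?C"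
    and \<tau>: "\<tau> \<in> Arr (D1 D)" "Dom (D1 D) \<tau> = U0 (T0 Z)" "Cod (D1 D) \<tau> = K" "S1 \<tau> = Ide (D0 D) (T0 Z)" "T1 \<tau> = k"
    and \<chi>\<tau>: "\<chi> \<bullet> \<tau> = U1 k" "lunit D K \<bullet> (\<chi> \<star> \<tau>) = runit D K"
    by (rule companion[OF assms(1,3)]) (simp add: assms(4))
  obtain l where l: "l \<in> Arr (D1 D)" "Dom (D1 D) l = Z" "Cod (D1 D) l = U0 (T0 Z) \<odot> Z"
      "l \<bullet> lunit D Z = Ide (D1 D) (U0 (T0 Z) \<odot> Z)" "lunit D Z \<bullet> l = Ide (D1 D) Z"
    using H.is_isoE[OF lunit_simps(6)[OF assms(2)]] assms(2) by auto
  \<comment> \<open>The inverse unit constraint is globular too, since its sides are inverse to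
    identities.\<close>
  have lS: "S1 l = Ide (D0 D) (S0 Z)" "T1 l = Ide (D0 D) (T0 Z)"
    using is_iso_side(1,3)[of "lunit D Z" l] l assms(2) Src_simps(2-4)[of l] Tgt_simps(2-4)[of l] by simp_all
  define \<sigma> where "\<sigma> = (\<tau> \<star> Ide (D1 D) Z) \<bullet> l"
  have \<sigma>: "\<sigma> \<in> Arr (D1 D)" "Dom (D1 D) \<sigma> = Z" "Cod (D1 D) \<sigma> = K \<odot> Z" "S1 \<sigma> = Ide (D0 D) (S0 Z)" "T1 \<sigma> = k"
    unfolding \<sigma>_def using assms K \<tau> l(1-3) lS by simp_all
  \<comment> \<open>The target side \<open>k\<close> of \<open>\<beta>\<close> is bent away by
    composing horizontally with \<open>\<chi>\<close>. The first companion identity turns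
    \<open>\<chi> \<bullet> \<tau>\<close> into \<open>U1 k\<close>, and naturality of
    \<open>lunit\<close> at \<open>\<beta>\<close> removes it.\<close>
  have ext: "lunit D (Cod (D1 D) \<beta>) \<bullet> (\<chi> \<star> \<beta>) \<bullet> \<sigma> = \<beta>"
    if \<beta>: "\<beta> \<in> Arr (D1 D)" "Dom (D1 D) \<beta> = Z" "T1 \<beta> = k" for \<beta>
  proof -
    have c: "T0 (Cod (D1 D) \<beta>) = ?C" using Tgt_simps(4)[of \<beta>] \<beta> by simp
    have "lunit D (Cod (D1 D) \<beta>) \<bullet> (\<chi> \<star> \<beta>) \<bullet> \<sigma>
        = lunit D (Cod (D1 D) \<beta>) \<bullet> ((\<chi> \<star> \<beta>) \<bullet> (\<tau> \<star> Ide (D1 D) Z)) \<bullet> l"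
      unfolding \<sigma>_def using \<beta> c assms K \<tau> \<chi> l(1-3) lS by (simp add: H.assoc_simp)
    also have "\<dots> = lunit D (Cod (D1 D) \<beta>) \<bullet> (U1 k \<star> \<beta>) \<bullet> l"
      using \<beta> c assms K \<tau> \<chi> \<chi>\<tau> by (simp flip: hcomp_cmp)
    also have "\<dots> = \<beta> \<bullet> lunit D Z \<bullet> l"
      using lunit_natural[of \<beta>] \<beta> by simp
    also have "\<dots> = \<beta>"
      using \<beta> l assms by (simp add: H.assoc_simp)
    finally show ?thesis .
  qed
  \<comment> \<open>The zigzag identity for \<open>\<sigma>\<close>, resting on the second companion
    identity. To bring \<open>\<chi>\<close> and \<open>\<tau>\<close> together the brackets must be
    moved, so the equation is precomposed with the left-hand side of the triangle for
    \<open>K\<close> and \<open>Z\<close>, which is invertible and cancelled afterwards.\<close>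
  have key: "lunit D (K \<odot> Z) \<bullet> (\<chi> \<star> \<sigma>) = Ide (D1 D) (K \<odot> Z)"
  proof -
    have "\<chi> \<star> \<sigma> = (\<chi> \<star> (\<tau> \<star> Ide (D1 D) Z)) \<bullet> (Ide (D1 D) K \<star> l)"
      unfolding \<sigma>_def using assms K \<tau> \<chi> l(1-3) lS by (simp flip: hcomp_cmp)
    then have "lunit D (K \<odot> Z) \<bullet> (\<chi> \<star> \<sigma>) \<bullet> ((Ide (D1 D) K \<star> lunit D Z) \<bullet> assoc D K (U0 (T0 Z)) Z)
        = lunit D (K \<odot> Z) \<bullet> (\<chi> \<star> (\<tau> \<star> Ide (D1 D) Z)) \<bullet>
           ((Ide (D1 D) K \<star> l) \<bullet> (Ide (D1 D) K \<star> lunit D Z)) \<bullet> assoc D K (U0 (T0 Z)) Z"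
      using assms K \<tau> \<chi> l(1-3) lS by (simp add: H.assoc_simp)
    also have "\<dots> = lunit D (K \<odot> Z) \<bullet> ((\<chi> \<star> (\<tau> \<star> Ide (D1 D) Z)) \<bullet> assoc D K (U0 (T0 Z)) Z)"
      using assms K \<tau> \<chi> l lS by (simp add: H.assoc_simp flip: hcomp_cmp)
    also have "\<dots> = lunit D (K \<odot> Z) \<bullet> assoc D (U0 ?C) K Z \<bullet> ((\<chi> \<star> \<tau>) \<star> Ide (D1 D) Z)"
      using assoc_natural[of \<chi> \<tau> "Ide (D1 D) Z"] assms K \<tau> \<chi> by (simp add: H.assoc_simp)
    also have "\<dots> = (lunit D K \<star> Ide (D1 D) Z) \<bullet> ((\<chi> \<star> \<tau>) \<star> Ide (D1 D) Z)"
      using lunit_hcomp[of K Z] assms K by simp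
    also have "\<dots> = runit D K \<star> Ide (D1 D) Z"
      using assms K \<tau> \<chi> \<chi>\<tau> by (simp flip: hcomp_cmp)
    also have "\<dots> = Ide (D1 D) (K \<odot> Z) \<bullet> ((Ide (D1 D) K \<star> lunit D Z) \<bullet> assoc D K (U0 (T0 Z)) Z)"
      using triangle[of K Z] assms K by simp
    finally show ?thesis
      by (rule H.iso_cancel_right[rotated -1])
        (use assms K \<tau> \<chi> \<sigma> in \<open>auto intro!: H.is_iso_cmp is_iso_hcomp H.is_iso_ide\<close>)
  qed
  show ?thesis
  proof (rule that[OF \<sigma>(1,2,4,5)])
    fix \<beta> assume \<beta>: "\<beta> \<in> Arr (D1 D)" "Dom (D1 D) \<beta> = Z" "T1 \<beta> = k"
    have c: "T0 (Cod (D1 D) \<beta>) = ?C" using Tgt_simps(4)[of \<beta>] \<beta> by simp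
    show "\<exists>\<gamma>. \<gamma> \<in> Arr (D1 D) \<and> Dom (D1 D) \<gamma> = Cod (D1 D) \<sigma> \<and> Cod (D1 D) \<gamma> = Cod (D1 D) \<beta> \<and>
        S1 \<gamma> = S1 \<beta> \<and> T1 \<gamma> = Ide (D0 D) (Cod (D0 D) k) \<and> \<gamma> \<bullet> \<sigma> = \<beta>"
      using ext[OF \<beta>] \<beta> c \<sigma> \<chi> assms K Src_simps(4)[of \<beta>]
      by (intro exI[of _ "lunit D (Cod (D1 D) \<beta>) \<bullet> (\<chi> \<star> \<beta>)"]) simp
  next
    fix \<gamma> \<gamma>'
    assume \<gamma>: "\<gamma> \<in> Arr (D1 D)" "\<gamma>' \<in> Arr (D1 D)" "Dom (D1 D) \<gamma> = Cod (D1 D) \<sigma>" "Dom (D1 D) \<gamma>' = Cod (D1 D) \<sigma>"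
      "Cod (D1 D) \<gamma> = Cod (D1 D) \<gamma>'" "T1 \<gamma> = Ide (D0 D) ?C" "T1 \<gamma>' = Ide (D0 D) ?C"
      and e: "\<gamma> \<bullet> \<sigma> = \<gamma>' \<bullet> \<sigma>"
    \<comment> \<open>A cell with identity target side is recovered from its composite with
      \<open>\<sigma>\<close>: interchange and naturality of \<open>lunit\<close> slide it past
      \<open>\<chi>\<close> and leave the zigzag \<open>key\<close>. Hence factorizations are
      unique.\<close>
    have r: "\<delta> = lunit D (Cod (D1 D) \<delta>) \<bullet> (\<chi> \<star> (\<delta> \<bullet> \<sigma>))"
      if \<delta>: "\<delta> \<in> Arr (D1 D)" "Dom (D1 D) \<delta> = K \<odot> Z" "T1 \<delta> = Ide (D0 D) ?C" for \<delta>
    proof -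
      have c: "T0 (Cod (D1 D) \<delta>) = ?C" using Tgt_simps(4)[of \<delta>] \<delta> assms(3) by simp
      have "lunit D (Cod (D1 D) \<delta>) \<bullet> (\<chi> \<star> (\<delta> \<bullet> \<sigma>))
          = lunit D (Cod (D1 D) \<delta>) \<bullet> ((Ide (D1 D) (U0 ?C) \<bullet> \<chi>) \<star> (\<delta> \<bullet> \<sigma>))"
        using \<chi> assms(3) by simp
      also have "\<dots> = lunit D (Cod (D1 D) \<delta>) \<bullet> (Ide (D1 D) (U0 ?C) \<star> \<delta>) \<bullet> (\<chi> \<star> \<sigma>)"
        using \<chi> \<delta> c \<sigma> K assms by (subst hcomp_cmp) (simp_all add: H.assoc_simp)
      also have "\<dots> = \<delta> \<bullet> (lunit D (K \<odot> Z) \<bullet> (\<chi> \<star> \<sigma>))"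
        using lunit_natural[of \<delta>] \<delta> \<chi> \<sigma> K assms by (simp add: H.assoc_simp)
      also have "\<dots> = \<delta>"
        using key \<delta> by simp
      finally show ?thesis ..
    qed
    show "\<gamma> = \<gamma>'"
      using r[of \<gamma>] r[of \<gamma>'] \<gamma> e \<sigma> by simp
  qed
qed

end

section \<open>Extensions along source sides and along both sides\<close>

context double_category
begin

text \<open>The same construction with the conjoint: \<open>\<sigma>\<close> is the composite from
  \<open>Z\<close> through \<open>Z \<odot> U0 (S0 Z)\<close> to \<open>Z \<odot> J\<close>, and
  source sides are bent away instead of target sides.\<close>

lemma extension_right:
  assumes "fibrant D" "Z \<in> Obj (D1 D)" "h \<in> Arr (D0 D)" "Dom (D0 D) h = S0 Z"
  obtains \<sigma> where "\<sigma> \<in> Arr (D1 D)" "Dom (D1 D) \<sigma> = Z" "S1 \<sigma> = h" "T1 \<sigma> = Ide (D0 D) (T0 Z)"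
    and "\<And>\<beta>. \<lbrakk>\<beta> \<in> Arr (D1 D); Dom (D1 D) \<beta> = Z; S1 \<beta> = h\<rbrakk> \<Longrightarrow>
      \<exists>\<gamma>. \<gamma> \<in> Arr (D1 D) \<and> Dom (D1 D) \<gamma> = Cod (D1 D) \<sigma> \<and> Cod (D1 D) \<gamma> = Cod (D1 D) \<beta> \<and>
        S1 \<gamma> = Ide (D0 D) (Cod (D0 D) h) \<and> T1 \<gamma> = T1 \<beta> \<and> \<gamma> \<bullet> \<sigma> = \<beta>"
    and "\<And>\<gamma> \<gamma>'. \<lbrakk>\<gamma> \<in> Arr (D1 D); \<gamma>' \<in> Arr (D1 D); Dom (D1 D) \<gamma> = Cod (D1 D) \<sigma>; Dom (D1 D) \<gamma>' = Cod (D1 D) \<sigma>;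
      Cod (D1 D) \<gamma> = Cod (D1 D) \<gamma>'; S1 \<gamma> = Ide (D0 D) (Cod (D0 D) h); S1 \<gamma>' = Ide (D0 D) (Cod (D0 D) h);
      \<gamma> \<bullet> \<sigma> = \<gamma>' \<bullet> \<sigma>\<rbrakk> \<Longrightarrow> \<gamma> = \<gamma>'"
proof -
  let ?C = "Cod (D0 D) h"
  obtain \<chi> \<tau> J where J: "J \<in> Obj (D1 D)" "S0 J = ?C" "T0 J = S0 Z"
    and \<chi>: "\<chi> \<in> Arr (D1 D)" "Dom (D1 D) \<chi> = J" "Cod (D1 D) \<chi> = U0 ?C" "S1 \<chi> = Ide (D0 D) ?C" "T1 \<chi> = h"
    and \<tau>: "\<tau> \<in> Arr (D1 D)" "Dom (D1 D) \<tau> = U0 (S0 Z)" "Cod (D1 D) \<tau> = J" "S1 \<tau> = h" "T1 \<tau> = Ide (D0 D) (S0 Z)"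
    and \<chi>\<tau>: "\<chi> \<bullet> \<tau> = U1 h" "runit D J \<bullet> (\<tau> \<star> \<chi>) = lunit D J"
    by (rule conjoint[OF assms(1,3)]) (simp add: assms(4))
  obtain r where r: "r \<in> Arr (D1 D)" "Dom (D1 D) r = Z" "Cod (D1 D) r = Z \<odot> U0 (S0 Z)"
      "r \<bullet> runit D Z = Ide (D1 D) (Z \<odot> U0 (S0 Z))" "runit D Z \<bullet> r = Ide (D1 D) Z"
    using H.is_isoE[OF runit_simps(6)[OF assms(2)]] assms(2) by auto
  have rS: "S1 r = Ide (D0 D) (S0 Z)" "T1 r = Ide (D0 D) (T0 Z)"
    using is_iso_side(1,3)[of "runit D Z" r] r assms(2) Src_simps(2-4)[of r] Tgt_simps(2-4)[of r] by simp_all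
  define \<sigma> where "\<sigma> = (Ide (D1 D) Z \<star> \<tau>) \<bullet> r"
  have \<sigma>: "\<sigma> \<in> Arr (D1 D)" "Dom (D1 D) \<sigma> = Z" "Cod (D1 D) \<sigma> = Z \<odot> J" "S1 \<sigma> = h" "T1 \<sigma> = Ide (D0 D) (T0 Z)"
    unfolding \<sigma>_def using assms J \<tau> r(1-3) rS by simp_all
  have ext: "runit D (Cod (D1 D) \<beta>) \<bullet> (\<beta> \<star> \<chi>) \<bullet> \<sigma> = \<beta>"
    if \<beta>: "\<beta> \<in> Arr (D1 D)" "Dom (D1 D) \<beta> = Z" "S1 \<beta> = h" for \<beta>
  proof -
    have c: "S0 (Cod (D1 D) \<beta>) = ?C" using Src_simps(4)[of \<beta>] \<beta> by simp
    have "runit D (Cod (D1 D) \<beta>) \<bullet> (\<beta> \<star> \<chi>) \<bullet> \<sigma>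
        = runit D (Cod (D1 D) \<beta>) \<bullet> ((\<beta> \<star> \<chi>) \<bullet> (Ide (D1 D) Z \<star> \<tau>)) \<bullet> r"
      unfolding \<sigma>_def using \<beta> c assms J \<tau> \<chi> r(1-3) rS by (simp add: H.assoc_simp)
    also have "\<dots> = runit D (Cod (D1 D) \<beta>) \<bullet> (\<beta> \<star> U1 h) \<bullet> r"
      using \<beta> c assms J \<tau> \<chi> \<chi>\<tau> by (simp flip: hcomp_cmp)
    also have "\<dots> = \<beta> \<bullet> runit D Z \<bullet> r"
      using runit_natural[of \<beta>] \<beta> by simp
    also have "\<dots> = \<beta>"
      using \<beta> r assms by (simp add: H.assoc_simp)
    finally show ?thesis .
  qed
  \<comment> \<open>Here \<open>runit_hcomp\<close> itself produces the associator that moves the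
    brackets, so the zigzag is a direct computation and nothing has to be cancelled.\<close>
  have key: "runit D (Z \<odot> J) \<bullet> (\<sigma> \<star> \<chi>) = Ide (D1 D) (Z \<odot> J)"
  proof -
    let ?a = "assoc D Z (U0 (S0 Z)) J"
    have "\<sigma> \<star> \<chi> = ((Ide (D1 D) Z \<star> \<tau>) \<star> \<chi>) \<bullet> (r \<star> Ide (D1 D) J)"
      unfolding \<sigma>_def using assms J \<tau> \<chi> r(1-3) rS by (simp flip: hcomp_cmp)
    then have "runit D (Z \<odot> J) \<bullet> (\<sigma> \<star> \<chi>)
        = (Ide (D1 D) Z \<star> runit D J) \<bullet> (assoc D Z J (U0 ?C) \<bullet> ((Ide (D1 D) Z \<star> \<tau>) \<star> \<chi>)) \<bullet> (r \<star> Ide (D1 D) J)"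
      using runit_hcomp[of Z J, symmetric] assms J \<tau> \<chi> r(1-3) rS by (simp add: H.assoc_simp)
    also have "\<dots> = ((Ide (D1 D) Z \<star> runit D J) \<bullet> (Ide (D1 D) Z \<star> (\<tau> \<star> \<chi>))) \<bullet> ?a \<bullet> (r \<star> Ide (D1 D) J)"
      using assoc_natural[of "Ide (D1 D) Z" \<tau> \<chi>] assms J \<tau> \<chi> r(1-3) rS by (simp add: H.assoc_simp)
    also have "\<dots> = (Ide (D1 D) Z \<star> lunit D J) \<bullet> ?a \<bullet> (r \<star> Ide (D1 D) J)"
      using assms J \<tau> \<chi> \<chi>\<tau> by (simp flip: hcomp_cmp)
    also have "\<dots> = (runit D Z \<star> Ide (D1 D) J) \<bullet> (r \<star> Ide (D1 D) J)"
      using triangle[of Z J] assms J by simp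
    also have "\<dots> = Ide (D1 D) (Z \<odot> J)"
      using assms J r rS by (simp flip: hcomp_cmp)
    finally show ?thesis .
  qed
  show ?thesis
  proof (rule that[OF \<sigma>(1,2,4,5)])
    fix \<beta> assume \<beta>: "\<beta> \<in> Arr (D1 D)" "Dom (D1 D) \<beta> = Z" "S1 \<beta> = h"
    have c: "S0 (Cod (D1 D) \<beta>) = ?C" using Src_simps(4)[of \<beta>] \<beta> by simp
    show "\<exists>\<gamma>. \<gamma> \<in> Arr (D1 D) \<and> Dom (D1 D) \<gamma> = Cod (D1 D) \<sigma> \<and> Cod (D1 D) \<gamma> = Cod (D1 D) \<beta> \<and>
        S1 \<gamma> = Ide (D0 D) (Cod (D0 D) h) \<and> T1 \<gamma> = T1 \<beta> \<and> \<gamma> \<bullet> \<sigma> = \<beta>"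
      using ext[OF \<beta>] \<beta> c \<sigma> \<chi> assms J Tgt_simps(4)[of \<beta>]
      by (intro exI[of _ "runit D (Cod (D1 D) \<beta>) \<bullet> (\<beta> \<star> \<chi>)"]) simp
  next
    fix \<gamma> \<gamma>'
    assume \<gamma>: "\<gamma> \<in> Arr (D1 D)" "\<gamma>' \<in> Arr (D1 D)" "Dom (D1 D) \<gamma> = Cod (D1 D) \<sigma>" "Dom (D1 D) \<gamma>' = Cod (D1 D) \<sigma>"
      "Cod (D1 D) \<gamma> = Cod (D1 D) \<gamma>'" "S1 \<gamma> = Ide (D0 D) ?C" "S1 \<gamma>' = Ide (D0 D) ?C"
      and e: "\<gamma> \<bullet> \<sigma> = \<gamma>' \<bullet> \<sigma>"
    have r: "\<delta> = runit D (Cod (D1 D) \<delta>) \<bullet> ((\<delta> \<bullet> \<sigma>) \<star> \<chi>)"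
      if \<delta>: "\<delta> \<in> Arr (D1 D)" "Dom (D1 D) \<delta> = Z \<odot> J" "S1 \<delta> = Ide (D0 D) ?C" for \<delta>
    proof -
      have c: "S0 (Cod (D1 D) \<delta>) = ?C" using Src_simps(4)[of \<delta>] \<delta> assms(3) by simp
      have "runit D (Cod (D1 D) \<delta>) \<bullet> ((\<delta> \<bullet> \<sigma>) \<star> \<chi>)
          = runit D (Cod (D1 D) \<delta>) \<bullet> ((\<delta> \<bullet> \<sigma>) \<star> (Ide (D1 D) (U0 ?C) \<bullet> \<chi>))"
        using \<chi> assms(3) by simp
      also have "\<dots> = runit D (Cod (D1 D) \<delta>) \<bullet> (\<delta> \<star> Ide (D1 D) (U0 ?C)) \<bullet> (\<sigma> \<star> \<chi>)"
        using \<chi> \<delta> c \<sigma> J assms by (subst hcomp_cmp) (simp_all add: H.assoc_simp)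
      also have "\<dots> = \<delta> \<bullet> (runit D (Z \<odot> J) \<bullet> (\<sigma> \<star> \<chi>))"
        using runit_natural[of \<delta>] \<delta> \<chi> \<sigma> J assms by (simp add: H.assoc_simp)
      also have "\<dots> = \<delta>"
        using key \<delta> by simp
      finally show ?thesis ..
    qed
    show "\<gamma> = \<gamma>'"
      using r[of \<gamma>] r[of \<gamma>'] \<gamma> e \<sigma> by simp
  qed
qed

text \<open>The target side is removed first and the source side second. Factoring through
  \<open>\<sigma>\<close> keeps the source side \<open>h\<close>, and factoring through
  \<open>\<rho>\<close> keeps the identity already reached on the target, so the final factor is
  globular.\<close>

lemma extension:
  assumes "fibrant D" "Z \<in> Obj (D1 D)" "h \<in> Arr (D0 D)" "Dom (D0 D) h = S0 Z"
    and "k \<in> Arr (D0 D)" "Dom (D0 D) k = T0 Z"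
  obtains \<sigma> where "\<sigma> \<in> Arr (D1 D)" "Dom (D1 D) \<sigma> = Z" "S1 \<sigma> = h" "T1 \<sigma> = k"
    and "\<And>\<beta>. \<lbrakk>\<beta> \<in> Arr (D1 D); Dom (D1 D) \<beta> = Z; S1 \<beta> = h; T1 \<beta> = k\<rbrakk> \<Longrightarrow>
      \<exists>\<gamma>. \<gamma> \<in> Arr (D1 D) \<and> Dom (D1 D) \<gamma> = Cod (D1 D) \<sigma> \<and> Cod (D1 D) \<gamma> = Cod (D1 D) \<beta> \<and>
        S1 \<gamma> = Ide (D0 D) (Cod (D0 D) h) \<and> T1 \<gamma> = Ide (D0 D) (Cod (D0 D) k) \<and> \<gamma> \<bullet> \<sigma> = \<beta>"
    and "\<And>\<gamma> \<gamma>'. \<lbrakk>\<gamma> \<in> Arr (D1 D); \<gamma>' \<in> Arr (D1 D); Dom (D1 D) \<gamma> = Cod (D1 D) \<sigma>; Dom (D1 D) \<gamma>' = Cod (D1 D) \<sigma>;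
      Cod (D1 D) \<gamma> = Cod (D1 D) \<gamma>'; S1 \<gamma> = Ide (D0 D) (Cod (D0 D) h); S1 \<gamma>' = Ide (D0 D) (Cod (D0 D) h);
      T1 \<gamma> = Ide (D0 D) (Cod (D0 D) k); T1 \<gamma>' = Ide (D0 D) (Cod (D0 D) k); \<gamma> \<bullet> \<sigma> = \<gamma>' \<bullet> \<sigma>\<rbrakk> \<Longrightarrow> \<gamma> = \<gamma>'"
proof -
  obtain \<sigma> where \<sigma>: "\<sigma> \<in> Arr (D1 D)" "Dom (D1 D) \<sigma> = Z" "S1 \<sigma> = Ide (D0 D) (S0 Z)" "T1 \<sigma> = k"
    and lift_\<sigma>: "\<And>\<beta>. \<lbrakk>\<beta> \<in> Arr (D1 D); Dom (D1 D) \<beta> = Z; T1 \<beta> = k\<rbrakk> \<Longrightarrow>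
      \<exists>\<gamma>. \<gamma> \<in> Arr (D1 D) \<and> Dom (D1 D) \<gamma> = Cod (D1 D) \<sigma> \<and> Cod (D1 D) \<gamma> = Cod (D1 D) \<beta> \<and>
        S1 \<gamma> = S1 \<beta> \<and> T1 \<gamma> = Ide (D0 D) (Cod (D0 D) k) \<and> \<gamma> \<bullet> \<sigma> = \<beta>"
    and epi_\<sigma>: "\<And>\<gamma> \<gamma>'. \<lbrakk>\<gamma> \<in> Arr (D1 D); \<gamma>' \<in> Arr (D1 D); Dom (D1 D) \<gamma> = Cod (D1 D) \<sigma>; Dom (D1 D) \<gamma>' = Cod (D1 D) \<sigma>;
      Cod (D1 D) \<gamma> = Cod (D1 D) \<gamma>'; T1 \<gamma> = Ide (D0 D) (Cod (D0 D) k); T1 \<gamma>' = Ide (D0 D) (Cod (D0 D) k);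
      \<gamma> \<bullet> \<sigma> = \<gamma>' \<bullet> \<sigma>\<rbrakk> \<Longrightarrow> \<gamma> = \<gamma>'"
    using extension_left[OF assms(1,2,5,6)] by blast
  have Z1: "Cod (D1 D) \<sigma> \<in> Obj (D1 D)" "S0 (Cod (D1 D) \<sigma>) = S0 Z" "T0 (Cod (D1 D) \<sigma>) = Cod (D0 D) k"
    using Src_simps(4)[of \<sigma>] Tgt_simps(4)[of \<sigma>] \<sigma> assms(2) by simp_all
  then have "Dom (D0 D) h = S0 (Cod (D1 D) \<sigma>)" using assms(4) by simp
  then obtain \<rho> where \<rho>: "\<rho> \<in> Arr (D1 D)" "Dom (D1 D) \<rho> = Cod (D1 D) \<sigma>" "S1 \<rho> = h"
      "T1 \<rho> = Ide (D0 D) (T0 (Cod (D1 D) \<sigma>))"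
    and lift_\<rho>: "\<And>\<beta>. \<lbrakk>\<beta> \<in> Arr (D1 D); Dom (D1 D) \<beta> = Cod (D1 D) \<sigma>; S1 \<beta> = h\<rbrakk> \<Longrightarrow>
      \<exists>\<gamma>. \<gamma> \<in> Arr (D1 D) \<and> Dom (D1 D) \<gamma> = Cod (D1 D) \<rho> \<and> Cod (D1 D) \<gamma> = Cod (D1 D) \<beta> \<and>
        S1 \<gamma> = Ide (D0 D) (Cod (D0 D) h) \<and> T1 \<gamma> = T1 \<beta> \<and> \<gamma> \<bullet> \<rho> = \<beta>"
    and epi_\<rho>: "\<And>\<gamma> \<gamma>'. \<lbrakk>\<gamma> \<in> Arr (D1 D); \<gamma>' \<in> Arr (D1 D); Dom (D1 D) \<gamma> = Cod (D1 D) \<rho>; Dom (D1 D) \<gamma>' = Cod (D1 D) \<rho>;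
      Cod (D1 D) \<gamma> = Cod (D1 D) \<gamma>'; S1 \<gamma> = Ide (D0 D) (Cod (D0 D) h); S1 \<gamma>' = Ide (D0 D) (Cod (D0 D) h);
      \<gamma> \<bullet> \<rho> = \<gamma>' \<bullet> \<rho>\<rbrakk> \<Longrightarrow> \<gamma> = \<gamma>'"
    using extension_right[OF assms(1) Z1(1) assms(3)] by blast
  have \<rho>\<sigma>: "\<rho> \<bullet> \<sigma> \<in> Arr (D1 D)" "Dom (D1 D) (\<rho> \<bullet> \<sigma>) = Z" "Cod (D1 D) (\<rho> \<bullet> \<sigma>) = Cod (D1 D) \<rho>"
      "S1 (\<rho> \<bullet> \<sigma>) = h" "T1 (\<rho> \<bullet> \<sigma>) = k"
    using \<rho> \<sigma> Z1 assms by simp_all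
  show ?thesis
  proof (rule that[OF \<rho>\<sigma>(1,2,4,5)])
    fix \<beta> assume \<beta>: "\<beta> \<in> Arr (D1 D)" "Dom (D1 D) \<beta> = Z" "S1 \<beta> = h" "T1 \<beta> = k"
    obtain \<gamma> where \<gamma>: "\<gamma> \<in> Arr (D1 D)" "Dom (D1 D) \<gamma> = Cod (D1 D) \<sigma>" "Cod (D1 D) \<gamma> = Cod (D1 D) \<beta>"
        "S1 \<gamma> = S1 \<beta>" "T1 \<gamma> = Ide (D0 D) (Cod (D0 D) k)" "\<gamma> \<bullet> \<sigma> = \<beta>"
      using lift_\<sigma>[OF \<beta>(1,2,4)] by blast
    obtain \<delta> where \<delta>: "\<delta> \<in> Arr (D1 D)" "Dom (D1 D) \<delta> = Cod (D1 D) \<rho>" "Cod (D1 D) \<delta> = Cod (D1 D) \<gamma>"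
        "S1 \<delta> = Ide (D0 D) (Cod (D0 D) h)" "T1 \<delta> = T1 \<gamma>" "\<delta> \<bullet> \<rho> = \<gamma>"
      using lift_\<rho>[OF \<gamma>(1,2)] \<gamma>(4) \<beta>(3) by auto
    show "\<exists>\<gamma>. \<gamma> \<in> Arr (D1 D) \<and> Dom (D1 D) \<gamma> = Cod (D1 D) (\<rho> \<bullet> \<sigma>) \<and> Cod (D1 D) \<gamma> = Cod (D1 D) \<beta> \<and>
        S1 \<gamma> = Ide (D0 D) (Cod (D0 D) h) \<and> T1 \<gamma> = Ide (D0 D) (Cod (D0 D) k) \<and> \<gamma> \<bullet> (\<rho> \<bullet> \<sigma>) = \<beta>"
      using \<gamma> \<delta> \<rho> \<sigma> \<rho>\<sigma> H.cmp_extend[OF \<delta>(6) \<sigma>(1)] by (intro exI[of _ \<delta>]) simp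
  next
    fix \<gamma> \<gamma>'
    assume \<gamma>: "\<gamma> \<in> Arr (D1 D)" "\<gamma>' \<in> Arr (D1 D)" "Dom (D1 D) \<gamma> = Cod (D1 D) (\<rho> \<bullet> \<sigma>)" "Dom (D1 D) \<gamma>' = Cod (D1 D) (\<rho> \<bullet> \<sigma>)"
      "Cod (D1 D) \<gamma> = Cod (D1 D) \<gamma>'" "S1 \<gamma> = Ide (D0 D) (Cod (D0 D) h)" "S1 \<gamma>' = Ide (D0 D) (Cod (D0 D) h)"
      "T1 \<gamma> = Ide (D0 D) (Cod (D0 D) k)" "T1 \<gamma>' = Ide (D0 D) (Cod (D0 D) k)"
      and e: "\<gamma> \<bullet> (\<rho> \<bullet> \<sigma>) = \<gamma>' \<bullet> (\<rho> \<bullet> \<sigma>)"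
    \<comment> \<open>Cancellation of \<open>\<sigma>\<close> is available only for cells with
      identity target side; these composites qualify because the target side of
      \<open>\<rho>\<close> is an identity.\<close>
    have "\<gamma> \<bullet> \<rho> = \<gamma>' \<bullet> \<rho>"
    proof (rule epi_\<sigma>)
      show "\<gamma> \<bullet> \<rho> \<bullet> \<sigma> = \<gamma>' \<bullet> \<rho> \<bullet> \<sigma>" using e \<gamma> \<rho> \<sigma> \<rho>\<sigma>(3) by (simp add: H.assoc_simp)
    qed (use \<gamma> \<rho> \<sigma> \<rho>\<sigma>(3) Z1 assms in simp_all)
    then show "\<gamma> = \<gamma>'"
      by (rule epi_\<rho>[rotated -1]) (use \<gamma> \<rho>\<sigma>(3) in simp_all)
  qed
qed

end

section \<open>Products of horizontal arrows from local products\<close>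

lemma hor_cat_simps [simp]:
  "Dom (hor_cat D A B) = Dom (D1 D)" "Cod (hor_cat D A B) = Cod (D1 D)"
  "Ide (hor_cat D A B) = Ide (D1 D)" "Cmp (hor_cat D A B) = Cmp (D1 D)"
  "M \<in> Obj (hor_cat D A B) \<longleftrightarrow> M \<in> Obj (D1 D) \<and> onO (Src D) M = A \<and> onO (Tgt D) M = B"
  "\<alpha> \<in> Arr (hor_cat D A B) \<longleftrightarrow> \<alpha> \<in> Arr (D1 D) \<and>
    onA (Src D) \<alpha> = Ide (D0 D) A \<and> onA (Tgt D) \<alpha> = Ide (D0 D) B"
  by (simp_all add: hor_cat_def has_sides_def)

lemma (in double_category) category_hor_cat:
  assumes "A \<in> Obj (D0 D)" "B \<in> Obj (D0 D)"
  shows "category (hor_cat D A B)"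
proof
  fix \<alpha> assume \<alpha>: "\<alpha> \<in> Arr (hor_cat D A B)"
  then show "Dom (hor_cat D A B) \<alpha> \<in> Obj (hor_cat D A B)" "Cod (hor_cat D A B) \<alpha> \<in> Obj (hor_cat D A B)"
    using assms Src_simps(3,4)[of \<alpha>] Tgt_simps(3,4)[of \<alpha>] by simp_all
next
  fix \<alpha> M N \<beta> P assume "\<alpha> \<in> hom_set (hor_cat D A B) M N" "\<beta> \<in> hom_set (hor_cat D A B) N P"
  then show "\<beta> \<cdot>\<^bsub>hor_cat D A B\<^esub> \<alpha> \<in> hom_set (hor_cat D A B) M P"
    using assms by (simp add: hom_set_def)
next
  fix \<alpha> \<beta> \<gamma>
  assume "\<alpha> \<in> Arr (hor_cat D A B)" "\<beta> \<in> Arr (hor_cat D A B)" "\<gamma> \<in> Arr (hor_cat D A B)"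
    "Cod (hor_cat D A B) \<alpha> = Dom (hor_cat D A B) \<beta>" "Cod (hor_cat D A B) \<beta> = Dom (hor_cat D A B) \<gamma>"
  then show "\<gamma> \<cdot>\<^bsub>hor_cat D A B\<^esub> \<beta> \<cdot>\<^bsub>hor_cat D A B\<^esub> \<alpha> = \<gamma> \<cdot>\<^bsub>hor_cat D A B\<^esub> (\<beta> \<cdot>\<^bsub>hor_cat D A B\<^esub> \<alpha>)"
    by (simp add: H.assoc_simp)
qed (use assms in \<open>auto simp: hom_set_def\<close>)

text \<open>Products in \<open>D1\<close> that \<open>S\<close> and \<open>T\<close> carry to the
  chosen products in \<open>D0\<close> by equality rather than up to isomorphism: the sides of a
  double functor have to match exactly.\<close>

locale strict_products = double_category D
  for D :: "('o, 'v, 'h, 'c) dblcat" (structure)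
    and X :: "('o, 'v) prods" and Y :: "('h, 'c) prods" +
  assumes chosen_X: "chosen_products (D0 D) X"
    and chosen_Y: "chosen_products (D1 D) Y"
    and Src_prods: "\<lbrakk>M \<in> Obj (D1 D); N \<in> Obj (D1 D)\<rbrakk> \<Longrightarrow>
        onO (Src D) (pob Y M N) = pob X (onO (Src D) M) (onO (Src D) N)"
      "\<lbrakk>M \<in> Obj (D1 D); N \<in> Obj (D1 D)\<rbrakk> \<Longrightarrow>
        onA (Src D) (pr1 Y M N) = pr1 X (onO (Src D) M) (onO (Src D) N)"
      "\<lbrakk>M \<in> Obj (D1 D); N \<in> Obj (D1 D)\<rbrakk> \<Longrightarrow>
        onA (Src D) (pr2 Y M N) = pr2 X (onO (Src D) M) (onO (Src D) N)"
      "onO (Src D) (tob Y) = tob X"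
    and Tgt_prods: "\<lbrakk>M \<in> Obj (D1 D); N \<in> Obj (D1 D)\<rbrakk> \<Longrightarrow>
        onO (Tgt D) (pob Y M N) = pob X (onO (Tgt D) M) (onO (Tgt D) N)"
      "\<lbrakk>M \<in> Obj (D1 D); N \<in> Obj (D1 D)\<rbrakk> \<Longrightarrow>
        onA (Tgt D) (pr1 Y M N) = pr1 X (onO (Tgt D) M) (onO (Tgt D) N)"
      "\<lbrakk>M \<in> Obj (D1 D); N \<in> Obj (D1 D)\<rbrakk> \<Longrightarrow>
        onA (Tgt D) (pr2 Y M N) = pr2 X (onO (Tgt D) M) (onO (Tgt D) N)"
      "onO (Tgt D) (tob Y) = tob X"

locale local_products = double_category D
  for D :: "('o, 'v, 'h, 'c) dblcat" (structure)
    and X :: "('o, 'v) prods" and L :: "'o \<Rightarrow> 'o \<Rightarrow> ('h, 'c) prods" and R :: "'v \<Rightarrow> 'v \<Rightarrow> 'h \<Rightarrow> 'c" +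
  assumes fibrant: "fibrant D"
    and chosen_X: "chosen_products (D0 D) X"
    and chosen_L: "\<lbrakk>A \<in> Obj (D0 D); B \<in> Obj (D0 D)\<rbrakk> \<Longrightarrow> chosen_products (hor_cat D A B) (L A B)"
    and cleavage: "cleavage D R"
begin

sublocale X: category_with_products "D0 D" X
  by unfold_locales (rule chosen_X)

lemma cleavageD:
  assumes "M \<in> Obj (D1 D)" "f \<in> Arr (D0 D)" "Cod (D0 D) f = S0 M" "g \<in> Arr (D0 D)" "Cod (D0 D) g = T0 M"
  shows "cartesian_cell D (R f g M)" "R f g M \<in> Arr (D1 D)" "S1 (R f g M) = f" "T1 (R f g M) = g"
    and "Cod (D1 D) (R f g M) = M"
    and "S0 (Dom (D1 D) (R f g M)) = Dom (D0 D) f" "T0 (Dom (D1 D) (R f g M)) = Dom (D0 D) g"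
proof -
  have "niche D f g M" using assms by (simp add: niche_def)
  then show a: "cartesian_cell D (R f g M)" "R f g M \<in> Arr (D1 D)" "S1 (R f g M) = f" "T1 (R f g M) = g"
      "Cod (D1 D) (R f g M) = M"
    using cleavage unfolding cleavage_def has_sides_def by blast+
  show "S0 (Dom (D1 D) (R f g M)) = Dom (D0 D) f" "T0 (Dom (D1 D) (R f g M)) = Dom (D0 D) g"
    using a Src_simps(3)[of "R f g M"] Tgt_simps(3)[of "R f g M"] by simp_all
qed

text \<open>The universal property is assembled from three others: products in \<open>D0\<close>
  give the sides, Cartesian cells reduce a pair of cells to two cells with the same sides, and an
  extension makes these globular, so that the product in \<open>hor_cat\<close> applies.\<close>

lemma D1_products_is_product:
  assumes M: "M \<in> Obj (D1 D)" and N: "N \<in> Obj (D1 D)"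
  defines "Y \<equiv> D1_products D X L R"
  shows "is_product (D1 D) M N (pob Y M N) (pr1 Y M N) (pr2 Y M N)"
    and "S0 (pob Y M N) = pob X (S0 M) (S0 N)" "T0 (pob Y M N) = pob X (T0 M) (T0 N)"
    and "S1 (pr1 Y M N) = pr1 X (S0 M) (S0 N)" "T1 (pr1 Y M N) = pr1 X (T0 M) (T0 N)"
    and "S1 (pr2 Y M N) = pr2 X (S0 M) (S0 N)" "T1 (pr2 Y M N) = pr2 X (T0 M) (T0 N)"
proof -
  define A where "A = pob X (S0 M) (S0 N)"
  define B where "B = pob X (T0 M) (T0 N)"
  define \<rho> where "\<rho> = restr1 D X R M N"
  define \<sigma> where "\<sigma> = restr2 D X R M N"
  define W where "W = L A B"
  define p where "p = pr1 W (Dom (D1 D) \<rho>) (Dom (D1 D) \<sigma>)"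
  define q where "q = pr2 W (Dom (D1 D) \<rho>) (Dom (D1 D) \<sigma>)"
  define P where "P = pob W (Dom (D1 D) \<rho>) (Dom (D1 D) \<sigma>)"
  have Y: "pob Y M N = P" "pr1 Y M N = \<rho> \<bullet> p" "pr2 Y M N = \<sigma> \<bullet> q"
    by (simp_all add: Y_def D1_products_def Let_def P_def p_def q_def \<rho>_def \<sigma>_def W_def A_def B_def)
  have AB: "A \<in> Obj (D0 D)" "B \<in> Obj (D0 D)" using M N by (simp_all add: A_def B_def)
  have \<rho>: "cartesian_cell D \<rho>" "\<rho> \<in> Arr (D1 D)" "S1 \<rho> = pr1 X (S0 M) (S0 N)" "T1 \<rho> = pr1 X (T0 M) (T0 N)"
      "Cod (D1 D) \<rho> = M" "S0 (Dom (D1 D) \<rho>) = A" "T0 (Dom (D1 D) \<rho>) = B"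
    unfolding \<rho>_def restr1_def A_def B_def using M N by (subst cleavageD; simp)+
  have \<sigma>: "cartesian_cell D \<sigma>" "\<sigma> \<in> Arr (D1 D)" "S1 \<sigma> = pr2 X (S0 M) (S0 N)" "T1 \<sigma> = pr2 X (T0 M) (T0 N)"
      "Cod (D1 D) \<sigma> = N" "S0 (Dom (D1 D) \<sigma>) = A" "T0 (Dom (D1 D) \<sigma>) = B"
    unfolding \<sigma>_def restr2_def A_def B_def using M N by (subst cleavageD; simp)+
  interpret K: category "hor_cat D A B" by (rule category_hor_cat[OF AB])
  have prod: "is_product (hor_cat D A B) (Dom (D1 D) \<rho>) (Dom (D1 D) \<sigma>) P p q"
    using chosen_L[OF AB] \<rho> \<sigma> by (simp add: chosen_products_def P_def p_def q_def W_def)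
  note pq = K.is_productD[OF prod, simplified]
  show SP: "S0 (pob Y M N) = pob X (S0 M) (S0 N)" "T0 (pob Y M N) = pob X (T0 M) (T0 N)"
    using pq(1) by (simp_all add: Y A_def B_def)
  show Sp: "S1 (pr1 Y M N) = pr1 X (S0 M) (S0 N)" "T1 (pr1 Y M N) = pr1 X (T0 M) (T0 N)"
      "S1 (pr2 Y M N) = pr2 X (S0 M) (S0 N)" "T1 (pr2 Y M N) = pr2 X (T0 M) (T0 N)"
    using pq \<rho> \<sigma> M N by (simp_all add: Y A_def B_def)
  show "is_product (D1 D) M N (pob Y M N) (pr1 Y M N) (pr2 Y M N)"
    unfolding Y
  proof (rule H.is_productI)
    fix \<alpha> \<beta>
    assume \<alpha>: "\<alpha> \<in> Arr (D1 D)" "Cod (D1 D) \<alpha> = M" and \<beta>: "\<beta> \<in> Arr (D1 D)" "Cod (D1 D) \<beta> = N"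
      and d: "Dom (D1 D) \<alpha> = Dom (D1 D) \<beta>"
    let ?Z = "Dom (D1 D) \<beta>"
    note a = Src_simps(3,4)[OF \<alpha>(1)] Tgt_simps(3,4)[OF \<alpha>(1)] Src_simps(3,4)[OF \<beta>(1)] Tgt_simps(3,4)[OF \<beta>(1)]
    \<comment> \<open>The projections of the lift in \<open>D1\<close> lie over those in
      \<open>D0\<close>, so \<open>h\<close> and \<open>k\<close> are the only sides the lift can
      have.\<close>
    define h where "h = pairing (D0 D) X (S1 \<alpha>) (S1 \<beta>)"
    define k where "k = pairing (D0 D) X (T1 \<alpha>) (T1 \<beta>)"
    have hk: "h \<in> Arr (D0 D)" "Dom (D0 D) h = S0 ?Z" "Cod (D0 D) h = A"
        "k \<in> Arr (D0 D)" "Dom (D0 D) k = T0 ?Z" "Cod (D0 D) k = B"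
        "pr1 X (S0 M) (S0 N) \<cdot>\<^bsub>D0 D\<^esub> h = S1 \<alpha>" "pr2 X (S0 M) (S0 N) \<cdot>\<^bsub>D0 D\<^esub> h = S1 \<beta>"
        "pr1 X (T0 M) (T0 N) \<cdot>\<^bsub>D0 D\<^esub> k = T1 \<alpha>" "pr2 X (T0 M) (T0 N) \<cdot>\<^bsub>D0 D\<^esub> k = T1 \<beta>"
      using \<alpha> \<beta> d M N by (simp_all add: h_def k_def A_def B_def)
    obtain \<alpha>' where \<alpha>': "\<alpha>' \<in> Arr (D1 D)" "Dom (D1 D) \<alpha>' = Dom (D1 D) \<alpha>" "Cod (D1 D) \<alpha>' = Dom (D1 D) \<rho>"
        "S1 \<alpha>' = h" "T1 \<alpha>' = k" "\<rho> \<bullet> \<alpha>' = \<alpha>"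
      by (rule cartesian_cell_lift[OF \<rho>(1) \<alpha>(1), of h k]) (use \<rho> \<alpha> hk in simp_all)
    obtain \<beta>' where \<beta>': "\<beta>' \<in> Arr (D1 D)" "Dom (D1 D) \<beta>' = Dom (D1 D) \<beta>" "Cod (D1 D) \<beta>' = Dom (D1 D) \<sigma>"
        "S1 \<beta>' = h" "T1 \<beta>' = k" "\<sigma> \<bullet> \<beta>' = \<beta>"
      by (rule cartesian_cell_lift[OF \<sigma>(1) \<beta>(1), of h k]) (use \<sigma> \<beta> hk in simp_all)
    \<comment> \<open>The lifts \<open>\<alpha>'\<close> and \<open>\<beta>'\<close> share the sides
      \<open>(h, k)\<close>, so a single extension of \<open>?Z\<close> turns both into globular
      cells with a common domain.\<close>
    obtain \<epsilon> where \<epsilon>: "\<epsilon> \<in> Arr (D1 D)" "Dom (D1 D) \<epsilon> = ?Z" "S1 \<epsilon> = h" "T1 \<epsilon> = k"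
      and lift: "\<And>\<beta>. \<lbrakk>\<beta> \<in> Arr (D1 D); Dom (D1 D) \<beta> = ?Z; S1 \<beta> = h; T1 \<beta> = k\<rbrakk> \<Longrightarrow>
        \<exists>\<gamma>. \<gamma> \<in> Arr (D1 D) \<and> Dom (D1 D) \<gamma> = Cod (D1 D) \<epsilon> \<and> Cod (D1 D) \<gamma> = Cod (D1 D) \<beta> \<and>
          S1 \<gamma> = Ide (D0 D) (Cod (D0 D) h) \<and> T1 \<gamma> = Ide (D0 D) (Cod (D0 D) k) \<and> \<gamma> \<bullet> \<epsilon> = \<beta>"
      using extension[OF fibrant, of ?Z h k] hk \<beta> by auto
    obtain \<alpha>'' where \<alpha>'': "\<alpha>'' \<in> Arr (D1 D)" "Dom (D1 D) \<alpha>'' = Cod (D1 D) \<epsilon>" "Cod (D1 D) \<alpha>'' = Dom (D1 D) \<rho>"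
        "S1 \<alpha>'' = Ide (D0 D) A" "T1 \<alpha>'' = Ide (D0 D) B" "\<alpha>'' \<bullet> \<epsilon> = \<alpha>'"
      using lift[of \<alpha>'] \<alpha>'(1-5) d hk by auto
    obtain \<beta>'' where \<beta>'': "\<beta>'' \<in> Arr (D1 D)" "Dom (D1 D) \<beta>'' = Cod (D1 D) \<epsilon>" "Cod (D1 D) \<beta>'' = Dom (D1 D) \<sigma>"
        "S1 \<beta>'' = Ide (D0 D) A" "T1 \<beta>'' = Ide (D0 D) B" "\<beta>'' \<bullet> \<epsilon> = \<beta>'"
      using lift[of \<beta>'] \<beta>'(1-5) hk by auto
    obtain u where u: "u \<in> Arr (hor_cat D A B)" "Dom (D1 D) u = Cod (D1 D) \<epsilon>" "Cod (D1 D) u = P" "p \<bullet> u = \<alpha>''" "q \<bullet> u = \<beta>''"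
      using K.is_product_lift[OF prod, of \<alpha>'' \<beta>''] \<alpha>'' \<beta>'' by auto
    have "\<rho> \<bullet> p \<bullet> (u \<bullet> \<epsilon>) = \<alpha>" "\<sigma> \<bullet> q \<bullet> (u \<bullet> \<epsilon>) = \<beta>"
      using u(1-3) pq \<epsilon> \<rho>(2) \<sigma>(2) \<alpha>''(6) \<alpha>'(6) \<beta>''(6) \<beta>'(6)
      by (simp_all add: H.assoc_simp H.cmp_extend[OF u(4)] H.cmp_extend[OF u(5)])
    then show "\<exists>u. u \<in> Arr (D1 D) \<and> Dom (D1 D) u = ?Z \<and> Cod (D1 D) u = P \<and> \<rho> \<bullet> p \<bullet> u = \<alpha> \<and> \<sigma> \<bullet> q \<bullet> u = \<beta>"
      using u(1-3) \<epsilon> by (intro exI[of _ "u \<bullet> \<epsilon>"]) simp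
  next
    fix u v
    assume u: "u \<in> Arr (D1 D)" "Cod (D1 D) u = P" and v: "v \<in> Arr (D1 D)" "Cod (D1 D) v = P"
      and d: "Dom (D1 D) u = Dom (D1 D) v"
      and e1: "\<rho> \<bullet> p \<bullet> u = \<rho> \<bullet> p \<bullet> v" and e2: "\<sigma> \<bullet> q \<bullet> u = \<sigma> \<bullet> q \<bullet> v"
    \<comment> \<open>Uniqueness for Cartesian cells compares only cells with equal sides. The sides
      are therefore settled beforehand, by applying \<open>S\<close> and \<open>T\<close> to both
      equations.\<close>
    have sides: "S1 u = S1 v" "T1 u = T1 v"
    proof -
      note s = arg_cong[OF e1, of S1] arg_cong[OF e2, of S1]
      show "S1 u = S1 v"
        by (rule X.proj_joint_mono[of "S0 M" "S0 N"])
          (use s u v d M N \<rho>(2-4) \<sigma>(2-4) pq in \<open>simp_all add: A_def\<close>)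
      note t = arg_cong[OF e1, of T1] arg_cong[OF e2, of T1]
      show "T1 u = T1 v"
        by (rule X.proj_joint_mono[of "T0 M" "T0 N"])
          (use t u v d M N \<rho>(2-4) \<sigma>(2-4) pq in \<open>simp_all add: B_def\<close>)
    qed
    have pu: "p \<bullet> u = p \<bullet> v"
      by (rule cartesian_cell_mono[OF \<rho>(1)])
        (use e1 sides u v d pq \<rho>(2) in \<open>simp_all add: H.assoc_simp\<close>)
    have qu: "q \<bullet> u = q \<bullet> v"
      by (rule cartesian_cell_mono[OF \<sigma>(1)])
        (use e2 sides u v d pq \<sigma>(2) in \<open>simp_all add: H.assoc_simp\<close>)
    have dc: "Dom (D0 D) (S1 u) = S0 (Dom (D1 D) u)" "Dom (D0 D) (T1 u) = T0 (Dom (D1 D) u)"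
        "Cod (D0 D) (S1 u) = A" "Cod (D0 D) (T1 u) = B"
      using u pq(1) by simp_all
    obtain \<epsilon> where \<epsilon>: "\<epsilon> \<in> Arr (D1 D)" "Dom (D1 D) \<epsilon> = Dom (D1 D) u" "S1 \<epsilon> = S1 u" "T1 \<epsilon> = T1 u"
      and lift: "\<And>\<beta>. \<lbrakk>\<beta> \<in> Arr (D1 D); Dom (D1 D) \<beta> = Dom (D1 D) u; S1 \<beta> = S1 u; T1 \<beta> = T1 u\<rbrakk> \<Longrightarrow>
        \<exists>\<gamma>. \<gamma> \<in> Arr (D1 D) \<and> Dom (D1 D) \<gamma> = Cod (D1 D) \<epsilon> \<and> Cod (D1 D) \<gamma> = Cod (D1 D) \<beta> \<and>
          S1 \<gamma> = Ide (D0 D) (Cod (D0 D) (S1 u)) \<and> T1 \<gamma> = Ide (D0 D) (Cod (D0 D) (T1 u)) \<and> \<gamma> \<bullet> \<epsilon> = \<beta>"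
      and epi: "\<And>\<gamma> \<gamma>'. \<lbrakk>\<gamma> \<in> Arr (D1 D); \<gamma>' \<in> Arr (D1 D); Dom (D1 D) \<gamma> = Cod (D1 D) \<epsilon>; Dom (D1 D) \<gamma>' = Cod (D1 D) \<epsilon>;
        Cod (D1 D) \<gamma> = Cod (D1 D) \<gamma>'; S1 \<gamma> = Ide (D0 D) (Cod (D0 D) (S1 u)); S1 \<gamma>' = Ide (D0 D) (Cod (D0 D) (S1 u));
        T1 \<gamma> = Ide (D0 D) (Cod (D0 D) (T1 u)); T1 \<gamma>' = Ide (D0 D) (Cod (D0 D) (T1 u)); \<gamma> \<bullet> \<epsilon> = \<gamma>' \<bullet> \<epsilon>\<rbrakk> \<Longrightarrow> \<gamma> = \<gamma>'"
      by (rule extension[OF fibrant, of "Dom (D1 D) u" "S1 u" "T1 u"]) (use u in auto)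
    obtain u' where u': "u' \<in> Arr (D1 D)" "Dom (D1 D) u' = Cod (D1 D) \<epsilon>" "Cod (D1 D) u' = P"
        "S1 u' = Ide (D0 D) A" "T1 u' = Ide (D0 D) B" "u' \<bullet> \<epsilon> = u"
      using lift[of u] u unfolding dc by auto
    obtain v' where v': "v' \<in> Arr (D1 D)" "Dom (D1 D) v' = Cod (D1 D) \<epsilon>" "Cod (D1 D) v' = P"
        "S1 v' = Ide (D0 D) A" "T1 v' = Ide (D0 D) B" "v' \<bullet> \<epsilon> = v"
      using lift[of v] v d sides unfolding dc by auto
    \<comment> \<open>The equations between projections of \<open>u\<close> and \<open>v\<close>
      pass to their globular factors because composition with \<open>\<epsilon>\<close> can be
      cancelled; the local product then decides.\<close>
    have "u' = v'"
    proof (rule K.is_product_mono[OF prod])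
      have "p \<bullet> u' = p \<bullet> v'"
        by (rule epi)
          (use u' v' pq pu \<epsilon>(1) in \<open>simp_all add: dc(3,4) H.assoc_simp AB\<close>)
      then show "p \<cdot>\<^bsub>hor_cat D A B\<^esub> u' = p \<cdot>\<^bsub>hor_cat D A B\<^esub> v'" by simp
      have "q \<bullet> u' = q \<bullet> v'"
        by (rule epi)
          (use u' v' pq qu \<epsilon>(1) in \<open>simp_all add: dc(3,4) H.assoc_simp AB\<close>)
      then show "q \<cdot>\<^bsub>hor_cat D A B\<^esub> u' = q \<cdot>\<^bsub>hor_cat D A B\<^esub> v'" by simp
    qed (use u' v' in simp_all)
    then show "u = v" using u'(6) v'(6) by simp
  qed (use pq \<rho> \<sigma> in simp_all)
qed

text \<open>The nullary case of the same argument. The sides of a cell into the terminal object are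
  forced by the terminal object of \<open>D0\<close>, and an extension along them reduces to the
  hom-category over it.\<close>

lemma D1_products_terminal:
  shows "is_terminal (D1 D) (tob (D1_products D X L R))"
    and "S0 (tob (D1_products D X L R)) = tob X" "T0 (tob (D1_products D X L R)) = tob X"
proof -
  define I where "I = tob X"
  define E where "E = tob (L I I)"
  have Y: "tob (D1_products D X L R) = E" by (simp add: D1_products_def Let_def E_def I_def)
  have I: "I \<in> Obj (D0 D)" "is_terminal (D0 D) I" by (simp_all add: I_def X.terminal_tob)
  have E: "is_terminal (hor_cat D I I) E"
    using chosen_L[of I I] I by (simp add: chosen_products_def E_def)
  then have EO: "E \<in> Obj (D1 D)" "S0 E = I" "T0 E = I" by (simp_all add: is_terminal_def)
  then show "S0 (tob (D1_products D X L R)) = tob X" "T0 (tob (D1_products D X L R)) = tob X"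
    by (simp_all add: Y I_def)
  interpret K: category "hor_cat D I I" by (rule category_hor_cat[OF I(1) I(1)])
  show "is_terminal (D1 D) (tob (D1_products D X L R))"
    unfolding is_terminal_def Y
  proof (intro conjI ballI EO)
    fix Z assume Z: "Z \<in> Obj (D1 D)"
    obtain h where h: "h \<in> Arr (D0 D)" "Dom (D0 D) h = S0 Z" "Cod (D0 D) h = I"
      by (rule V.terminal_arrow[OF I(2) Src_simps(1)[OF Z]])
    obtain k where k: "k \<in> Arr (D0 D)" "Dom (D0 D) k = T0 Z" "Cod (D0 D) k = I"
      by (rule V.terminal_arrow[OF I(2) Tgt_simps(1)[OF Z]])
    note hk = h k
    obtain \<epsilon> where \<epsilon>: "\<epsilon> \<in> Arr (D1 D)" "Dom (D1 D) \<epsilon> = Z" "S1 \<epsilon> = h" "T1 \<epsilon> = k"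
      and lift: "\<And>\<beta>. \<lbrakk>\<beta> \<in> Arr (D1 D); Dom (D1 D) \<beta> = Z; S1 \<beta> = h; T1 \<beta> = k\<rbrakk> \<Longrightarrow>
        \<exists>\<gamma>. \<gamma> \<in> Arr (D1 D) \<and> Dom (D1 D) \<gamma> = Cod (D1 D) \<epsilon> \<and> Cod (D1 D) \<gamma> = Cod (D1 D) \<beta> \<and>
          S1 \<gamma> = Ide (D0 D) (Cod (D0 D) h) \<and> T1 \<gamma> = Ide (D0 D) (Cod (D0 D) k) \<and> \<gamma> \<bullet> \<epsilon> = \<beta>"
      by (rule extension[OF fibrant Z hk(1,2,4,5)]) auto
    have c: "S0 (Cod (D1 D) \<epsilon>) = I" "T0 (Cod (D1 D) \<epsilon>) = I"
      using Src_simps(4)[of \<epsilon>] Tgt_simps(4)[of \<epsilon>] \<epsilon> hk by simp_all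
    then obtain t where t: "t \<in> Arr (hor_cat D I I)" "Dom (D1 D) t = Cod (D1 D) \<epsilon>" "Cod (D1 D) t = E"
      using E \<epsilon>(1) unfolding is_terminal_def hom_set_def by fastforce
    show "\<exists>!u. u \<in> hom_set (D1 D) Z E"
    proof (intro ex1I[of _ "t \<bullet> \<epsilon>"])
      show "t \<bullet> \<epsilon> \<in> hom_set (D1 D) Z E" using t \<epsilon> by (simp add: hom_set_def)
      fix u assume "u \<in> hom_set (D1 D) Z E"
      note u = hom_setD[OF this]
      have "S1 u = h" "T1 u = k"
        by (rule V.terminal_unique[OF I(2)]; use u hk EO in simp)+
      \<comment> \<open>Any competitor \<open>u\<close> factors through the same
        \<open>\<epsilon>\<close> by a globular cell, which must be \<open>t\<close>; existence of
        factorizations thus already yields uniqueness here.\<close>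
      then obtain s where "s \<in> Arr (D1 D)" "Dom (D1 D) s = Cod (D1 D) \<epsilon>" "Cod (D1 D) s = E"
          "S1 s = Ide (D0 D) I" "T1 s = Ide (D0 D) I" "s \<bullet> \<epsilon> = u"
        using lift[of u] u hk by auto
      moreover from this have "s = t"
        by (intro K.terminal_unique[OF E]) (use t in simp_all)
      ultimately show "u = t \<bullet> \<epsilon>" by simp
    qed
  qed
qed

lemma strict_products_D1_products: "strict_products D X (D1_products D X L R)"
  by unfold_locales
    (use chosen_X D1_products_is_product D1_products_terminal in \<open>simp_all add: chosen_products_def\<close>)

end

section \<open>The lax double functor of a choice of products\<close>

lemma prod_cat_simps [simp]:
  "(A, B) \<in> Obj (prod_cat C D) \<longleftrightarrow> A \<in> Obj C \<and> B \<in> Obj D"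
  "(f, g) \<in> Arr (prod_cat C D) \<longleftrightarrow> f \<in> Arr C \<and> g \<in> Arr D"
  "Dom (prod_cat C D) (f, g) = (Dom C f, Dom D g)"
  "Cod (prod_cat C D) (f, g) = (Cod C f, Cod D g)"
  "Ide (prod_cat C D) (A, B) = (Ide C A, Ide D B)"
  "(f', g') \<cdot>\<^bsub>prod_cat C D\<^esub> (f, g) = (f' \<cdot>\<^bsub>C\<^esub> f, g' \<cdot>\<^bsub>D\<^esub> g)"
  "(f, g) \<in> hom_set (prod_cat C D) (A, B) (A', B') \<longleftrightarrow> f \<in> hom_set C A A' \<and> g \<in> hom_set D B B'"
  by (auto simp: prod_cat_def hom_set_def)

lemma prod_dblcat_simps [simp]:
  "D0 (prod_dblcat B D) = prod_cat (D0 B) (D0 D)"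
  "D1 (prod_dblcat B D) = prod_cat (D1 B) (D1 D)"
  "onO (Src (prod_dblcat B D)) (M, M') = (onO (Src B) M, onO (Src D) M')"
  "onA (Src (prod_dblcat B D)) (\<alpha>, \<alpha>') = (onA (Src B) \<alpha>, onA (Src D) \<alpha>')"
  "onO (Tgt (prod_dblcat B D)) (M, M') = (onO (Tgt B) M, onO (Tgt D) M')"
  "onA (Tgt (prod_dblcat B D)) (\<alpha>, \<alpha>') = (onA (Tgt B) \<alpha>, onA (Tgt D) \<alpha>')"
  "onO (Uni (prod_dblcat B D)) (A, A') = (onO (Uni B) A, onO (Uni D) A')"
  "onA (Uni (prod_dblcat B D)) (f, f') = (onA (Uni B) f, onA (Uni D) f')"
  "(M, M') \<odot>\<^bsub>prod_dblcat B D\<^esub> (N, N') = (M \<odot>\<^bsub>B\<^esub> N, M' \<odot>\<^bsub>D\<^esub> N')"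
  "(\<alpha>, \<alpha>') \<star>\<^bsub>prod_dblcat B D\<^esub> (\<beta>, \<beta>') = (\<alpha> \<star>\<^bsub>B\<^esub> \<beta>, \<alpha>' \<star>\<^bsub>D\<^esub> \<beta>')"
  "assoc (prod_dblcat B D) (M, M') (N, N') (P, P') = (assoc B M N P, assoc D M' N' P')"
  "lunit (prod_dblcat B D) (M, M') = (lunit B M, lunit D M')"
  "runit (prod_dblcat B D) (M, M') = (runit B M, runit D M')"
  by (simp_all add: prod_dblcat_def prod_ftor_def)

lemma composables_prod_dblcat [simp]:
  "((M, M'), (N, N')) \<in> Obj (composables (prod_dblcat B D)) \<longleftrightarrow>
    (M, N) \<in> Obj (composables B) \<and> (M', N') \<in> Obj (composables D)"
  "((\<alpha>, \<alpha>'), (\<beta>, \<beta>')) \<in> Arr (composables (prod_dblcat B D)) \<longleftrightarrow>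
    (\<alpha>, \<beta>) \<in> Arr (composables B) \<and> (\<alpha>', \<beta>') \<in> Arr (composables D)"
  by (auto simp: composables_def)

lemma unit_dblcat_simps [simp]:
  "D0 unit_dblcat = unit_cat" "D1 unit_dblcat = unit_cat"
  "x \<in> Obj unit_cat" "x \<in> Arr unit_cat" "x \<in> hom_set unit_cat y z"
  "p \<in> Obj (composables unit_dblcat)"
  by (auto simp: unit_dblcat_def unit_cat_def composables_def prod_cat_def hom_set_def)

text \<open>The formula of \<open>induced_times\<close> with the products \<open>Y\<close> left
  arbitrary, so that products coming from an adjunction can be compared with those built from local
  products.\<close>

definition lax_times ::
    "('o, 'v, 'h, 'c) dblcat \<Rightarrow> ('o, 'v) prods \<Rightarrow> ('h, 'c) prods
      \<Rightarrow> ('o \<times> 'o, 'v \<times> 'v, 'h \<times> 'h, 'c \<times> 'c, 'o, 'v, 'h, 'c) dblftor" where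
  "lax_times D X Y =
    \<lparr>F0 = product_ftor (D0 D) X,
     F1 = product_ftor (D1 D) Y,
     LComp = (\<lambda>(M', N') (M, N).
       pairing (D1 D) Y (pr1 Y M' N' \<star>\<^bsub>D\<^esub> pr1 Y M N) (pr2 Y M' N' \<star>\<^bsub>D\<^esub> pr2 Y M N)),
     LUnit = (\<lambda>(A, B).
       pairing (D1 D) Y (onA (Uni D) (pr1 X A B)) (onA (Uni D) (pr2 X A B)))\<rparr>"

lemma induced_times_eq: "induced_times D X L R = lax_times D X (D1_products D X L R)"
  by (simp add: induced_times_def lax_times_def Let_def)

context double_category
begin

text \<open>Interchange oriented towards horizontal composites of vertical ones, where the
  projection equations and naturality squares become visible to the simplifier.\<close>

lemma hcomp_merge:
  assumes "\<alpha> \<in> Arr (D1 D)" "\<alpha>' \<in> Arr (D1 D)" "\<beta> \<in> Arr (D1 D)" "\<beta>' \<in> Arr (D1 D)"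
    and "Cod (D1 D) \<alpha> = Dom (D1 D) \<alpha>'" "Cod (D1 D) \<beta> = Dom (D1 D) \<beta>'"
    and "S1 \<alpha> = T1 \<beta>" "S1 \<alpha>' = T1 \<beta>'"
  shows "(\<alpha>' \<star> \<beta>') \<bullet> (\<alpha> \<star> \<beta>) = (\<alpha>' \<bullet> \<alpha>) \<star> (\<beta>' \<bullet> \<beta>)"
  using hcomp_cmp[OF assms] by simp

lemma hcomp_merge_extend:
  assumes "\<alpha> \<in> Arr (D1 D)" "\<alpha>' \<in> Arr (D1 D)" "\<beta> \<in> Arr (D1 D)" "\<beta>' \<in> Arr (D1 D)" "\<gamma> \<in> Arr (D1 D)"
    and "Cod (D1 D) \<alpha> = Dom (D1 D) \<alpha>'" "Cod (D1 D) \<beta> = Dom (D1 D) \<beta>'"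
    and "Cod (D1 D) \<gamma> = Dom (D1 D) \<alpha> \<odot> Dom (D1 D) \<beta>"
    and "S1 \<alpha> = T1 \<beta>" "S1 \<alpha>' = T1 \<beta>'"
  shows "(\<alpha>' \<star> \<beta>') \<bullet> ((\<alpha> \<star> \<beta>) \<bullet> \<gamma>) = ((\<alpha>' \<bullet> \<alpha>) \<star> (\<beta>' \<bullet> \<beta>)) \<bullet> \<gamma>"
  using assms by (intro H.cmp_extend hcomp_merge) simp_all

end

section \<open>Structure cells of products lying strictly over products of \<open>D0\<close>\<close>

context strict_products
begin

sublocale X: category_with_products "D0 D" X
  by unfold_locales (rule chosen_X)

sublocale Y: category_with_products "D1 D" Y
  by unfold_locales (rule chosen_Y)

declare Src_prods [simp] Tgt_prods [simp]

text \<open>\<open>S\<close> and \<open>T\<close> carry projections to projections, so the images of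
  a pairing have the components that characterize the pairing in \<open>D0\<close>.\<close>

lemma sides_pairing [simp]:
  assumes "\<alpha> \<in> Arr (D1 D)" "\<beta> \<in> Arr (D1 D)" "Dom (D1 D) \<alpha> = Dom (D1 D) \<beta>"
  shows "S1 (pairing (D1 D) Y \<alpha> \<beta>) = pairing (D0 D) X (S1 \<alpha>) (S1 \<beta>)"
    and "T1 (pairing (D1 D) Y \<alpha> \<beta>) = pairing (D0 D) X (T1 \<alpha>) (T1 \<beta>)"
proof -
  let ?u = "pairing (D1 D) Y \<alpha> \<beta>"
  let ?M = "Cod (D1 D) \<alpha>" and ?N = "Cod (D1 D) \<beta>"
  have "S1 (pr1 Y ?M ?N \<bullet> ?u) = pr1 X (S0 ?M) (S0 ?N) \<cdot>\<^bsub>D0 D\<^esub> S1 ?u"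
    "S1 (pr2 Y ?M ?N \<bullet> ?u) = pr2 X (S0 ?M) (S0 ?N) \<cdot>\<^bsub>D0 D\<^esub> S1 ?u"
    "T1 (pr1 Y ?M ?N \<bullet> ?u) = pr1 X (T0 ?M) (T0 ?N) \<cdot>\<^bsub>D0 D\<^esub> T1 ?u"
    "T1 (pr2 Y ?M ?N \<bullet> ?u) = pr2 X (T0 ?M) (T0 ?N) \<cdot>\<^bsub>D0 D\<^esub> T1 ?u"
    using assms by (simp_all del: Y.pr_pairing)
  then have e: "pr1 X (S0 ?M) (S0 ?N) \<cdot>\<^bsub>D0 D\<^esub> S1 ?u = S1 \<alpha>" "pr2 X (S0 ?M) (S0 ?N) \<cdot>\<^bsub>D0 D\<^esub> S1 ?u = S1 \<beta>"
    "pr1 X (T0 ?M) (T0 ?N) \<cdot>\<^bsub>D0 D\<^esub> T1 ?u = T1 \<alpha>" "pr2 X (T0 ?M) (T0 ?N) \<cdot>\<^bsub>D0 D\<^esub> T1 ?u = T1 \<beta>"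
    using assms by simp_all
  show "S1 ?u = pairing (D0 D) X (S1 \<alpha>) (S1 \<beta>)"
    by (rule X.proj_joint_mono[of "S0 ?M" "S0 ?N"]) (use assms e in simp_all)
  show "T1 ?u = pairing (D0 D) X (T1 \<alpha>) (T1 \<beta>)"
    by (rule X.proj_joint_mono[of "T0 ?M" "T0 ?N"]) (use assms e in simp_all)
qed

lemma pairing_proj [simp]:
  "\<lbrakk>A \<in> Obj (D0 D); B \<in> Obj (D0 D)\<rbrakk> \<Longrightarrow>
    pairing (D0 D) X (pr1 X A B) (pr2 X A B) = Ide (D0 D) (pob X A B)"
  by (rule X.proj_joint_mono[of A B]) simp_all

lemma lax_times_simps [simp]:
  "F0 (lax_times D X Y) = product_ftor (D0 D) X"
  "F1 (lax_times D X Y) = product_ftor (D1 D) Y"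
  "LComp (lax_times D X Y) (M', N') (M, N) =
    pairing (D1 D) Y (pr1 Y M' N' \<star> pr1 Y M N) (pr2 Y M' N' \<star> pr2 Y M N)"
  "LUnit (lax_times D X Y) (A, B) = pairing (D1 D) Y (U1 (pr1 X A B)) (U1 (pr2 X A B))"
  by (simp_all add: lax_times_def)

lemmas product_simps = X.product_ftor_onO X.product_ftor_onA Y.product_ftor_onO Y.product_ftor_onA

text \<open>Each naturality or coherence axiom equates cells into a product. After projecting, the
  associativity and unit axioms reduce to naturality of \<open>assoc\<close>, \<open>lunit\<close>
  and \<open>runit\<close> at the projections; naturality of the structure cells reduces to
  interchange and functoriality of \<open>U\<close>.\<close>

lemma lax_double_functor_lax_times: "lax_double_functor (prod_dblcat D D) D (lax_times D X Y)"
proof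
  show "is_functor (D0 (prod_dblcat D D)) (D0 D) (F0 (lax_times D X Y))"
    "is_functor (D1 (prod_dblcat D D)) (D1 D) (F1 (lax_times D X Y))"
    by (simp_all add: X.functor_product_ftor Y.functor_product_ftor)
next
  fix p assume "p \<in> Obj (D1 (prod_dblcat D D))"
  then obtain M M' where p: "p = (M, M')" "M \<in> Obj (D1 D)" "M' \<in> Obj (D1 D)" by (cases p) auto
  then show "S0 (onO (F1 (lax_times D X Y)) p) = onO (F0 (lax_times D X Y)) (onO (Src (prod_dblcat D D)) p)"
    "T0 (onO (F1 (lax_times D X Y)) p) = onO (F0 (lax_times D X Y)) (onO (Tgt (prod_dblcat D D)) p)"
    by (simp_all add: product_simps)
  let ?P = "pob Y M M'"
  let ?UT = "U0 (T0 M)" and ?UT' = "U0 (T0 M')"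
  have "onA (F1 (lax_times D X Y)) (lunit D M, lunit D M') \<bullet> LComp (lax_times D X Y) (?UT, ?UT') (M, M')
      \<bullet> (LUnit (lax_times D X Y) (T0 M, T0 M') \<star> Ide (D1 D) ?P) = lunit D ?P"
    by (rule Y.proj_joint_mono[of M M'])
      (use p lunit_natural[of "pr1 Y M M'"] lunit_natural[of "pr2 Y M M'"]
        in \<open>simp_all add: product_simps H.assoc_simp hcomp_merge\<close>)
  then show "onA (F1 (lax_times D X Y)) (lunit (prod_dblcat D D) p) \<bullet>
       LComp (lax_times D X Y) (onO (Uni (prod_dblcat D D)) (onO (Tgt (prod_dblcat D D)) p)) p \<bullet>
       (LUnit (lax_times D X Y) (onO (Tgt (prod_dblcat D D)) p) \<star> Ide (D1 D) (onO (F1 (lax_times D X Y)) p)) =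
       lunit D (onO (F1 (lax_times D X Y)) p)"
    by (simp add: p product_simps(3))
  let ?US = "U0 (S0 M)" and ?US' = "U0 (S0 M')"
  have "onA (F1 (lax_times D X Y)) (runit D M, runit D M') \<bullet> LComp (lax_times D X Y) (M, M') (?US, ?US')
      \<bullet> (Ide (D1 D) ?P \<star> LUnit (lax_times D X Y) (S0 M, S0 M')) = runit D ?P"
    by (rule Y.proj_joint_mono[of M M'])
      (use p runit_natural[of "pr1 Y M M'"] runit_natural[of "pr2 Y M M'"]
        in \<open>simp_all add: product_simps H.assoc_simp hcomp_merge\<close>)
  then show "onA (F1 (lax_times D X Y)) (runit (prod_dblcat D D) p) \<bullet>
       LComp (lax_times D X Y) p (onO (Uni (prod_dblcat D D)) (onO (Src (prod_dblcat D D)) p)) \<bullet>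
       (Ide (D1 D) (onO (F1 (lax_times D X Y)) p) \<star> LUnit (lax_times D X Y) (onO (Src (prod_dblcat D D)) p)) =
       runit D (onO (F1 (lax_times D X Y)) p)"
    by (simp add: p product_simps(3))
next
  fix p assume "p \<in> Arr (D1 (prod_dblcat D D))"
  then obtain \<alpha> \<beta> where p: "p = (\<alpha>, \<beta>)" "\<alpha> \<in> Arr (D1 D)" "\<beta> \<in> Arr (D1 D)" by (cases p) auto
  then show "S1 (onA (F1 (lax_times D X Y)) p) = onA (F0 (lax_times D X Y)) (onA (Src (prod_dblcat D D)) p)"
    "T1 (onA (F1 (lax_times D X Y)) p) = onA (F0 (lax_times D X Y)) (onA (Tgt (prod_dblcat D D)) p)"
    by (simp_all add: product_simps)
next
  fix p q assume "(p, q) \<in> Obj (composables (prod_dblcat D D))"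
  then obtain M M' N N' where pq: "p = (M, M')" "q = (N, N')" "M \<in> Obj (D1 D)" "M' \<in> Obj (D1 D)"
      "N \<in> Obj (D1 D)" "N' \<in> Obj (D1 D)" "S0 M = T0 N" "S0 M' = T0 N'"
    by (cases p; cases q) auto
  show "LComp (lax_times D X Y) p q \<in> hom_set (D1 D) (onO (F1 (lax_times D X Y)) p \<odot> onO (F1 (lax_times D X Y)) q)
         (onO (F1 (lax_times D X Y)) (p \<odot>\<^bsub>prod_dblcat D D\<^esub> q)) \<and> globular D (LComp (lax_times D X Y) p q)"
    using pq
    by (auto simp: product_simps hom_set_def intro!: globularI[of _ "pob X (S0 N) (S0 N')" "pob X (T0 M) (T0 M')"])
  fix r assume "(q, r) \<in> Obj (composables (prod_dblcat D D))"
  then obtain P P' where r: "r = (P, P')" "P \<in> Obj (D1 D)" "P' \<in> Obj (D1 D)" "S0 N = T0 P" "S0 N' = T0 P'"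
    using pq by (cases r) auto
  have "onA (F1 (lax_times D X Y)) (assoc D M N P, assoc D M' N' P') \<bullet>
       LComp (lax_times D X Y) (M \<odot> N, M' \<odot> N') (P, P') \<bullet>
       (LComp (lax_times D X Y) (M, M') (N, N') \<star> Ide (D1 D) (pob Y P P')) =
       LComp (lax_times D X Y) (M, M') (N \<odot> P, N' \<odot> P') \<bullet>
       (Ide (D1 D) (pob Y M M') \<star> LComp (lax_times D X Y) (N, N') (P, P')) \<bullet>
       assoc D (pob Y M M') (pob Y N N') (pob Y P P')"
    by (rule Y.proj_joint_mono[of "M \<odot> (N \<odot> P)" "M' \<odot> (N' \<odot> P')"])
      (use pq r assoc_natural[of "pr1 Y M M'" "pr1 Y N N'" "pr1 Y P P'"]
        assoc_natural[of "pr2 Y M M'" "pr2 Y N N'" "pr2 Y P P'"]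
        in \<open>simp_all add: product_simps H.assoc_simp hcomp_merge hcomp_merge_extend\<close>)
  then show "onA (F1 (lax_times D X Y)) (assoc (prod_dblcat D D) p q r) \<bullet>
       LComp (lax_times D X Y) (p \<odot>\<^bsub>prod_dblcat D D\<^esub> q) r \<bullet>
       (LComp (lax_times D X Y) p q \<star> Ide (D1 D) (onO (F1 (lax_times D X Y)) r)) =
       LComp (lax_times D X Y) p (q \<odot>\<^bsub>prod_dblcat D D\<^esub> r) \<bullet>
       (Ide (D1 D) (onO (F1 (lax_times D X Y)) p) \<star> LComp (lax_times D X Y) q r) \<bullet>
       assoc D (onO (F1 (lax_times D X Y)) p) (onO (F1 (lax_times D X Y)) q) (onO (F1 (lax_times D X Y)) r)"
    by (simp add: pq r product_simps(3))
next
  fix p q assume "(p, q) \<in> Arr (composables (prod_dblcat D D))"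
  then obtain \<alpha> \<alpha>' \<beta> \<beta>' where pq: "p = (\<alpha>, \<alpha>')" "q = (\<beta>, \<beta>')" "\<alpha> \<in> Arr (D1 D)" "\<alpha>' \<in> Arr (D1 D)"
      "\<beta> \<in> Arr (D1 D)" "\<beta>' \<in> Arr (D1 D)" "S1 \<alpha> = T1 \<beta>" "S1 \<alpha>' = T1 \<beta>'"
    by (cases p; cases q) auto
  note c = sides_composable[OF pq(3,5,7)] sides_composable[OF pq(4,6,8)]
  show "LComp (lax_times D X Y) (Cod (D1 (prod_dblcat D D)) p) (Cod (D1 (prod_dblcat D D)) q) \<bullet>
       (onA (F1 (lax_times D X Y)) p \<star> onA (F1 (lax_times D X Y)) q) =
       onA (F1 (lax_times D X Y)) (p \<star>\<^bsub>prod_dblcat D D\<^esub> q) \<bullet>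
       LComp (lax_times D X Y) (Dom (D1 (prod_dblcat D D)) p) (Dom (D1 (prod_dblcat D D)) q)"
    by (rule Y.proj_joint_mono[of "Cod (D1 D) \<alpha> \<odot> Cod (D1 D) \<beta>" "Cod (D1 D) \<alpha>' \<odot> Cod (D1 D) \<beta>'"])
      (use pq c in \<open>simp_all add: product_simps H.assoc_simp hcomp_merge\<close>)
next
  fix p assume "p \<in> Obj (D0 (prod_dblcat D D))"
  then obtain A B where p: "p = (A, B)" "A \<in> Obj (D0 D)" "B \<in> Obj (D0 D)" by (cases p) auto
  then show "LUnit (lax_times D X Y) p \<in> hom_set (D1 D) (U0 (onO (F0 (lax_times D X Y)) p))
      (onO (F1 (lax_times D X Y)) (onO (Uni (prod_dblcat D D)) p)) \<and> globular D (LUnit (lax_times D X Y) p)"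
    by (auto simp: product_simps hom_set_def intro!: globularI[of _ "pob X A B" "pob X A B"])
next
  fix p assume "p \<in> Arr (D0 (prod_dblcat D D))"
  then obtain f g where p: "p = (f, g)" "f \<in> Arr (D0 D)" "g \<in> Arr (D0 D)" by (cases p) auto
  show "LUnit (lax_times D X Y) (Cod (D0 (prod_dblcat D D)) p) \<bullet> U1 (onA (F0 (lax_times D X Y)) p) =
       onA (F1 (lax_times D X Y)) (onA (Uni (prod_dblcat D D)) p) \<bullet> LUnit (lax_times D X Y) (Dom (D0 (prod_dblcat D D)) p)"
    by (rule Y.proj_joint_mono[of "U0 (Cod (D0 D) f)" "U0 (Cod (D0 D) g)"])
      (use p in \<open>simp_all add: product_simps H.assoc_simp flip: Uni_cmp\<close>)
qed

lemma cell_to_tob_unique: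
  assumes "\<alpha> \<in> Arr (D1 D)" "\<beta> \<in> Arr (D1 D)" "Dom (D1 D) \<alpha> = Dom (D1 D) \<beta>"
    "Cod (D1 D) \<alpha> = tob Y" "Cod (D1 D) \<beta> = tob Y"
  shows "\<alpha> = \<beta>"
  by (rule H.terminal_unique[OF Y.terminal_tob]) (use assms in simp_all)

text \<open>The naturality and coherence axioms equate cells into \<open>tob Y\<close> and so hold
  by terminality. The cells \<open>c\<close> and \<open>u\<close> are parameters because the
  adjunction obtains them by existence and \<open>induced_terminal\<close> by a definite
  description.\<close>

lemma lax_double_functor_tob:
  assumes F: "F = \<lparr>F0 = \<lparr>onO = (\<lambda>_. tob X), onA = (\<lambda>_. Ide (D0 D) (tob X))\<rparr>,
    F1 = \<lparr>onO = (\<lambda>_. tob Y), onA = (\<lambda>_. Ide (D1 D) (tob Y))\<rparr>,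
    LComp = (\<lambda>_ _. c), LUnit = (\<lambda>_. u)\<rparr>"
    and c: "c \<in> hom_set (hor_cat D (tob X) (tob X)) (tob Y \<odot> tob Y) (tob Y)"
    and u: "u \<in> hom_set (hor_cat D (tob X) (tob X)) (U0 (tob X)) (tob Y)"
  shows "lax_double_functor unit_dblcat D F"
proof -
  note c' = hom_setD[OF c, simplified] and u' = hom_setD[OF u, simplified]
  have "globular D c" "globular D u"
    using c' u' by (auto intro!: globularI[of _ "tob X" "tob X"])
  then show ?thesis
    unfolding F using c' u'
    by unfold_locales
      (auto simp: is_functor_def hom_set_def unit_cat_def unit_dblcat_def id_ftor_def intro!: cell_to_tob_unique)
qed

end

section \<open>From products to adjunctions\<close>

text \<open>
  The last clause covers the structure cells of the terminal object, which are the unique cells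
  into \<open>tob Y\<close> with these domains.
\<close>

definition pseudo_products ::
    "('o, 'v, 'h, 'c) dblcat \<Rightarrow> ('o, 'v) prods \<Rightarrow> ('h, 'c) prods \<Rightarrow> bool" where
  "pseudo_products D X Y \<longleftrightarrow>
    (\<forall>M N M' N'. (M', M) \<in> Obj (composables D) \<and> (N', N) \<in> Obj (composables D) \<longrightarrow>
       is_iso (D1 D) (LComp (lax_times D X Y) (M', N') (M, N))) \<and>
    (\<forall>A \<in> Obj (D0 D). \<forall>B \<in> Obj (D0 D). is_iso (D1 D) (LUnit (lax_times D X Y) (A, B))) \<and>
    (\<forall>\<alpha> \<in> hom_set (D1 D) (tob Y \<odot>\<^bsub>D\<^esub> tob Y) (tob Y) \<union> hom_set (D1 D) (onO (Uni D) (tob X)) (tob Y).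
       is_iso (D1 D) \<alpha>)"

lemma comp_dblftor_simps [simp]:
  "F0 (comp_dblftor E G F) = comp_ftor (F0 G) (F0 F)"
  "F1 (comp_dblftor E G F) = comp_ftor (F1 G) (F1 F)"
  "LComp (comp_dblftor E G F) M N =
    onA (F1 G) (LComp F M N) \<cdot>\<^bsub>D1 E\<^esub> LComp G (onO (F1 F) M) (onO (F1 F) N)"
  "LUnit (comp_dblftor E G F) A = onA (F1 G) (LUnit F A) \<cdot>\<^bsub>D1 E\<^esub> LUnit G (onO (F0 F) A)"
  by (simp_all add: comp_dblftor_def)

lemma ftor_simps [simp]:
  "onO (comp_ftor G F) A = onO G (onO F A)" "onA (comp_ftor G F) f = onA G (onA F f)"
  "onO id_ftor A = A" "onA id_ftor f = f"
  by (simp_all add: comp_ftor_def id_ftor_def)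

lemma id_dblftor_simps [simp]:
  "F0 (id_dblftor D) = id_ftor" "F1 (id_dblftor D) = id_ftor"
  "LComp (id_dblftor D) M N = Ide (D1 D) (M \<odot>\<^bsub>D\<^esub> N)"
  "LUnit (id_dblftor D) A = Ide (D1 D) (onO (Uni D) A)"
  by (simp_all add: id_dblftor_def)

lemma diagonal_simps [simp]:
  "onO (F0 (diagonal D)) A = (A, A)" "onA (F0 (diagonal D)) f = (f, f)"
  "onO (F1 (diagonal D)) M = (M, M)" "onA (F1 (diagonal D)) \<alpha> = (\<alpha>, \<alpha>)"
  "LComp (diagonal D) M N = (Ide (D1 D) (M \<odot>\<^bsub>D\<^esub> N), Ide (D1 D) (M \<odot>\<^bsub>D\<^esub> N))"
  "LUnit (diagonal D) A = (Ide (D1 D) (onO (Uni D) A), Ide (D1 D) (onO (Uni D) A))"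
  by (simp_all add: diagonal_def)

lemma globular_prod_dblcat [simp]:
  "globular (prod_dblcat B D) (\<alpha>, \<beta>) \<longleftrightarrow> globular B \<alpha> \<and> globular D \<beta>"
  by (simp add: globular_def has_sides_def Bex_def split_paired_Ex) blast

lemma is_iso_prod_cat [simp]:
  "is_iso (prod_cat C D) (f, g) \<longleftrightarrow> is_iso C f \<and> is_iso D g"
  by (simp add: is_iso_def Bex_def split_paired_Ex) blast

lemma (in double_category) globular_ide:
  assumes "M \<in> Obj (D1 D)"
  shows "globular D (Ide (D1 D) M)"
  by (rule globularI[of _ "S0 M" "T0 M"]) (use assms in simp_all)

lemma (in double_category) double_functor_diagonal: "double_functor D (prod_dblcat D D) (diagonal D)"
proof -
  have "lax_double_functor D (prod_dblcat D D) (diagonal D)"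
    by unfold_locales
      (auto simp: is_functor_def hom_set_def sides_composable globular_ide H.assoc_simp)
  then show ?thesis by (auto simp: double_functor_def intro!: H.is_iso_ide)
qed

lemma (in double_category) double_functor_bang: "double_functor D unit_dblcat bang"
proof -
  have "lax_double_functor D unit_dblcat bang"
    by unfold_locales (auto simp: is_functor_def globular_def has_sides_def)
  then show ?thesis by (auto simp: double_functor_def is_iso_def)
qed

section \<open>Adjunctions built from invertible structure cells\<close>

context strict_products
begin

lemma double_functor_lax_times:
  "pseudo_products D X Y \<Longrightarrow> double_functor (prod_dblcat D D) D (lax_times D X Y)"
  using lax_double_functor_lax_times
  by (auto simp: double_functor_def pseudo_products_def simp del: lax_times_simps)

text \<open>The unit pairs an identity with itself and the counit consists of the projections.
  Compatibility of the counit with the structure cells is exactly the pair of equations defining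
  those cells; the equations for the unit are checked on components.\<close>

lemma has_right_adjoint_diagonal:
  assumes "pseudo_products D X Y"
  shows "has_right_adjoint D (prod_dblcat D D) (diagonal D)"
proof -
  let ?G = "lax_times D X Y"
  let ?\<eta>0 = "\<lambda>A. pairing (D0 D) X (Ide (D0 D) A) (Ide (D0 D) A)"
  let ?\<eta>1 = "\<lambda>M. pairing (D1 D) Y (Ide (D1 D) M) (Ide (D1 D) M)"
  let ?\<epsilon>0 = "\<lambda>(A, B). (pr1 X A B, pr2 X A B)"
  let ?\<epsilon>1 = "\<lambda>(M, N). (pr1 Y M N, pr2 Y M N)"
  have "vertical_transformation D D (id_dblftor D) (comp_dblftor D ?G (diagonal D)) ?\<eta>0 ?\<eta>1"
  proof
    have "?\<eta>0 (Cod (D0 D) f) \<cdot>\<^bsub>D0 D\<^esub> f = onA (product_ftor (D0 D) X) (f, f) \<cdot>\<^bsub>D0 D\<^esub> ?\<eta>0 (Dom (D0 D) f)"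
      if "f \<in> Arr (D0 D)" for f
      by (rule X.proj_joint_mono[of "Cod (D0 D) f" "Cod (D0 D) f"])
        (use that in \<open>simp_all add: product_simps V.assoc_simp\<close>)
    then show "is_nat_trans (D0 D) (D0 D) (F0 (id_dblftor D)) (F0 (comp_dblftor D ?G (diagonal D))) ?\<eta>0"
      by (simp add: is_nat_trans_def hom_set_def product_simps(1))
    have "?\<eta>1 (Cod (D1 D) \<alpha>) \<bullet> \<alpha> = onA (product_ftor (D1 D) Y) (\<alpha>, \<alpha>) \<bullet> ?\<eta>1 (Dom (D1 D) \<alpha>)"
      if "\<alpha> \<in> Arr (D1 D)" for \<alpha>
      by (rule Y.proj_joint_mono[of "Cod (D1 D) \<alpha>" "Cod (D1 D) \<alpha>"])
        (use that in \<open>simp_all add: product_simps H.assoc_simp\<close>)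
    then show "is_nat_trans (D1 D) (D1 D) (F1 (id_dblftor D)) (F1 (comp_dblftor D ?G (diagonal D))) ?\<eta>1"
      by (simp add: is_nat_trans_def hom_set_def product_simps(3))
  next
    fix M assume "M \<in> Obj (D1 D)"
    then show "has_sides D (?\<eta>1 M) (?\<eta>0 (S0 M)) (?\<eta>0 (T0 M))" by (simp add: has_sides_def)
  next
    fix M N assume "(M, N) \<in> Obj (composables D)"
    then have MN: "M \<in> Obj (D1 D)" "N \<in> Obj (D1 D)" "S0 M = T0 N" by simp_all
    show "?\<eta>1 (M \<odot> N) \<bullet> LComp (id_dblftor D) M N = LComp (comp_dblftor D ?G (diagonal D)) M N \<bullet> (?\<eta>1 M \<star> ?\<eta>1 N)"
      by (rule Y.proj_joint_mono[of "M \<odot> N" "M \<odot> N"])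
        (use MN in \<open>simp_all add: product_simps H.assoc_simp hcomp_merge\<close>)
  next
    fix A assume A: "A \<in> Obj (D0 D)"
    show "?\<eta>1 (U0 A) \<bullet> LUnit (id_dblftor D) A = LUnit (comp_dblftor D ?G (diagonal D)) A \<bullet> U1 (?\<eta>0 A)"
      by (rule Y.proj_joint_mono[of "U0 A" "U0 A"])
        (use A in \<open>simp_all add: product_simps H.assoc_simp flip: Uni_cmp\<close>)
  qed
  moreover have "vertical_transformation (prod_dblcat D D) (prod_dblcat D D)
      (comp_dblftor (prod_dblcat D D) (diagonal D) ?G) (id_dblftor (prod_dblcat D D)) ?\<epsilon>0 ?\<epsilon>1"
    by unfold_locales
      (auto simp: is_nat_trans_def product_simps has_sides_def H.assoc_simp intro: hom_setI)
  moreover have "onA (F0 ?G) (?\<epsilon>0 p) \<cdot>\<^bsub>D0 D\<^esub> ?\<eta>0 (onO (F0 ?G) p) = Ide (D0 D) (onO (F0 ?G) p)"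
    if "p \<in> Obj (D0 (prod_dblcat D D))" for p
    by (cases p, rule X.proj_joint_mono[of "fst p" "snd p"]) (use that in \<open>simp_all add: product_simps V.assoc_simp\<close>)
  moreover have "onA (F1 ?G) (?\<epsilon>1 p) \<bullet> ?\<eta>1 (onO (F1 ?G) p) = Ide (D1 D) (onO (F1 ?G) p)"
    if "p \<in> Obj (D1 (prod_dblcat D D))" for p
    by (cases p, rule Y.proj_joint_mono[of "fst p" "snd p"]) (use that in \<open>simp_all add: product_simps H.assoc_simp\<close>)
  ultimately have "dbl_adjunction D (prod_dblcat D D) (diagonal D) ?G ?\<eta>0 ?\<eta>1 ?\<epsilon>0 ?\<epsilon>1"
    using double_functor_diagonal double_functor_lax_times[OF assms]
    by (simp add: dbl_adjunction_def)
  then show ?thesis unfolding has_right_adjoint_def by blast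
qed

lemma double_functor_tob:
  assumes F: "F = \<lparr>F0 = \<lparr>onO = (\<lambda>_. tob X), onA = (\<lambda>_. Ide (D0 D) (tob X))\<rparr>,
    F1 = \<lparr>onO = (\<lambda>_. tob Y), onA = (\<lambda>_. Ide (D1 D) (tob Y))\<rparr>,
    LComp = (\<lambda>_ _. c), LUnit = (\<lambda>_. u)\<rparr>"
    and c: "c \<in> hom_set (hor_cat D (tob X) (tob X)) (tob Y \<odot> tob Y) (tob Y)"
    and u: "u \<in> hom_set (hor_cat D (tob X) (tob X)) (U0 (tob X)) (tob Y)"
    and "pseudo_products D X Y"
  shows "double_functor unit_dblcat D F"
proof -
  have "is_iso (D1 D) c" "is_iso (D1 D) u"
    using hom_setD[OF c] hom_setD[OF u] assms(4) unfolding pseudo_products_def by (auto simp: hom_set_def)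
  then show ?thesis
    using lax_double_functor_tob[OF assms(1-3)] by (auto simp: double_functor_def F)
qed

text \<open>A cell into \<open>tob Y\<close> exists by terminality in \<open>D1\<close>; its sides
  are endomorphisms of the terminal object \<open>tob X\<close>, hence identities.\<close>

lemma glob_cell_to_tob:
  assumes "M \<in> Obj (D1 D)" "S0 M = tob X" "T0 M = tob X"
  obtains \<alpha> where "\<alpha> \<in> hom_set (hor_cat D (tob X) (tob X)) M (tob Y)"
proof -
  obtain \<alpha> where \<alpha>: "\<alpha> \<in> Arr (D1 D)" "Dom (D1 D) \<alpha> = M" "Cod (D1 D) \<alpha> = tob Y"
    by (rule H.terminal_arrow[OF Y.terminal_tob assms(1)])
  have "S1 \<alpha> = Ide (D0 D) (tob X)" "T1 \<alpha> = Ide (D0 D) (tob X)"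
    by (rule V.terminal_unique[OF X.terminal_tob]; use \<alpha> assms in simp)+
  then show ?thesis using that \<alpha> by (auto simp: hom_set_def)
qed

lemma has_right_adjoint_bang:
  assumes "pseudo_products D X Y"
  shows "has_right_adjoint D unit_dblcat bang"
proof -
  obtain c where c: "c \<in> hom_set (hor_cat D (tob X) (tob X)) (tob Y \<odot> tob Y) (tob Y)"
    by (rule glob_cell_to_tob[of "tob Y \<odot> tob Y"]) simp_all
  obtain u where u: "u \<in> hom_set (hor_cat D (tob X) (tob X)) (U0 (tob X)) (tob Y)"
    by (rule glob_cell_to_tob[of "U0 (tob X)"]) simp_all
  define G where "G = \<lparr>F0 = \<lparr>onO = (\<lambda>_::unit. tob X), onA = (\<lambda>_::unit. Ide (D0 D) (tob X))\<rparr>,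
    F1 = \<lparr>onO = (\<lambda>_::unit. tob Y), onA = (\<lambda>_::unit. Ide (D1 D) (tob Y))\<rparr>,
    LComp = (\<lambda>(_::unit) (_::unit). c), LUnit = (\<lambda>_::unit. u)\<rparr>"
  have G: "double_functor unit_dblcat D G"
    by (rule double_functor_tob[OF G_def c u assms])
  note c' = hom_setD[OF c, simplified] and u' = hom_setD[OF u, simplified]
  have "\<forall>A \<in> Obj (D0 D). \<exists>f. f \<in> Arr (D0 D) \<and> Dom (D0 D) f = A \<and> Cod (D0 D) f = tob X"
    by (blast elim: V.terminal_arrow[OF X.terminal_tob])
  from bchoice[OF this] obtain \<eta>0 where \<eta>0: "\<forall>A \<in> Obj (D0 D).
      \<eta>0 A \<in> Arr (D0 D) \<and> Dom (D0 D) (\<eta>0 A) = A \<and> Cod (D0 D) (\<eta>0 A) = tob X"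
    ..
  have "\<forall>M \<in> Obj (D1 D). \<exists>\<alpha>. \<alpha> \<in> Arr (D1 D) \<and> Dom (D1 D) \<alpha> = M \<and> Cod (D1 D) \<alpha> = tob Y"
    by (blast elim: H.terminal_arrow[OF Y.terminal_tob])
  from bchoice[OF this] obtain \<eta>1 where \<eta>1: "\<forall>M \<in> Obj (D1 D).
      \<eta>1 M \<in> Arr (D1 D) \<and> Dom (D1 D) (\<eta>1 M) = M \<and> Cod (D1 D) (\<eta>1 M) = tob Y"
    ..
  \<comment> \<open>\<open>\<eta>0\<close> and \<open>\<eta>1\<close> were chosen independently;
    they match because arrows into \<open>tob X\<close> are unique.\<close>
  have sides: "S1 (\<eta>1 M) = \<eta>0 (S0 M)" "T1 (\<eta>1 M) = \<eta>0 (T0 M)" if "M \<in> Obj (D1 D)" for M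
    by (rule V.terminal_unique[OF X.terminal_tob]; use that \<eta>0 \<eta>1 in simp)+
  have "vertical_transformation D D (id_dblftor D) (comp_dblftor D G bang) \<eta>0 \<eta>1"
    by unfold_locales
      (use \<eta>0 \<eta>1 sides c' u' in \<open>auto simp: is_nat_trans_def hom_set_def G_def bang_def has_sides_def
        intro!: cell_to_tob_unique V.terminal_unique[OF X.terminal_tob]\<close>)
  moreover have "vertical_transformation unit_dblcat unit_dblcat (comp_dblftor unit_dblcat bang G)
      (id_dblftor unit_dblcat) (\<lambda>_. ()) (\<lambda>_. ())"
    by unfold_locales (auto simp: is_nat_trans_def has_sides_def)
  moreover have "onA (F0 G) () \<cdot>\<^bsub>D0 D\<^esub> \<eta>0 (onO (F0 G) ()) = Ide (D0 D) (onO (F0 G) ())"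
    by (rule V.terminal_unique[OF X.terminal_tob]) (use \<eta>0 in \<open>simp_all add: G_def\<close>)
  moreover have "onA (F1 G) () \<bullet> \<eta>1 (onO (F1 G) ()) = Ide (D1 D) (onO (F1 G) ())"
    by (rule cell_to_tob_unique) (use \<eta>1 in \<open>simp_all add: G_def\<close>)
  ultimately have "dbl_adjunction D unit_dblcat bang G \<eta>0 \<eta>1 (\<lambda>_. ()) (\<lambda>_. ())"
    using double_functor_bang G by (simp add: dbl_adjunction_def)
  then show ?thesis unfolding has_right_adjoint_def by blast
qed

lemma cartesian_if_pseudo_products: "pseudo_products D X Y \<Longrightarrow> cartesian_dblcat D"
  by (simp add: cartesian_dblcat_def has_right_adjoint_diagonal has_right_adjoint_bang)

end

section \<open>From adjunctions to products\<close>

text \<open>The classical description of products by a right adjoint of the diagonal, with the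
  counit as projections. It is stated for a single category so that it serves both \<open>D0\<close>
  and \<open>D1\<close>.\<close>

lemma (in category) diagonal_adjunction_product:
  assumes G: "is_functor (prod_cat C C) C G"
    and \<Delta>: "\<And>A. onO \<Delta> A = (A, A)" "\<And>f. onA \<Delta> f = (f, f)"
    and \<eta>: "is_nat_trans C C id_ftor (comp_ftor G \<Delta>) \<eta>"
    and \<epsilon>: "is_nat_trans (prod_cat C C) (prod_cat C C) (comp_ftor \<Delta> G) id_ftor \<epsilon>"
    and t1: "\<And>A. A \<in> Obj C \<Longrightarrow> \<epsilon> (A, A) \<cdot>\<^bsub>prod_cat C C\<^esub> (\<eta> A, \<eta> A) = (Ide C A, Ide C A)"
    and t2: "\<And>p. p \<in> Obj (prod_cat C C) \<Longrightarrow> onA G (\<epsilon> p) \<cdot> \<eta> (onO G p) = Ide C (onO G p)"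
    and AB: "A \<in> Obj C" "B \<in> Obj C"
  shows "is_product C A B (onO G (A, B)) (fst (\<epsilon> (A, B))) (snd (\<epsilon> (A, B)))"
proof -
  let ?P = "onO G (A, B)"
  define p q where "p = fst (\<epsilon> (A, B))" and "q = snd (\<epsilon> (A, B))"
  have \<epsilon>_eq: "\<epsilon> (A, B) = (p, q)" by (simp add: p_def q_def)
  have "(p, q) \<in> hom_set (prod_cat C C) (?P, ?P) (A, B)"
    using \<epsilon> AB by (simp add: is_nat_trans_def \<Delta> flip: \<epsilon>_eq)
  then have pq: "p \<in> Arr C" "Dom C p = ?P" "Cod C p = A" "q \<in> Arr C" "Dom C q = ?P" "Cod C q = B"
    by (auto simp: hom_set_def)
  have P: "?P \<in> Obj C" using dom_closed[OF pq(1)] by (simp add: pq(2))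
  have \<eta>_simps: "\<eta> Z \<in> Arr C" "Dom C (\<eta> Z) = Z" "Cod C (\<eta> Z) = onO G (Z, Z)" if "Z \<in> Obj C" for Z
    using \<eta> that by (auto simp: is_nat_trans_def hom_set_def \<Delta>)
  have \<eta>_nat: "\<eta> (Cod C f) \<cdot> f = onA G (f, f) \<cdot> \<eta> (Dom C f)" if "f \<in> Arr C" for f
    using \<eta> that by (auto simp: is_nat_trans_def \<Delta>)
  have G_simps: "onA G (f, g) \<in> Arr C" "Dom C (onA G (f, g)) = onO G (Dom C f, Dom C g)"
    "Cod C (onA G (f, g)) = onO G (Cod C f, Cod C g)" if "f \<in> Arr C" "g \<in> Arr C" for f g
    using is_functorD(2-4)[OF G, of "(f, g)"] that by simp_all
  have G_cmp: "onA G (f' \<cdot> f, g' \<cdot> g) = onA G (f', g') \<cdot> onA G (f, g)"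
    if "f \<in> Arr C" "g \<in> Arr C" "f' \<in> Arr C" "g' \<in> Arr C" "Cod C f = Dom C f'" "Cod C g = Dom C g'" for f g f' g'
    using is_functorD(6)[OF G, of "(f, g)" "(f', g')"] that by simp
  \<comment> \<open>An arrow is the transpose of its own projections, by naturality of
    \<open>\<eta>\<close> at \<open>x\<close> and the triangle identity \<open>t2\<close>. This
    gives joint monicity.\<close>
  have transpose: "x = onA G (p \<cdot> x, q \<cdot> x) \<cdot> \<eta> (Dom C x)" if "x \<in> Arr C" "Cod C x = ?P" for x
  proof -
    have "onA G (p \<cdot> x, q \<cdot> x) \<cdot> \<eta> (Dom C x) = onA G (p, q) \<cdot> (onA G (x, x) \<cdot> \<eta> (Dom C x))"
      using that pq \<eta>_simps G_simps by (simp add: G_cmp assoc_simp)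
    also have "\<dots> = (onA G (\<epsilon> (A, B)) \<cdot> \<eta> ?P) \<cdot> x"
      using that pq \<eta>_simps G_simps P \<eta>_nat[of x] by (simp add: assoc_simp \<epsilon>_eq)
    also have "\<dots> = x" using t2[of "(A, B)"] that AB by simp
    finally show ?thesis ..
  qed
  have "is_product C A B ?P p q"
  proof (rule is_productI[OF pq])
    fix f g assume fg: "f \<in> Arr C" "g \<in> Arr C" "Dom C f = Dom C g" "Cod C f = A" "Cod C g = B"
    let ?Z = "Dom C g"
    have Z: "?Z \<in> Obj C" using fg by simp
    obtain p' q' where pq': "\<epsilon> (?Z, ?Z) = (p', q')" by fastforce
    have "(p', q') \<in> hom_set (prod_cat C C) (onO G (?Z, ?Z), onO G (?Z, ?Z)) (?Z, ?Z)"
      using \<epsilon> Z by (simp add: is_nat_trans_def \<Delta> flip: pq')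
    then have p': "p' \<in> Arr C" "Dom C p' = onO G (?Z, ?Z)" "Cod C p' = ?Z"
      "q' \<in> Arr C" "Dom C q' = onO G (?Z, ?Z)" "Cod C q' = ?Z"
      by (auto simp: hom_set_def)
    \<comment> \<open>The lift is \<open>onA G (f, g) \<cdot> \<eta> ?Z\<close>; naturality of
      \<open>\<epsilon>\<close> at \<open>(f, g)\<close> and the triangle identity \<open>t1\<close>
      compute its projections.\<close>
    have "(f, g) \<in> Arr (prod_cat C C)" using fg by simp
    then have "\<epsilon> (A, B) \<cdot>\<^bsub>prod_cat C C\<^esub> (onA G (f, g), onA G (f, g)) = (f, g) \<cdot>\<^bsub>prod_cat C C\<^esub> \<epsilon> (?Z, ?Z)"
      using \<epsilon> fg unfolding is_nat_trans_def by (fastforce simp: \<Delta>)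
    then have n: "p \<cdot> onA G (f, g) = f \<cdot> p'" "q \<cdot> onA G (f, g) = g \<cdot> q'"
      by (simp_all add: \<epsilon>_eq pq')
    have t: "p' \<cdot> \<eta> ?Z = Ide C ?Z" "q' \<cdot> \<eta> ?Z = Ide C ?Z"
      using t1[OF Z] by (simp_all add: pq')
    have "p \<cdot> (onA G (f, g) \<cdot> \<eta> ?Z) = f" "q \<cdot> (onA G (f, g) \<cdot> \<eta> ?Z) = g"
      using fg pq p' G_simps \<eta>_simps Z t by (simp_all add: cmp_extend[OF n(1)] cmp_extend[OF n(2)] assoc_simp)
    then show "\<exists>h. h \<in> Arr C \<and> Dom C h = Dom C g \<and> Cod C h = ?P \<and> p \<cdot> h = f \<and> q \<cdot> h = g"
      using fg G_simps \<eta>_simps Z by (intro exI[of _ "onA G (f, g) \<cdot> \<eta> ?Z"]) simp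
  next
    fix x y assume "x \<in> Arr C" "y \<in> Arr C" "Dom C x = Dom C y" "Cod C x = ?P" "Cod C y = ?P"
      "p \<cdot> x = p \<cdot> y" "q \<cdot> x = q \<cdot> y"
    then show "x = y" using transpose[of x] transpose[of y] by simp
  qed
  then show ?thesis by (simp add: p_def q_def)
qed

text \<open>The triangle identity makes the unit at \<open>onO G ()\<close> an identity, and
  naturality of \<open>\<eta>\<close> at an arrow \<open>f\<close> into that object then reads
  \<open>f = \<eta> Z\<close>.\<close>

lemma (in category) bang_adjunction_terminal:
  assumes G: "is_functor unit_cat C G"
    and \<eta>: "is_nat_trans C C id_ftor (comp_ftor G F) \<eta>"
    and t: "onA G () \<cdot> \<eta> (onO G ()) = Ide C (onO G ())"
  shows "is_terminal C (onO G ())"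
proof -
  let ?I = "onO G ()"
  have I: "?I \<in> Obj C" using is_functorD(1)[OF G, of "()"] by simp
  have GI: "onA G () = Ide C ?I" using is_functorD(5)[OF G, of "()"] by simp
  have \<eta>_simps: "\<eta> Z \<in> Arr C" "Dom C (\<eta> Z) = Z" "Cod C (\<eta> Z) = ?I" if "Z \<in> Obj C" for Z
    using \<eta> that by (auto simp: is_nat_trans_def hom_set_def)
  have \<eta>I: "\<eta> ?I = Ide C ?I" using t \<eta>_simps[OF I] by (simp add: GI)
  have "f = \<eta> Z" if f: "f \<in> hom_set C Z ?I" for f Z
  proof -
    have "\<eta> (Cod C f) \<cdot> f = onA G (onA F f) \<cdot> \<eta> (Dom C f)"
      using \<eta> hom_setD(1)[OF f] by (auto simp: is_nat_trans_def)
    moreover have "Z \<in> Obj C" using dom_closed[OF hom_setD(1)[OF f]] hom_setD(2)[OF f] by simp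
    ultimately show ?thesis
      using hom_setD[OF f] \<eta>_simps[of Z] by (simp add: \<eta>I GI)
  qed
  moreover have "\<eta> Z \<in> hom_set C Z ?I" if "Z \<in> Obj C" for Z
    using \<eta>_simps[OF that] by (rule hom_setI)
  ultimately show ?thesis
    unfolding is_terminal_def using I by blast
qed

section \<open>Products extracted from a Cartesian double category and their independence of
  choices\<close>

context double_category
begin

lemma is_iso_Uni:
  assumes "is_iso (D0 D) f"
  shows "is_iso (D1 D) (U1 f)"
proof -
  obtain g where g: "g \<in> Arr (D0 D)" "Dom (D0 D) g = Cod (D0 D) f" "Cod (D0 D) g = Dom (D0 D) f"
      "g \<cdot>\<^bsub>D0 D\<^esub> f = Ide (D0 D) (Dom (D0 D) f)" "f \<cdot>\<^bsub>D0 D\<^esub> g = Ide (D0 D) (Cod (D0 D) f)"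
    using assms by (rule V.is_isoE)
  show ?thesis
    by (rule H.is_isoI[of _ "U1 g"]) (use V.is_iso_Arr[OF assms] g in \<open>simp_all flip: Uni_cmp\<close>)
qed

text \<open>The counit supplies the projections on both levels. Double functors and vertical
  transformations respect \<open>S\<close> and \<open>T\<close> by equality, so the resulting
  products are strict over \<open>D0\<close>; the invertible structure cells of the right adjoint
  turn out to be the canonical ones.\<close>

lemma cartesian_pseudo_products:
  assumes "cartesian_dblcat D"
  obtains X Y where "strict_products D X Y" "pseudo_products D X Y"
proof -
  obtain G \<eta>0 \<eta>1 \<epsilon>0 \<epsilon>1 where adj: "dbl_adjunction D (prod_dblcat D D) (diagonal D) G \<eta>0 \<eta>1 \<epsilon>0 \<epsilon>1"
    using assms by (auto simp: cartesian_dblcat_def has_right_adjoint_def)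
  obtain G' \<eta>0' \<eta>1' \<epsilon>0' \<epsilon>1' where adj': "dbl_adjunction D unit_dblcat bang G' \<eta>0' \<eta>1' \<epsilon>0' \<epsilon>1'"
    using assms by (auto simp: cartesian_dblcat_def has_right_adjoint_def)
  have pseudo: "double_functor (prod_dblcat D D) D G" "double_functor unit_dblcat D G'"
    using adj adj' by (auto simp: dbl_adjunction_def)
  interpret G: lax_double_functor "prod_dblcat D D" D G
    using pseudo by (simp add: double_functor_def)
  interpret G': lax_double_functor unit_dblcat D G'
    using pseudo by (simp add: double_functor_def)
  interpret \<eta>: vertical_transformation D D "id_dblftor D" "comp_dblftor D G (diagonal D)" \<eta>0 \<eta>1
    using adj by (simp add: dbl_adjunction_def)
  interpret \<epsilon>: vertical_transformation "prod_dblcat D D" "prod_dblcat D D"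
      "comp_dblftor (prod_dblcat D D) (diagonal D) G" "id_dblftor (prod_dblcat D D)" \<epsilon>0 \<epsilon>1
    using adj by (simp add: dbl_adjunction_def)
  interpret \<eta>': vertical_transformation D D "id_dblftor D" "comp_dblftor D G' bang" \<eta>0' \<eta>1'
    using adj' by (simp add: dbl_adjunction_def)
  define X where "X = \<lparr>pob = (\<lambda>A B. onO (F0 G) (A, B)), pr1 = (\<lambda>A B. fst (\<epsilon>0 (A, B))),
    pr2 = (\<lambda>A B. snd (\<epsilon>0 (A, B))), tob = onO (F0 G') ()\<rparr>"
  define Y where "Y = \<lparr>pob = (\<lambda>M N. onO (F1 G) (M, N)), pr1 = (\<lambda>M N. fst (\<epsilon>1 (M, N))),
    pr2 = (\<lambda>M N. snd (\<epsilon>1 (M, N))), tob = onO (F1 G') ()\<rparr>"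
  have X: "is_product (D0 D) A B (pob X A B) (pr1 X A B) (pr2 X A B)"
    if "A \<in> Obj (D0 D)" "B \<in> Obj (D0 D)" for A B
    unfolding X_def prods.simps
    by (rule V.diagonal_adjunction_product[where \<Delta> = "F0 (diagonal D)" and \<eta> = \<eta>0])
      (use adj G.functor_F0 \<eta>.nat_0 \<epsilon>.nat_0 that in \<open>simp_all add: dbl_adjunction_def\<close>)
  have Y: "is_product (D1 D) M N (pob Y M N) (pr1 Y M N) (pr2 Y M N)"
    if "M \<in> Obj (D1 D)" "N \<in> Obj (D1 D)" for M N
    unfolding Y_def prods.simps
    by (rule H.diagonal_adjunction_product[where \<Delta> = "F1 (diagonal D)" and \<eta> = \<eta>1])
      (use adj G.functor_F1 \<eta>.nat_1 \<epsilon>.nat_1 that in \<open>simp_all add: dbl_adjunction_def\<close>)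
  have tX: "is_terminal (D0 D) (tob X)"
    unfolding X_def prods.simps
    by (rule V.bang_adjunction_terminal[where F = "F0 bang" and \<eta> = \<eta>0'])
      (use adj' G'.functor_F0 \<eta>'.nat_0 in \<open>simp_all add: dbl_adjunction_def\<close>)
  have tY: "is_terminal (D1 D) (tob Y)"
    unfolding Y_def prods.simps
    by (rule H.bang_adjunction_terminal[where F = "F1 bang" and \<eta> = \<eta>1'])
      (use adj' G'.functor_F1 \<eta>'.nat_1 in \<open>simp_all add: dbl_adjunction_def\<close>)
  have \<epsilon>0: "\<epsilon>0 (A, B) = (pr1 X A B, pr2 X A B)" for A B by (simp add: X_def)
  have \<epsilon>1: "\<epsilon>1 (M, N) = (pr1 Y M N, pr2 Y M N)" for M N by (simp add: Y_def)
  have F1G: "onO (F1 G) (M, N) = pob Y M N" and F0G: "onO (F0 G) (A, B) = pob X A B" for M N A B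
    by (simp_all add: X_def Y_def)
  have F0G': "onO (F0 G') () = tob X" and F1G': "onO (F1 G') () = tob Y"
    by (simp_all add: X_def Y_def)
  have "strict_products D X Y"
  proof
    show "chosen_products (D0 D) X" "chosen_products (D1 D) Y"
      using X Y tX tY by (simp_all add: chosen_products_def)
    fix M N assume "M \<in> Obj (D1 D)" "N \<in> Obj (D1 D)"
    then show "S0 (pob Y M N) = pob X (S0 M) (S0 N)" "T0 (pob Y M N) = pob X (T0 M) (T0 N)"
        "S1 (pr1 Y M N) = pr1 X (S0 M) (S0 N)" "S1 (pr2 Y M N) = pr2 X (S0 M) (S0 N)"
        "T1 (pr1 Y M N) = pr1 X (T0 M) (T0 N)" "T1 (pr2 Y M N) = pr2 X (T0 M) (T0 N)"
      using G.Src_F1(1)[of "(M, N)"] G.Tgt_F1(1)[of "(M, N)"] \<epsilon>.sides[of "(M, N)"]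
      by (simp_all add: has_sides_def \<epsilon>0 \<epsilon>1 F0G F1G)
  next
    show "S0 (tob Y) = tob X" "T0 (tob Y) = tob X"
      using G'.Src_F1(1)[of "()"] G'.Tgt_F1(1)[of "()"] by (simp_all add: F0G' F1G' unit_dblcat_def id_ftor_def)
  qed
  then interpret P: strict_products D X Y .
  have "pseudo_products D X Y"
    unfolding pseudo_products_def
  proof (intro conjI allI impI ballI)
    fix M N M' N' assume "(M', M) \<in> Obj (composables D) \<and> (N', N) \<in> Obj (composables D)"
    then have MN: "M \<in> Obj (D1 D)" "M' \<in> Obj (D1 D)" "N \<in> Obj (D1 D)" "N' \<in> Obj (D1 D)"
      "S0 M' = T0 M" "S0 N' = T0 N" by simp_all
    let ?c = "LComp G (M', N') (M, N)"
    have "?c \<in> hom_set (D1 D) (pob Y M' N' \<odot> pob Y M N) (pob Y (M' \<odot> M) (N' \<odot> N))"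
      using G.LComp_cell[of "(M', N')" "(M, N)"] MN by (simp add: F1G)
    note c = hom_setD[OF this]
    \<comment> \<open>Compatibility of the counit with structure cells, read in each component: the
      structure cells of the diagonal are identities, so what remains are the projections of
      \<open>?c\<close>.\<close>
    have e: "pr1 Y (M' \<odot> M) (N' \<odot> N) \<bullet> ?c = pr1 Y M' N' \<star> pr1 Y M N"
      "pr2 Y (M' \<odot> M) (N' \<odot> N) \<bullet> ?c = pr2 Y M' N' \<star> pr2 Y M N"
      using \<epsilon>.compat_LComp[of "(M', N')" "(M, N)"] MN c by (simp_all add: \<epsilon>1 F1G)
    have "?c = LComp (lax_times D X Y) (M', N') (M, N)"
      by (rule P.Y.proj_joint_mono[of "M' \<odot> M" "N' \<odot> N"]) (use MN c e in simp_all)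
    moreover have "is_iso (D1 D) ?c"
      using pseudo(1) MN unfolding double_functor_def by fastforce
    ultimately show "is_iso (D1 D) (LComp (lax_times D X Y) (M', N') (M, N))" by simp
  next
    fix A B assume AB: "A \<in> Obj (D0 D)" "B \<in> Obj (D0 D)"
    let ?u = "LUnit G (A, B)"
    have "?u \<in> hom_set (D1 D) (U0 (pob X A B)) (pob Y (U0 A) (U0 B))"
      using G.LUnit_cell[of "(A, B)"] AB by (simp add: F1G F0G)
    note u = hom_setD[OF this]
    have e: "pr1 Y (U0 A) (U0 B) \<bullet> ?u = U1 (pr1 X A B)" "pr2 Y (U0 A) (U0 B) \<bullet> ?u = U1 (pr2 X A B)"
      using \<epsilon>.compat_LUnit[of "(A, B)"] AB u by (simp_all add: \<epsilon>1 \<epsilon>0 F1G F0G)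
    have "?u = LUnit (lax_times D X Y) (A, B)"
      by (rule P.Y.proj_joint_mono[of "U0 A" "U0 B"]) (use AB u e in simp_all)
    moreover have "is_iso (D1 D) ?u"
      using pseudo(1) AB unfolding double_functor_def by simp
    ultimately show "is_iso (D1 D) (LUnit (lax_times D X Y) (A, B))" by simp
  next
    fix \<alpha>
    assume "\<alpha> \<in> hom_set (D1 D) (tob Y \<odot> tob Y) (tob Y) \<union> hom_set (D1 D) (U0 (tob X)) (tob Y)"
    \<comment> \<open>The invertible structure cells of \<open>G'\<close> have the required
      boundaries, and by terminality any other such cell coincides with one of them.\<close>
    moreover have "LComp G' () () \<in> hom_set (D1 D) (tob Y \<odot> tob Y) (tob Y)" "is_iso (D1 D) (LComp G' () ())"
      "LUnit G' () \<in> hom_set (D1 D) (U0 (tob X)) (tob Y)" "is_iso (D1 D) (LUnit G' ())"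
      using G'.LComp_cell[of "()" "()"] G'.LUnit_cell[of "()"] pseudo(2)
      by (auto simp: double_functor_def F0G' F1G' simp flip: F0G' F1G')
    ultimately show "is_iso (D1 D) \<alpha>"
      using P.cell_to_tob_unique[of \<alpha> "LComp G' () ()"] P.cell_to_tob_unique[of \<alpha> "LUnit G' ()"]
      by (auto simp: hom_set_def)
  qed
  then show ?thesis using that P.strict_products_axioms by blast
qed

end

text \<open>The structure cell for \<open>Y\<close> closes a square whose other three edges are
  invertible: the structure cell for \<open>Y'\<close> and two comparison cells. The comparison
  cells have sides \<open>c0\<close> and are not globular in general, which is why invertibility of
  horizontal composites and of \<open>U1\<close> is needed for arbitrary sides.\<close>

lemma pseudo_products_transfer:
  assumes "strict_products D X Y" "strict_products D X' Y'" "pseudo_products D X' Y'"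
  shows "pseudo_products D X Y"
proof -
  interpret P: strict_products D X Y by fact
  interpret Q: strict_products D X' Y' by fact
  define c where "c = (\<lambda>M N. pairing (D1 D) Y (pr1 Y' M N) (pr2 Y' M N))"
  define c0 where "c0 = (\<lambda>A B. pairing (D0 D) X (pr1 X' A B) (pr2 X' A B))"
  have c: "c M N \<in> Arr (D1 D)" "Dom (D1 D) (c M N) = pob Y' M N" "Cod (D1 D) (c M N) = pob Y M N"
      "P.S1 (c M N) = c0 (P.S0 M) (P.S0 N)" "P.T1 (c M N) = c0 (P.T0 M) (P.T0 N)"
      "pr1 Y M N \<cdot>\<^bsub>D1 D\<^esub> c M N = pr1 Y' M N" "pr2 Y M N \<cdot>\<^bsub>D1 D\<^esub> c M N = pr2 Y' M N"
    if "M \<in> Obj (D1 D)" "N \<in> Obj (D1 D)" for M N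
    using that by (simp_all add: c_def c0_def)
  have c0: "c0 A B \<in> Arr (D0 D)" "Dom (D0 D) (c0 A B) = pob X' A B" "Cod (D0 D) (c0 A B) = pob X A B"
      "pr1 X A B \<cdot>\<^bsub>D0 D\<^esub> c0 A B = pr1 X' A B" "pr2 X A B \<cdot>\<^bsub>D0 D\<^esub> c0 A B = pr2 X' A B"
    if "A \<in> Obj (D0 D)" "B \<in> Obj (D0 D)" for A B
    using that by (simp_all add: c0_def)
  have c_iso: "is_iso (D1 D) (c M N)" if "M \<in> Obj (D1 D)" "N \<in> Obj (D1 D)" for M N
    by (rule P.H.is_product_comparison_iso[OF Q.Y.product_pob P.Y.product_pob]) (use that c in simp_all)
  have c0_iso: "is_iso (D0 D) (c0 A B)" if "A \<in> Obj (D0 D)" "B \<in> Obj (D0 D)" for A B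
    by (rule P.V.is_product_comparison_iso[OF Q.X.product_pob P.X.product_pob]) (use that c0 in simp_all)
  show ?thesis
    unfolding pseudo_products_def
  proof (intro conjI allI impI ballI)
    fix M N M' N' assume "(M', M) \<in> Obj (composables D) \<and> (N', N) \<in> Obj (composables D)"
    then have MN: "M \<in> Obj (D1 D)" "M' \<in> Obj (D1 D)" "N \<in> Obj (D1 D)" "N' \<in> Obj (D1 D)"
      "P.S0 M' = P.T0 M" "P.S0 N' = P.T0 N" by simp_all
    let ?l = "LComp (lax_times D X Y) (M', N') (M, N)"
    let ?l' = "LComp (lax_times D X' Y') (M', N') (M, N)"
    let ?cc = "c M' N' \<star>\<^bsub>D\<^esub> c M N"
    have l': "is_iso (D1 D) ?l'" using assms(3) MN by (simp add: pseudo_products_def del: Q.lax_times_simps)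
    \<comment> \<open>Each projection of either path is the horizontal composite of the
      corresponding projections of \<open>Y'\<close>.\<close>
    have "?l \<cdot>\<^bsub>D1 D\<^esub> ?cc = c (M' \<odot>\<^bsub>D\<^esub> M) (N' \<odot>\<^bsub>D\<^esub> N) \<cdot>\<^bsub>D1 D\<^esub> ?l'"
      by (rule P.Y.proj_joint_mono[of "M' \<odot>\<^bsub>D\<^esub> M" "N' \<odot>\<^bsub>D\<^esub> N"])
        (use MN c in \<open>simp_all add: P.hcomp_merge P.H.cmp_extend[OF c(6)] P.H.cmp_extend[OF c(7)]\<close>)
    moreover have "is_iso (D1 D) (c (M' \<odot>\<^bsub>D\<^esub> M) (N' \<odot>\<^bsub>D\<^esub> N) \<cdot>\<^bsub>D1 D\<^esub> ?l')"
      by (rule P.H.is_iso_cmp[OF l' c_iso]) (use MN c in simp_all)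
    ultimately have i: "is_iso (D1 D) (?l \<cdot>\<^bsub>D1 D\<^esub> ?cc)" by metis
    have "is_iso (D1 D) ?cc"
      by (rule P.is_iso_hcomp[OF c_iso c_iso]) (use MN c in simp_all)
    from this i show "is_iso (D1 D) ?l"
      by (rule P.H.is_iso_left_factor) (use MN c in simp_all)
  next
    fix A B assume AB: "A \<in> Obj (D0 D)" "B \<in> Obj (D0 D)"
    let ?l = "LUnit (lax_times D X Y) (A, B)"
    let ?l' = "LUnit (lax_times D X' Y') (A, B)"
    have l': "is_iso (D1 D) ?l'" using assms(3) AB by (simp add: pseudo_products_def del: Q.lax_times_simps)
    have "?l \<cdot>\<^bsub>D1 D\<^esub> P.U1 (c0 A B) = c (P.U0 A) (P.U0 B) \<cdot>\<^bsub>D1 D\<^esub> ?l'"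
      by (rule P.Y.proj_joint_mono[of "P.U0 A" "P.U0 B"])
        (use AB c c0 in \<open>simp_all add: P.H.cmp_extend[OF c(6)] P.H.cmp_extend[OF c(7)] flip: P.Uni_cmp\<close>)
    moreover have "is_iso (D1 D) (c (P.U0 A) (P.U0 B) \<cdot>\<^bsub>D1 D\<^esub> ?l')"
      by (rule P.H.is_iso_cmp[OF l' c_iso]) (use AB c in simp_all)
    ultimately have "is_iso (D1 D) (?l \<cdot>\<^bsub>D1 D\<^esub> P.U1 (c0 A B))" by metis
    with P.is_iso_Uni[OF c0_iso[OF AB]] show "is_iso (D1 D) ?l"
      by (rule P.H.is_iso_left_factor) (use AB c c0 in simp_all)
  next
    fix \<alpha>
    assume \<alpha>: "\<alpha> \<in> hom_set (D1 D) (tob Y \<odot>\<^bsub>D\<^esub> tob Y) (tob Y) \<union> hom_set (D1 D) (P.U0 (tob X)) (tob Y)"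
    obtain t where t: "t \<in> Arr (D1 D)" "Dom (D1 D) t = tob Y'" "Cod (D1 D) t = tob Y"
      by (rule P.H.terminal_arrow[OF P.Y.terminal_tob Q.Y.tob_Obj])
    obtain s where s: "s \<in> Arr (D0 D)" "Dom (D0 D) s = tob X'" "Cod (D0 D) s = tob X"
      by (rule P.V.terminal_arrow[OF P.X.terminal_tob Q.X.tob_Obj])
    have t_iso: "is_iso (D1 D) t" by (rule P.H.terminal_iso[OF Q.Y.terminal_tob P.Y.terminal_tob t])
    have s_iso: "is_iso (D0 D) s" by (rule P.V.terminal_iso[OF Q.X.terminal_tob P.X.terminal_tob s])
    have st: "P.S1 t = s" "P.T1 t = s"
      by (rule P.V.terminal_unique[OF P.X.terminal_tob]; use s t in simp)+
    \<comment> \<open>The nullary comparison square, with invertible edges \<open>r\<close>,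
      \<open>\<beta>\<close> and \<open>t\<close>. It commutes because it ends in a terminal object.
      The edge \<open>r\<close> is later taken to be \<open>t \<star> t\<close> or
      \<open>U1 s\<close>.\<close>
    have key: "is_iso (D1 D) \<alpha>"
      if "\<alpha> \<in> Arr (D1 D)" "Cod (D1 D) \<alpha> = tob Y" "is_iso (D1 D) r" "Cod (D1 D) r = Dom (D1 D) \<alpha>"
        "is_iso (D1 D) \<beta>" "Dom (D1 D) \<beta> = Dom (D1 D) r" "Cod (D1 D) \<beta> = tob Y'" for r \<beta>
    proof -
      have "\<alpha> \<cdot>\<^bsub>D1 D\<^esub> r = t \<cdot>\<^bsub>D1 D\<^esub> \<beta>"
        by (rule P.cell_to_tob_unique)
          (use that t P.H.is_iso_Arr[OF that(3)] P.H.is_iso_Arr[OF that(5)] in simp_all)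
      moreover have "is_iso (D1 D) (t \<cdot>\<^bsub>D1 D\<^esub> \<beta>)"
        by (rule P.H.is_iso_cmp[OF that(5) t_iso]) (use that t in simp)
      ultimately have "is_iso (D1 D) (\<alpha> \<cdot>\<^bsub>D1 D\<^esub> r)" by simp
      with that(3) show ?thesis
        by (rule P.H.is_iso_left_factor) (use that(1,4) in simp_all)
    qed
    from \<alpha> show "is_iso (D1 D) \<alpha>"
    proof
      assume "\<alpha> \<in> hom_set (D1 D) (tob Y \<odot>\<^bsub>D\<^esub> tob Y) (tob Y)"
      note \<alpha> = hom_setD[OF this]
      obtain \<beta> where \<beta>: "\<beta> \<in> Arr (D1 D)" "Dom (D1 D) \<beta> = tob Y' \<odot>\<^bsub>D\<^esub> tob Y'" "Cod (D1 D) \<beta> = tob Y'"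
        by (rule P.H.terminal_arrow[OF Q.Y.terminal_tob, of "tob Y' \<odot>\<^bsub>D\<^esub> tob Y'"]) simp_all
      have tt: "is_iso (D1 D) (t \<star>\<^bsub>D\<^esub> t)"
        by (rule P.is_iso_hcomp[OF t_iso t_iso]) (simp add: st)
      have "is_iso (D1 D) \<beta>"
        using assms(3) \<beta> by (auto simp: pseudo_products_def hom_set_def)
      then show ?thesis
        by (rule key[of "t \<star>\<^bsub>D\<^esub> t" \<beta>, rotated 4]) (use \<alpha> \<beta> t st tt in simp_all)
    next
      assume "\<alpha> \<in> hom_set (D1 D) (P.U0 (tob X)) (tob Y)"
      note \<alpha> = hom_setD[OF this]
      obtain \<beta> where \<beta>: "\<beta> \<in> Arr (D1 D)" "Dom (D1 D) \<beta> = P.U0 (tob X')" "Cod (D1 D) \<beta> = tob Y'"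
        by (rule P.H.terminal_arrow[OF Q.Y.terminal_tob, of "P.U0 (tob X')"]) simp_all
      have "is_iso (D1 D) \<beta>"
        using assms(3) \<beta> by (auto simp: pseudo_products_def hom_set_def)
      then show ?thesis
        by (rule key[of "P.U1 s" \<beta>, rotated 4]) (use \<alpha> \<beta> s P.is_iso_Uni[OF s_iso] in simp_all)
    qed
  qed
qed

section \<open>Local products by restriction\<close>

lemma has_finite_products_iff: "has_finite_products C \<longleftrightarrow> (\<exists>X. chosen_products C X)"
proof
  assume h: "has_finite_products C"
  then obtain I where I: "is_terminal C I" by (auto simp: has_finite_products_def)
  \<comment> \<open>The product object and its two projections are packed into one triple, so that a
    single choice function suffices.\<close>
  have "\<forall>A B. \<exists>z. A \<in> Obj C \<and> B \<in> Obj C \<longrightarrow> is_product C A B (fst z) (fst (snd z)) (snd (snd z))"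
    using h by (auto simp: has_finite_products_def)
  then obtain z where "\<forall>A B. A \<in> Obj C \<and> B \<in> Obj C \<longrightarrow>
      is_product C A B (fst (z A B)) (fst (snd (z A B))) (snd (snd (z A B)))"
    by metis
  then have "chosen_products C \<lparr>pob = (\<lambda>A B. fst (z A B)), pr1 = (\<lambda>A B. fst (snd (z A B))),
      pr2 = (\<lambda>A B. snd (snd (z A B))), tob = I\<rparr>"
    using I by (simp add: chosen_products_def)
  then show "\<exists>X. chosen_products C X" by blast
qed (unfold has_finite_products_def chosen_products_def, blast)

lemma fibrant_cleavage:
  assumes "fibrant D"
  obtains R where "cleavage D R"
proof -
  have "\<forall>f g M. \<exists>\<alpha>. niche D f g M \<longrightarrow>
      cartesian_cell D \<alpha> \<and> has_sides D \<alpha> f g \<and> Cod (D1 D) \<alpha> = M"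
    using assms by (auto simp: fibrant_def)
  then obtain R where "\<forall>f g M. niche D f g M \<longrightarrow>
      cartesian_cell D (R f g M) \<and> has_sides D (R f g M) f g \<and> Cod (D1 D) (R f g M) = M"
    by metis
  then show ?thesis using that by (simp add: cleavage_def)
qed

text \<open>A globular cell into the restriction along the diagonals \<open>d A\<close> and
  \<open>d B\<close> corresponds to a cell into \<open>pob Y M N\<close> with the diagonals as
  sides, hence to a pair of cells into \<open>M\<close> and \<open>N\<close> with identity
  sides.\<close>

lemma (in strict_products) local_product:
  assumes "fibrant D" "M \<in> Obj (hor_cat D A B)" "N \<in> Obj (hor_cat D A B)"
  shows "\<exists>P p q. is_product (hor_cat D A B) M N P p q"
proof -
  have MN: "M \<in> Obj (D1 D)" "S0 M = A" "T0 M = B" "N \<in> Obj (D1 D)" "S0 N = A" "T0 N = B"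
    using assms by simp_all
  then have AB: "A \<in> Obj (D0 D)" "B \<in> Obj (D0 D)" by auto
  interpret K: category "hor_cat D A B" by (rule category_hor_cat[OF AB])
  define d where "d = (\<lambda>A. pairing (D0 D) X (Ide (D0 D) A) (Ide (D0 D) A))"
  have d: "d C \<in> Arr (D0 D)" "Dom (D0 D) (d C) = C" "Cod (D0 D) (d C) = pob X C C"
    "pr1 X C C \<cdot>\<^bsub>D0 D\<^esub> d C = Ide (D0 D) C" "pr2 X C C \<cdot>\<^bsub>D0 D\<^esub> d C = Ide (D0 D) C"
    if "C \<in> Obj (D0 D)" for C
    using that by (simp_all add: d_def)
  obtain \<chi> where \<chi>: "cartesian_cell D \<chi>" "\<chi> \<in> Arr (D1 D)" "S1 \<chi> = d A" "T1 \<chi> = d B" "Cod (D1 D) \<chi> = pob Y M N"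
    "Dom (D1 D) \<chi> \<in> Obj (D1 D)" "S0 (Dom (D1 D) \<chi>) = Dom (D0 D) (d A)" "T0 (Dom (D1 D) \<chi>) = Dom (D0 D) (d B)"
    by (rule fibrant_restriction[OF assms(1), of "pob Y M N" "d A" "d B"]) (use MN AB d in simp_all)
  have "is_product (hor_cat D A B) M N (Dom (D1 D) \<chi>) (pr1 Y M N \<bullet> \<chi>) (pr2 Y M N \<bullet> \<chi>)"
  proof (rule K.is_productI)
    fix \<alpha> \<beta>
    assume "\<alpha> \<in> Arr (hor_cat D A B)" "\<beta> \<in> Arr (hor_cat D A B)"
      "Dom (hor_cat D A B) \<alpha> = Dom (hor_cat D A B) \<beta>" "Cod (hor_cat D A B) \<alpha> = M" "Cod (hor_cat D A B) \<beta> = N"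
    then have \<alpha>\<beta>: "\<alpha> \<in> Arr (D1 D)" "S1 \<alpha> = Ide (D0 D) A" "T1 \<alpha> = Ide (D0 D) B"
      "\<beta> \<in> Arr (D1 D)" "S1 \<beta> = Ide (D0 D) A" "T1 \<beta> = Ide (D0 D) B"
      "Dom (D1 D) \<alpha> = Dom (D1 D) \<beta>" "Cod (D1 D) \<alpha> = M" "Cod (D1 D) \<beta> = N"
      by simp_all
    obtain \<gamma> where \<gamma>: "\<gamma> \<in> Arr (D1 D)" "Dom (D1 D) \<gamma> = Dom (D1 D) (pairing (D1 D) Y \<alpha> \<beta>)" "Cod (D1 D) \<gamma> = Dom (D1 D) \<chi>"
        "S1 \<gamma> = Ide (D0 D) A" "T1 \<gamma> = Ide (D0 D) B" "\<chi> \<bullet> \<gamma> = pairing (D1 D) Y \<alpha> \<beta>"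
      by (rule cartesian_cell_lift[OF \<chi>(1), of "pairing (D1 D) Y \<alpha> \<beta>" "Ide (D0 D) A" "Ide (D0 D) B"])
        (use \<alpha>\<beta> \<chi> AB d in \<open>simp_all add: d_def\<close>)
    then show "\<exists>\<gamma>. \<gamma> \<in> Arr (hor_cat D A B) \<and> Dom (hor_cat D A B) \<gamma> = Dom (hor_cat D A B) \<beta> \<and>
        Cod (hor_cat D A B) \<gamma> = Dom (D1 D) \<chi> \<and> (pr1 Y M N \<bullet> \<chi>) \<cdot>\<^bsub>hor_cat D A B\<^esub> \<gamma> = \<alpha> \<and>
        (pr2 Y M N \<bullet> \<chi>) \<cdot>\<^bsub>hor_cat D A B\<^esub> \<gamma> = \<beta>"
      using \<chi> \<alpha>\<beta> MN by (intro exI[of _ \<gamma>]) (simp add: H.assoc_simp)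
  next
    fix x y
    assume "x \<in> Arr (hor_cat D A B)" "y \<in> Arr (hor_cat D A B)" "Dom (hor_cat D A B) x = Dom (hor_cat D A B) y"
      "Cod (hor_cat D A B) x = Dom (D1 D) \<chi>" "Cod (hor_cat D A B) y = Dom (D1 D) \<chi>"
      "(pr1 Y M N \<bullet> \<chi>) \<cdot>\<^bsub>hor_cat D A B\<^esub> x = (pr1 Y M N \<bullet> \<chi>) \<cdot>\<^bsub>hor_cat D A B\<^esub> y"
      "(pr2 Y M N \<bullet> \<chi>) \<cdot>\<^bsub>hor_cat D A B\<^esub> x = (pr2 Y M N \<bullet> \<chi>) \<cdot>\<^bsub>hor_cat D A B\<^esub> y"
    then have xy: "x \<in> Arr (D1 D)" "y \<in> Arr (D1 D)" "Dom (D1 D) x = Dom (D1 D) y"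
      "Cod (D1 D) x = Dom (D1 D) \<chi>" "Cod (D1 D) y = Dom (D1 D) \<chi>" "S1 x = S1 y" "T1 x = T1 y"
      "pr1 Y M N \<bullet> (\<chi> \<bullet> x) = pr1 Y M N \<bullet> (\<chi> \<bullet> y)" "pr2 Y M N \<bullet> (\<chi> \<bullet> x) = pr2 Y M N \<bullet> (\<chi> \<bullet> y)"
      using \<chi> MN by (simp_all add: H.assoc_simp)
    have "\<chi> \<bullet> x = \<chi> \<bullet> y"
      by (rule Y.proj_joint_mono[of M N]) (use xy \<chi> MN in simp_all)
    then show "x = y"
      by (rule cartesian_cell_mono[OF \<chi>(1) xy(1-7)])
  qed (use MN AB d \<chi> in simp_all)
  then show ?thesis by blast
qed

text \<open>The terminal object of \<open>D1\<close> is restricted along the unique vertical arrows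
  from \<open>A\<close> and \<open>B\<close> to the terminal object of \<open>D0\<close>; every cell
  into it from an arrow over \<open>A\<close> and \<open>B\<close> has these sides.\<close>

lemma (in strict_products) local_terminal:
  assumes "fibrant D" "A \<in> Obj (D0 D)" "B \<in> Obj (D0 D)"
  shows "\<exists>E. is_terminal (hor_cat D A B) E"
proof -
  obtain h where h: "h \<in> Arr (D0 D)" "Dom (D0 D) h = A" "Cod (D0 D) h = tob X"
    by (rule V.terminal_arrow[OF X.terminal_tob assms(2)])
  obtain k where k: "k \<in> Arr (D0 D)" "Dom (D0 D) k = B" "Cod (D0 D) k = tob X"
    by (rule V.terminal_arrow[OF X.terminal_tob assms(3)])
  obtain \<chi> where \<chi>: "cartesian_cell D \<chi>" "\<chi> \<in> Arr (D1 D)" "S1 \<chi> = h" "T1 \<chi> = k" "Cod (D1 D) \<chi> = tob Y"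
    "Dom (D1 D) \<chi> \<in> Obj (D1 D)" "S0 (Dom (D1 D) \<chi>) = Dom (D0 D) h" "T0 (Dom (D1 D) \<chi>) = Dom (D0 D) k"
    by (rule fibrant_restriction[OF assms(1), of "tob Y" h k]) (use h k in simp_all)
  have "is_terminal (hor_cat D A B) (Dom (D1 D) \<chi>)"
    unfolding is_terminal_def
  proof (intro conjI ballI)
    show "Dom (D1 D) \<chi> \<in> Obj (hor_cat D A B)" using \<chi> h k by simp
    fix M assume "M \<in> Obj (hor_cat D A B)"
    then have M: "M \<in> Obj (D1 D)" "S0 M = A" "T0 M = B" by simp_all
    obtain t where t: "t \<in> Arr (D1 D)" "Dom (D1 D) t = M" "Cod (D1 D) t = tob Y"
      by (rule H.terminal_arrow[OF Y.terminal_tob M(1)])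
    have st: "S1 t = h" "T1 t = k"
      by (rule V.terminal_unique[OF X.terminal_tob]; use t M h k in simp)+
    obtain \<gamma> where \<gamma>: "\<gamma> \<in> Arr (D1 D)" "Dom (D1 D) \<gamma> = Dom (D1 D) t" "Cod (D1 D) \<gamma> = Dom (D1 D) \<chi>"
        "S1 \<gamma> = Ide (D0 D) A" "T1 \<gamma> = Ide (D0 D) B" "\<chi> \<bullet> \<gamma> = t"
      by (rule cartesian_cell_lift[OF \<chi>(1), of t "Ide (D0 D) A" "Ide (D0 D) B"])
        (use t st \<chi> h k assms in simp_all)
    show "\<exists>!\<gamma>. \<gamma> \<in> hom_set (hor_cat D A B) M (Dom (D1 D) \<chi>)"
    proof (rule ex1I)
      show "\<gamma> \<in> hom_set (hor_cat D A B) M (Dom (D1 D) \<chi>)"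
        using \<gamma> t by (simp add: hom_set_def)
      fix \<gamma>' assume "\<gamma>' \<in> hom_set (hor_cat D A B) M (Dom (D1 D) \<chi>)"
      note \<gamma>' = hom_setD[OF this, simplified]
      have "\<chi> \<bullet> \<gamma>' = \<chi> \<bullet> \<gamma>"
        by (rule cell_to_tob_unique) (use \<gamma> \<gamma>' \<chi> t in simp_all)
      then show "\<gamma>' = \<gamma>"
        by (rule cartesian_cell_mono[OF \<chi>(1), rotated -1]) (use \<gamma>(1-5) \<gamma>' t in simp_all)
    qed
  qed
  then show ?thesis by blast
qed

text \<open>Laxness of both induced functors holds for any such products, so the two conditions
  differ only in how invertibility of the structure cells is expressed.\<close>

lemma (in local_products) pseudo_products_iff_double_functor:
  "pseudo_products D X (D1_products D X L R) \<longleftrightarrow>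
    double_functor (prod_dblcat D D) D (induced_times D X L R) \<and>
    double_functor unit_dblcat D (induced_terminal D X L)"
proof -
  let ?Y = "D1_products D X L R"
  interpret P: strict_products D X ?Y by (rule strict_products_D1_products)
  have Y: "tob ?Y = tob (L (tob X) (tob X))" by (simp add: D1_products_def Let_def)
  have L: "is_terminal (hor_cat D (tob X) (tob X)) (tob ?Y)"
    using chosen_L[of "tob X" "tob X"] by (simp add: Y chosen_products_def)
  define glob where "glob = (\<lambda>M. THE \<alpha>. \<alpha> \<in> hom_set (hor_cat D (tob X) (tob X)) M (tob ?Y))"
  \<comment> \<open>The definite description denotes a cell because \<open>tob ?Y\<close> is
    terminal in the hom-category over \<open>tob X\<close>.\<close>
  have glob: "glob M \<in> hom_set (hor_cat D (tob X) (tob X)) M (tob ?Y)"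
    if "M \<in> Obj (D1 D)" "S0 M = tob X" "T0 M = tob X" for M
    unfolding glob_def by (rule theI') (use L that in \<open>simp add: is_terminal_def\<close>)
  have it: "induced_terminal D X L =
      \<lparr>F0 = \<lparr>onO = (\<lambda>_. tob X), onA = (\<lambda>_. Ide (D0 D) (tob X))\<rparr>,
       F1 = \<lparr>onO = (\<lambda>_. tob ?Y), onA = (\<lambda>_. Ide (D1 D) (tob ?Y))\<rparr>,
       LComp = (\<lambda>_ _. glob (tob ?Y \<odot> tob ?Y)), LUnit = (\<lambda>_. glob (U0 (tob X)))\<rparr>"
    by (simp add: induced_terminal_def Let_def glob_def Y)
  have c: "glob (tob ?Y \<odot> tob ?Y) \<in> hom_set (hor_cat D (tob X) (tob X)) (tob ?Y \<odot> tob ?Y) (tob ?Y)"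
    "glob (U0 (tob X)) \<in> hom_set (hor_cat D (tob X) (tob X)) (U0 (tob X)) (tob ?Y)"
    by (rule glob; simp)+
  show ?thesis
  proof
    assume "pseudo_products D X ?Y"
    then show "double_functor (prod_dblcat D D) D (induced_times D X L R) \<and>
        double_functor unit_dblcat D (induced_terminal D X L)"
      using P.double_functor_lax_times P.double_functor_tob[OF it c] by (simp add: induced_times_eq)
  next
    assume a: "double_functor (prod_dblcat D D) D (induced_times D X L R) \<and>
        double_functor unit_dblcat D (induced_terminal D X L)"
    then have times: "\<forall>(M, N) \<in> Obj (composables (prod_dblcat D D)). is_iso (D1 D) (LComp (lax_times D X ?Y) M N)"
        "\<forall>A \<in> Obj (D0 (prod_dblcat D D)). is_iso (D1 D) (LUnit (lax_times D X ?Y) A)"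
      by (simp_all add: double_functor_def induced_times_eq)
    have "is_iso (D1 D) (LComp (lax_times D X ?Y) (M', N') (M, N))"
      if "(M', M) \<in> Obj (composables D)" "(N', N) \<in> Obj (composables D)" for M N M' N'
      using bspec[OF times(1), of "((M', N'), (M, N))"] that by simp
    moreover have "is_iso (D1 D) (LUnit (lax_times D X ?Y) (A, B))"
      if "A \<in> Obj (D0 D)" "B \<in> Obj (D0 D)" for A B
      using bspec[OF times(2), of "(A, B)"] that by simp
    moreover have "is_iso (D1 D) \<alpha>"
      if "\<alpha> \<in> hom_set (D1 D) (tob ?Y \<odot> tob ?Y) (tob ?Y) \<union> hom_set (D1 D) (U0 (tob X)) (tob ?Y)" for \<alpha>
    proof -
      \<comment> \<open>Arbitrary cells of \<open>D1\<close> are quantified over here, yet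
        terminality of \<open>tob ?Y\<close> in \<open>D1\<close> leaves only the globular
        ones.\<close>
      have "\<alpha> = glob (tob ?Y \<odot> tob ?Y) \<or> \<alpha> = glob (U0 (tob X))"
        using that c P.cell_to_tob_unique[of \<alpha> "glob (tob ?Y \<odot> tob ?Y)"] P.cell_to_tob_unique[of \<alpha> "glob (U0 (tob X))"]
        by (auto simp: hom_set_def)
      moreover have "is_iso (D1 D) (glob (tob ?Y \<odot> tob ?Y))" "is_iso (D1 D) (glob (U0 (tob X)))"
        using a by (auto simp: double_functor_def it)
      ultimately show ?thesis by auto
    qed
    ultimately show "pseudo_products D X ?Y" by (simp add: pseudo_products_def del: P.lax_times_simps)
  qed
qed

theorem corollary4p3p3:
  fixes D :: "('o, 'v, 'h, 'c) dblcat"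
  assumes "double_category D"
    and "fibrant D"
  shows "cartesian_dblcat D \<longleftrightarrow>
    has_finite_products (D0 D) \<and>
    (\<forall>A \<in> Obj (D0 D). \<forall>B \<in> Obj (D0 D). has_finite_products (hor_cat D A B)) \<and>
    (\<forall>X L R. chosen_products (D0 D) X \<and>
       (\<forall>A \<in> Obj (D0 D). \<forall>B \<in> Obj (D0 D). chosen_products (hor_cat D A B) (L A B)) \<and>
       cleavage D R \<longrightarrow>
       double_functor (prod_dblcat D D) D (induced_times D X L R) \<and>
       double_functor unit_dblcat D (induced_terminal D X L))"
    (is "_ \<longleftrightarrow> ?prod0 \<and> ?local \<and> ?pseudo")
proof -
  interpret double_category D by fact
  have local_productsI: "local_products D X L R"
    if "chosen_products (D0 D) X" "cleavage D R"
      "\<forall>A \<in> Obj (D0 D). \<forall>B \<in> Obj (D0 D). chosen_products (hor_cat D A B) (L A B)" for X L R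
    by unfold_locales (use that assms(2) in auto)
  show ?thesis
  proof
    assume "cartesian_dblcat D"
    then obtain X' Y' where s: "strict_products D X' Y'" and p: "pseudo_products D X' Y'"
      by (rule cartesian_pseudo_products)
    interpret P: strict_products D X' Y' by (rule s)
    have ?prod0 using P.chosen_X by (auto simp: has_finite_products_iff)
    moreover have ?local
      using P.local_product[OF assms(2)] P.local_terminal[OF assms(2)] unfolding has_finite_products_def by blast
    moreover have ?pseudo
    proof (intro allI impI, elim conjE)
      fix X L R assume "chosen_products (D0 D) X" "cleavage D R"
        "\<forall>A \<in> Obj (D0 D). \<forall>B \<in> Obj (D0 D). chosen_products (hor_cat D A B) (L A B)"
      then interpret Q: local_products D X L R by (rule local_productsI)
      show "double_functor (prod_dblcat D D) D (induced_times D X L R) \<and>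
          double_functor unit_dblcat D (induced_terminal D X L)"
        \<comment> \<open>The given \<open>X\<close>, \<open>L\<close>, \<open>R\<close> need not be
          related to the adjunction; invertibility is carried over from the products
          \<open>X'\<close>, \<open>Y'\<close> that the adjunction provides.\<close>
        unfolding Q.pseudo_products_iff_double_functor[symmetric]
        by (rule pseudo_products_transfer[OF Q.strict_products_D1_products s p])
    qed
    ultimately show "?prod0 \<and> ?local \<and> ?pseudo" by blast
  next
    assume h: "?prod0 \<and> ?local \<and> ?pseudo"
    then obtain X where X: "chosen_products (D0 D) X" by (auto simp: has_finite_products_iff)
    have "\<forall>A B. \<exists>W. A \<in> Obj (D0 D) \<and> B \<in> Obj (D0 D) \<longrightarrow> chosen_products (hor_cat D A B) W"
      using h by (auto simp: has_finite_products_iff)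
    then obtain L where L: "\<forall>A \<in> Obj (D0 D). \<forall>B \<in> Obj (D0 D). chosen_products (hor_cat D A B) (L A B)"
      by metis
    obtain R where R: "cleavage D R" using assms(2) by (rule fibrant_cleavage)
    interpret Q: local_products D X L R by (rule local_productsI[OF X R L])
    interpret P: strict_products D X "D1_products D X L R" by (rule Q.strict_products_D1_products)
    have "pseudo_products D X (D1_products D X L R)"
      unfolding Q.pseudo_products_iff_double_functor using h X L R by blast
    then show "cartesian_dblcat D" by (rule P.cartesian_if_pseudo_products)
  qed
qed

end
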